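(* Let $(u,v)$ be a bounded solution of the system $$\begin{cases}-\Delta u=uv^2 & \text{in }\mathbb{R}^3,\\ -\Delta v=u^2v & \text{in }\mathbb{R}^3.\end{cases}$$ If $(u,v)$ has finite Morse index, then $u\equiv v\equiv0$.
   Context: Solutions are real-valued pairs $(u,v)\in H^1_{loc}(\mathbb{R}^3)\times H^1_{loc}(\mathbb{R}^3)$ (no sign condition is imposed), satisfying the equations weakly. Bounded means $u,v\in L^\infty(\mathbb{R}^3)$. The Morse index of $(u,v)$ is the maximal dimension of a subspace $W\subset C_c^1(\mathbb{R}^3)\times C_c^1(\mathbb{R}^3)$ such that $\tilde Q_{u,v}(\phi,\psi)<0$ for every nonzero $(\phi,\psi)\in W$, where $$\tilde Q_{u,v}(\phi,\psi)=\int_{\mathbb{R}^3}(|\nabla\phi|^2+|\nabla\psi|^2)dx-\int_{\mathbb{R}^3}\left(v^2\phi^2+u^2\psi^2+4uv\phi\psi\right)dx.$$ *)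

theory Defs
  imports "HOL-Analysis.Analysis" "HOL-Library.Function_Algebras" "HOL-Library.Extended_Nat"
begin

type_synonym R3 = "real ^ 3"

text \<open>Pointwise scalar multiplication, so that spaces of functions, and pairs of functions,
  are real vector spaces with the library notions of subspace, span and dimension.\<close>

instantiation "fun" :: (type, scaleR) scaleR
begin

definition scaleR_fun_def: "c *\<^sub>R f = (\<lambda>x. c *\<^sub>R f x)"

instance ..

end

lemma scaleR_fun_apply [simp]: "(c *\<^sub>R f) x = c *\<^sub>R f x"
  by (simp add: scaleR_fun_def)

instance "fun" :: (type, real_vector) real_vector
  by standard (simp_all add: fun_eq_iff scaleR_add_right scaleR_add_left)


section \<open>Test functions\<close>

definition grad :: "(R3 \<Rightarrow> real) \<Rightarrow> R3 \<Rightarrow> R3" where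
  "grad f x = (THE D. GDERIV f x :> D)"

lemma grad_eqI:
  assumes "GDERIV f x :> D"
  shows "grad f x = D"
  unfolding grad_def
proof (rule the_equality)
  fix D' assume "GDERIV f x :> D'"
  with assms have "(\<lambda>h. h \<bullet> D') = (\<lambda>h. h \<bullet> D)"
    unfolding gderiv_def by (rule has_derivative_unique[rotated])
  then show "D' = D"
    by (metis vector_eq_ldot)
qed (fact assms)

definition C1c :: "(R3 \<Rightarrow> real) set" where
  "C1c = {\<phi>. (\<exists>g. (\<forall>x. GDERIV \<phi> x :> g x) \<and> continuous_on UNIV g)
            \<and> compact (closure {x. \<phi> x \<noteq> 0})}"


section \<open>Local Lebesgue and Sobolev spaces\<close>

text \<open>Elements of these spaces are represented by Lebesgue measurable functions defined
  everywhere; statements about them are invariant under changes on null sets.\<close>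

definition L1_loc :: "(R3 \<Rightarrow> 'a::euclidean_space) set" where
  "L1_loc = {f. \<forall>K. compact K \<longrightarrow> set_integrable lebesgue K f}"

definition L2_loc :: "(R3 \<Rightarrow> 'a::euclidean_space) set" where
  "L2_loc = {f \<in> borel_measurable lebesgue.
     \<forall>K. compact K \<longrightarrow> set_integrable lebesgue K (\<lambda>x. (norm (f x))\<^sup>2)}"

definition L_infinity :: "(R3 \<Rightarrow> real) set" where
  "L_infinity = {f \<in> borel_measurable lebesgue. \<exists>C. AE x in lebesgue. \<bar>f x\<bar> \<le> C}"

text \<open>For locally integrable functions, testing against continuously differentiable or against
  smooth functions of compact support gives the same weak derivatives and, below, the same
  weak solutions.\<close>

definition has_weak_gradient :: "(R3 \<Rightarrow> real) \<Rightarrow> (R3 \<Rightarrow> R3) \<Rightarrow> bool" where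
  "has_weak_gradient u g \<longleftrightarrow> u \<in> L1_loc \<and> g \<in> L1_loc \<and>
     (\<forall>\<eta>\<in>C1c. (\<integral>x. u x *\<^sub>R grad \<eta> x \<partial>lebesgue) = - (\<integral>x. \<eta> x *\<^sub>R g x \<partial>lebesgue))"

definition H1_loc :: "(R3 \<Rightarrow> real) set" where
  "H1_loc = {u \<in> L2_loc. \<exists>g \<in> L2_loc. has_weak_gradient u g}"


section \<open>Weak solutions and Morse index\<close>

text \<open>The function \<open>u\<close> solves \<open>-\<Delta>u = f\<close> weakly. The weak gradient is unique almost
  everywhere, so it does not matter which one is chosen.\<close>

definition weakly_solves_poisson :: "(R3 \<Rightarrow> real) \<Rightarrow> (R3 \<Rightarrow> real) \<Rightarrow> bool" where
  "weakly_solves_poisson u f \<longleftrightarrow> f \<in> L1_loc \<and>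
     (\<exists>g. has_weak_gradient u g \<and>
       (\<forall>\<eta>\<in>C1c. (\<integral>x. g x \<bullet> grad \<eta> x \<partial>lebesgue) = (\<integral>x. f x * \<eta> x \<partial>lebesgue)))"

definition weak_solution :: "(R3 \<Rightarrow> real) \<Rightarrow> (R3 \<Rightarrow> real) \<Rightarrow> bool" where
  "weak_solution u v \<longleftrightarrow> u \<in> H1_loc \<and> v \<in> H1_loc \<and>
     weakly_solves_poisson u (\<lambda>x. u x * (v x)\<^sup>2) \<and>
     weakly_solves_poisson v (\<lambda>x. (u x)\<^sup>2 * v x)"

definition Q_form ::
  "(R3 \<Rightarrow> real) \<Rightarrow> (R3 \<Rightarrow> real) \<Rightarrow> (R3 \<Rightarrow> real) \<times> (R3 \<Rightarrow> real) \<Rightarrow> real" where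
  "Q_form u v = (\<lambda>(\<phi>, \<psi>).
     (\<integral>x. (norm (grad \<phi> x))\<^sup>2 + (norm (grad \<psi> x))\<^sup>2 \<partial>lebesgue) -
     (\<integral>x. (v x)\<^sup>2 * (\<phi> x)\<^sup>2 + (u x)\<^sup>2 * (\<psi> x)\<^sup>2 + 4 * u x * v x * \<phi> x * \<psi> x \<partial>lebesgue))"

text \<open>The library function \<^const>\<open>dim\<close> is not meaningful for infinite-dimensional
  spaces; these get dimension \<open>\<infinity>\<close> here.\<close>

definition edim :: "'a::real_vector set \<Rightarrow> enat" where
  "edim W = (if \<exists>B. finite B \<and> W \<subseteq> span B then enat (dim W) else \<infinity>)"

definition morse_index :: "(R3 \<Rightarrow> real) \<Rightarrow> (R3 \<Rightarrow> real) \<Rightarrow> enat" where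
  "morse_index u v =
     (SUP W \<in> {W. subspace W \<and> W \<subseteq> C1c \<times> C1c \<and> (\<forall>w\<in>W. w \<noteq> 0 \<longrightarrow> Q_form u v w < 0)}. edim W)"

end

theory Submission
  imports Defs
begin

text \<open>
  Finite Morse index makes the solution stable outside a ball: otherwise a maximal negative
  subspace could be enlarged by a test pair with disjoint support. Testing stability with
  \<open>(\<phi>, 0)\<close>, \<open>(0, \<phi>)\<close> and with \<open>(u \<phi>, v \<phi>)\<close>, and using the equations, gives
  \<open>\<integral>(u\<^sup>2 + v\<^sup>2) \<phi>\<^sup>2 \<le> 2 \<integral>|\<nabla>\<phi>|\<^sup>2\<close> and
  \<open>4 \<integral>u\<^sup>2 v\<^sup>2 \<phi>\<^sup>2 \<le> \<integral>(u\<^sup>2 + v\<^sup>2) |\<nabla>\<phi>|\<^sup>2\<close> for cutoffs vanishing on the ball. In dimension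
  three these yield \<open>\<integral>\<^bsub>B\<^sub>R\<^esub> (u\<^sup>2 + v\<^sup>2) = O(R)\<close> and \<open>u\<^sup>2 v\<^sup>2 \<in> L\<^sup>1\<close>. Comparing the energy identity
  \<open>\<integral>|\<nabla>u|\<^sup>2 + |\<nabla>v|\<^sup>2 = 2 \<integral>u\<^sup>2 v\<^sup>2\<close> with the Pohozaev identity
  \<open>\<integral>|\<nabla>u|\<^sup>2 + |\<nabla>v|\<^sup>2 = 3 \<integral>u\<^sup>2 v\<^sup>2\<close> forces \<open>u v = 0\<close>; then \<open>u\<close> and \<open>v\<close> have zero gradient, and a
  nonzero constant would violate the linear growth.

  No regularity theory is needed: \<open>u\<close> and \<open>v\<close> are mollified, the mollifications satisfy
  \<open>-\<Delta>U = F\<close> classically with bounded \<open>F\<close>, the identities are derived for them, and only \<open>U\<close>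
  and \<open>F\<close> (never the gradients) have to converge, boundedly almost everywhere.
\<close>

section \<open>Continuously differentiable functions and integration by parts\<close>

text \<open>The constants come from homogeneity and dimension. Tested with
  \<open>(u \<phi>, v \<phi>)\<close>, the potential part of the form is (1 + 1 + 4) u^2 v^2, of
  which the equations give back 2; hence the 4. A cutoff at radius R has gradient of order 1/R on a
  volume R^3, which gives the growth R; inserted in the second inequality this becomes R^-2 times R.
  In dimension n the Pohozaev factor is n/(n - 2), which equals the energy factor 2 only for n = 4.
  The obstacle is the cutoff error in the Pohozaev identity: it involves the gradients squared, for
  which no decay is known beforehand. The cutoff is chosen so that its radial derivative, -8
  \<open>zeta\<close>, is again an admissible weight for the energy identity. This turns the error
  into integrals of u^2 v^2 \<open>zeta\<close> plus O(1/R), and these vanish because u^2 v^2 is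
  integrable and \<open>zeta\<close> tends to 0 pointwise. Mollified pairs solve the system only up
  to a defect, which appears multiplied by x . grad U. Young's inequality with a parameter t
  separates the factors; the defect disappears in the limit of the mollification, and t tends to 0
  afterwards.\<close>

lemma integrable_indicator_cball:
  "integrable lebesgue (\<lambda>x::'a::euclidean_space. indicat_real (cball 0 R) x * C)"
  by (intro integrable_mult_left integrable_real_indicator)
    (use emeasure_bounded_finite[OF bounded_cball[of "0::'a" R]] in auto)

lemma integrable_bounded_support:
  fixes f :: "'a::euclidean_space \<Rightarrow> 'b::{banach, second_countable_topology}"
  assumes f: "f \<in> borel_measurable lebesgue" and bd: "\<And>x. norm (f x) \<le> C"
    and sup: "\<And>x. x \<notin> cball 0 R \<Longrightarrow> f x = 0"
  shows "integrable lebesgue f"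
proof (rule Bochner_Integration.integrable_bound)
  show "integrable lebesgue (\<lambda>x. indicat_real (cball 0 R) x * C)"
    by (rule integrable_indicator_cball)
  show "AE x in lebesgue. norm (f x) \<le> norm (indicat_real (cball 0 R) x * C)"
    by (rule AE_I2) (metis abs_ge_self bd indicator_simps(1) indicator_simps(2) mult_1 mult_zero_left
        norm_zero order_refl order_trans real_norm_def sup)
qed (fact f)

lemma bounded_support_obtain:
  fixes f :: "'a::euclidean_space \<Rightarrow> 'b::zero"
  assumes "bounded {x. f x \<noteq> 0}"
  obtains R where "R > 0" "\<And>x. x \<notin> cball 0 R \<Longrightarrow> f x = 0"
proof -
  obtain R where R: "\<And>x. f x \<noteq> 0 \<Longrightarrow> norm x \<le> R"
    using assms unfolding bounded_iff by auto
  show thesis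
    by (rule that[of "max R 1"]) (use R in \<open>force simp: not_le\<close>)+
qed

lemma continuous_support_bounded:
  fixes f :: "'a::euclidean_space \<Rightarrow> 'b::real_normed_vector"
  assumes "continuous_on UNIV f" "bounded {x. f x \<noteq> 0}"
  obtains B where "B > 0" "\<And>x. norm (f x) \<le> B"
proof -
  obtain R where R: "\<And>x. x \<notin> cball 0 R \<Longrightarrow> f x = 0"
    using bounded_support_obtain[OF assms(2)] by blast
  have "compact (f ` cball 0 R)"
    by (rule compact_continuous_image) (use assms continuous_on_subset in auto)
  then obtain B where B: "B > 0" "\<And>x. x \<in> cball 0 R \<Longrightarrow> norm (f x) \<le> B"
    using compact_imp_bounded bounded_pos by (metis imageI)
  have "norm (f x) \<le> B" for x
    using B R[of x] by (cases "x \<in> cball 0 R") auto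
  with B(1) show thesis by (rule that)
qed

lemma continuous_imp_lebesgue_measurable:
  fixes f :: "'a::euclidean_space \<Rightarrow> 'b::{metric_space, second_countable_topology}"
  shows "continuous_on UNIV f \<Longrightarrow> f \<in> borel_measurable lebesgue"
  by (simp add: borel_measurable_continuous_onI measurable_completion)

lemma integrable_continuous_support:
  fixes f :: "'a::euclidean_space \<Rightarrow> 'b::euclidean_space"
  assumes "continuous_on UNIV f" "bounded {x. f x \<noteq> 0}"
  shows "integrable lebesgue f"
proof -
  obtain R where R: "\<And>x. x \<notin> cball 0 R \<Longrightarrow> f x = 0"
    using bounded_support_obtain[OF assms(2)] by blast
  obtain B where B: "\<And>x. norm (f x) \<le> B"
    using continuous_support_bounded[OF assms] by blast
  show ?thesis
    by (rule integrable_bounded_support[OF continuous_imp_lebesgue_measurable[OF assms(1)] B R])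
qed

abbreviation cball_ind :: "real \<Rightarrow> R3 \<Rightarrow> real" where
  "cball_ind R \<equiv> indicat_real (cball 0 R)"

text \<open>The gradient is an explicit argument, so that the rules below compute it along with the
  function. \<open>grad\<close> is a definite description and is reached only through
  \<open>is_C1_grad\<close>.\<close>

definition is_C1 :: "(R3 \<Rightarrow> real) \<Rightarrow> (R3 \<Rightarrow> R3) \<Rightarrow> bool" where
  "is_C1 w g \<longleftrightarrow> (\<forall>x. GDERIV w x :> g x) \<and> continuous_on UNIV g"

lemma is_C1_grad: "is_C1 w g \<Longrightarrow> grad w = g"
  by (auto simp: is_C1_def intro: grad_eqI)

lemma is_C1_continuous: "is_C1 w g \<Longrightarrow> continuous_on UNIV w"
  unfolding is_C1_def gderiv_def
  by (metis has_derivative_continuous continuous_at_imp_continuous_on)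

lemma is_C1_continuous_grad: "is_C1 w g \<Longrightarrow> continuous_on UNIV g"
  by (simp add: is_C1_def)

lemma is_C1_const: "is_C1 (\<lambda>x. c) (\<lambda>x. 0)"
  by (simp add: is_C1_def GDERIV_const)

lemma is_C1_add:
  "is_C1 w g \<Longrightarrow> is_C1 w' g' \<Longrightarrow> is_C1 (\<lambda>x. w x + w' x) (\<lambda>x. g x + g' x)"
  by (auto simp: is_C1_def intro!: GDERIV_add continuous_intros)

lemma is_C1_sum:
  "(\<And>i. i \<in> I \<Longrightarrow> is_C1 (w i) (g i)) \<Longrightarrow> is_C1 (\<lambda>x. \<Sum>i\<in>I. w i x) (\<lambda>x. \<Sum>i\<in>I. g i x)"
  by (induction I rule: infinite_finite_induct) (auto intro: is_C1_const is_C1_add)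

lemma is_C1_mult:
  assumes "is_C1 w g" "is_C1 w' g'"
  shows "is_C1 (\<lambda>x. w x * w' x) (\<lambda>x. w x *\<^sub>R g' x + w' x *\<^sub>R g x)"
  using assms is_C1_continuous[OF assms(1)] is_C1_continuous[OF assms(2)]
  by (auto simp: is_C1_def intro!: GDERIV_mult continuous_intros)

lemma is_C1_compose:
  assumes w: "is_C1 w g" and "\<And>t. (F has_real_derivative F' t) (at t)" "continuous_on UNIV F'"
  shows "is_C1 (\<lambda>x. F (w x)) (\<lambda>x. F' (w x) *\<^sub>R g x)"
proof -
  have "continuous_on UNIV (\<lambda>x. F' (w x))"
    by (rule continuous_on_compose2[OF assms(3) is_C1_continuous[OF w]]) auto
  then show ?thesis
    using assms by (auto simp: is_C1_def intro!: continuous_intros intro: GDERIV_DERIV_compose)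
qed

lemma is_C1_cmult: "is_C1 w g \<Longrightarrow> is_C1 (\<lambda>x. c * w x) (\<lambda>x. c *\<^sub>R g x)"
  using is_C1_mult[OF is_C1_const[of c]] by simp

lemma is_C1_uminus: "is_C1 w g \<Longrightarrow> is_C1 (\<lambda>x. - w x) (\<lambda>x. - g x)"
  using is_C1_cmult[of w g "-1"] by simp

lemma is_C1_power2:
  assumes "is_C1 w g"
  shows "is_C1 (\<lambda>x. (w x)\<^sup>2) (\<lambda>x. (2 * w x) *\<^sub>R g x)"
  using is_C1_mult[OF assms assms] by (simp add: power2_eq_square flip: scaleR_left_distrib)

lemma is_C1_nth: "is_C1 (\<lambda>x. x $ i) (\<lambda>x. axis i 1)"
  by (auto simp: is_C1_def gderiv_def inner_axis intro!: bounded_linear_imp_has_derivative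
      bounded_linear_vec_nth)

lemma is_C1_norm2: "is_C1 (\<lambda>x. (norm x)\<^sup>2) (\<lambda>x. 2 *\<^sub>R x)"
  by (auto simp: is_C1_def gderiv_def power2_norm_eq_inner inner_commute
      intro!: continuous_intros derivative_eq_intros)

lemma is_C1_cong: "is_C1 w g \<Longrightarrow> (\<And>x. w x = w' x) \<Longrightarrow> (\<And>x. g x = g' x) \<Longrightarrow> is_C1 w' g'"
  by (metis ext)

lemma is_C1_zero_on_open:
  assumes w: "is_C1 w g" and S: "open S" "x \<in> S" and z: "\<And>y. y \<in> S \<Longrightarrow> w y = 0"
  shows "g x = 0"
proof -
  have "FDERIV w x :> (\<lambda>h. h \<bullet> g x)"
    using w by (simp add: is_C1_def gderiv_def)
  then have "FDERIV (\<lambda>x. 0) x :> (\<lambda>h. h \<bullet> g x)"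
    by (rule has_derivative_transform_within_open[OF _ S]) (use z in auto)
  then have "(\<lambda>h. h \<bullet> g x) = (\<lambda>h. 0)"
    by (rule has_derivative_unique) simp
  then show ?thesis
    by (metis inner_eq_zero_iff)
qed

lemma is_C1_zero_outside:
  assumes w: "is_C1 w g" and z: "\<And>x. x \<notin> cball 0 R \<Longrightarrow> w x = 0" and x: "x \<notin> cball 0 R"
  shows "g x = 0"
  by (rule is_C1_zero_on_open[OF w, of "- cball 0 R"]) (use x z in auto)

lemma is_C1_support:
  assumes w: "is_C1 w g" and "bounded {x. w x \<noteq> 0}"
  shows "bounded {x. g x \<noteq> 0}"
proof -
  obtain R where R: "\<And>x. x \<notin> cball 0 R \<Longrightarrow> w x = 0"
    using bounded_support_obtain[OF assms(2)] by blast
  show ?thesis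
    by (rule bounded_subset[OF bounded_cball[of 0 R]]) (use is_C1_zero_outside[OF w R] in blast)
qed

lemma C1c_I:
  assumes "is_C1 w g" "bounded {x. w x \<noteq> 0}"
  shows "w \<in> C1c"
  using assms by (auto simp: C1c_def is_C1_def compact_closure)

lemma C1c_D:
  assumes "w \<in> C1c"
  shows "is_C1 w (grad w)" "bounded {x. w x \<noteq> 0}"
proof -
  obtain g where g: "is_C1 w g" and "compact (closure {x. w x \<noteq> 0})"
    using assms by (auto simp: C1c_def is_C1_def)
  then show "is_C1 w (grad w)" "bounded {x. w x \<noteq> 0}"
    by (simp_all add: is_C1_grad[OF g] compact_closure)
qed

lemma is_C1_lipschitz:
  assumes w: "is_C1 w g" and B: "\<And>x. norm (g x) \<le> B"
  shows "\<bar>w y - w x\<bar> \<le> B * norm (y - x)"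
proof -
  have "norm (w y - w x) \<le> B * norm (y - x)"
  proof (rule differentiable_bound)
    show "\<And>z. z \<in> UNIV \<Longrightarrow> (w has_derivative (\<lambda>h. h \<bullet> g z)) (at z within UNIV)"
      using w by (simp add: is_C1_def gderiv_def)
    show "onorm (\<lambda>h. h \<bullet> g z) \<le> B" for z
      using B[of z] onorm_inner_left[OF bounded_linear_ident, of "g z"] onorm_id_le
      by (smt (verit, ccfv_SIG) Cauchy_Schwarz_ineq2 mult.commute mult_left_mono norm_ge_zero
          onorm_le real_norm_def mult_right_mono)
  qed auto
  then show ?thesis by simp
qed

section \<open>Translation invariance and the divergence theorem\<close>

lemma lebesgue_integral_translation:
  fixes f :: "'a::euclidean_space \<Rightarrow> 'b::euclidean_space"
  assumes "f \<in> borel_measurable borel"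
  shows "(LINT x|lebesgue. f (x + c)) = (LINT x|lebesgue. f x)"
proof -
  have "(LINT x|lborel. f (x + c)) = (LINT x|(distr lborel borel ((+) c)). f x)"
    by (subst integral_distr) (use assms in \<open>auto simp: add.commute\<close>)
  then show ?thesis
    using assms by (simp add: lborel_distr_plus integral_completion)
qed

text \<open>Translation invariance does the work: the difference quotients in direction
  \<open>e\<close> have integral 0 and converge to \<open>g x \<bullet> e\<close>. As
  \<open>t n \<le> 1\<close>, they live on the ball of radius \<open>R + norm e\<close>, where the
  Lipschitz bound \<open>B * norm e\<close> dominates them.\<close>

lemma integral_grad_zero:
  assumes w: "is_C1 w g" and s: "bounded {x. w x \<noteq> 0}"
  shows "(LINT x|lebesgue. g x \<bullet> e) = 0"
proof -
  note contw = is_C1_continuous[OF w]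
  obtain R where R: "R > 0" "\<And>x. x \<notin> cball 0 R \<Longrightarrow> w x = 0"
    using bounded_support_obtain[OF s] by blast
  have contg: "continuous_on UNIV g" using w by (simp add: is_C1_def)
  obtain B where B: "B > 0" "\<And>x. norm (g x) \<le> B"
    using continuous_support_bounded[OF contg is_C1_support[OF w s]] by blast
  define t where "t n = inverse (real (Suc n))" for n
  define q where "q n x = (w (x + t n *\<^sub>R e) - w x) / t n" for n x
  have t0: "t n > 0" and t1: "t n \<le> 1" for n
    by (auto simp: t_def field_simps)
  have tlim: "t \<longlonglongrightarrow> 0"
    unfolding t_def using LIMSEQ_inverse_real_of_nat .
  have cq: "continuous_on UNIV (\<lambda>x. w (x + c))" for c
    by (rule continuous_on_compose2[OF contw]) (auto intro!: continuous_intros)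
  have "(\<lambda>n. LINT x|lebesgue. q n x) \<longlonglongrightarrow> (LINT x|lebesgue. g x \<bullet> e)"
  proof (rule integral_dominated_convergence[where w="\<lambda>x. cball_ind (R + norm e) x * (B * norm e)"])
    show "(\<lambda>x. g x \<bullet> e) \<in> borel_measurable lebesgue"
      by (intro continuous_imp_lebesgue_measurable continuous_intros contg)
    show "q n \<in> borel_measurable lebesgue" for n
      unfolding q_def using t0[of n]
      by (intro continuous_imp_lebesgue_measurable continuous_intros cq contw) auto
    show "integrable lebesgue (\<lambda>x. cball_ind (R + norm e) x * (B * norm e))"
      by (rule integrable_indicator_cball)
    show "AE x in lebesgue. (\<lambda>n. q n x) \<longlonglongrightarrow> g x \<bullet> e"
    proof (rule AE_I2)
      fix x
      have "((\<lambda>x. w x) has_derivative (\<lambda>h. h \<bullet> g x)) (at (x + 0 *\<^sub>R e))"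
        using w by (simp add: is_C1_def gderiv_def)
      then have "((\<lambda>s. w (x + s *\<^sub>R e)) has_derivative (\<lambda>s. (s *\<^sub>R e) \<bullet> g x)) (at 0)"
        by (rule has_derivative_compose[rotated]) (auto intro!: derivative_eq_intros)
      then have "((\<lambda>s. w (x + s *\<^sub>R e)) has_real_derivative (g x \<bullet> e)) (at 0)"
        by (simp add: has_field_derivative_def inner_commute mult_commute_abs)
      then have "((\<lambda>s. (w (x + s *\<^sub>R e) - w x) / s) \<longlongrightarrow> g x \<bullet> e) (at 0)"
        by (simp add: DERIV_def)
      moreover have "filterlim t (at 0) sequentially"
        using tlim t0 by (simp add: filterlim_at less_imp_neq[THEN not_sym])
      ultimately show "(\<lambda>n. q n x) \<longlonglongrightarrow> g x \<bullet> e"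
        unfolding q_def by (rule filterlim_compose)
    qed
    show "AE x in lebesgue. norm (q n x) \<le> cball_ind (R + norm e) x * (B * norm e)" for n
    proof (rule AE_I2)
      fix x
      have le: "norm (t n *\<^sub>R e) \<le> norm e"
        using t0[of n] t1[of n] by (simp add: mult_left_le_one_le)
      show "norm (q n x) \<le> cball_ind (R + norm e) x * (B * norm e)"
      proof (cases "x \<in> cball 0 (R + norm e)")
        case True
        have "\<bar>w (x + t n *\<^sub>R e) - w x\<bar> \<le> B * (t n * norm e)"
          using is_C1_lipschitz[OF w B(2), of "x + t n *\<^sub>R e" x] t0[of n] by simp
        then show ?thesis
          using True t0[of n] by (simp add: q_def field_simps)
      next
        case False
        then have "norm x > R + norm e" by simp
        moreover have "norm x \<le> norm (x + t n *\<^sub>R e) + norm (t n *\<^sub>R e)"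
          using norm_triangle_ineq4[of "x + t n *\<^sub>R e" "t n *\<^sub>R e"] by simp
        ultimately have "norm x > R" "norm (x + t n *\<^sub>R e) > R"
          using le norm_ge_zero[of e] by linarith+
        then have "w x = 0" "w (x + t n *\<^sub>R e) = 0"
          by (auto intro!: R(2))
        then show ?thesis using B(1) by (simp add: q_def)
      qed
    qed
  qed
  moreover have "(LINT x|lebesgue. q n x) = 0" for n
  proof -
    have b: "bounded {x. w (x + c) \<noteq> 0}" for c
    proof -
      have "{x. w (x + c) \<noteq> 0} \<subseteq> (\<lambda>x. x - c) ` {x. w x \<noteq> 0}"
        by (auto simp: image_iff intro!: exI[of _ "_ + c"])
      then show ?thesis
        using bounded_translation_minus[OF s, of c] bounded_subset by blast
    qed
    have "(LINT x|lebesgue. w (x + t n *\<^sub>R e) - w x) = 0"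
      using lebesgue_integral_translation[OF borel_measurable_continuous_onI[OF contw], of "t n *\<^sub>R e"]
      by (subst Bochner_Integration.integral_diff)
        (auto intro!: integrable_continuous_support cq contw b s)
    then show ?thesis
      by (simp add: q_def)
  qed
  ultimately show ?thesis
    by (simp add: LIMSEQ_const_iff)
qed

text \<open>The divergence theorem for the compactly supported field \<open>a Y\<close>, where
  \<open>DY x $ i\<close> is row \<open>i\<close> of the Jacobian of \<open>Y\<close>. Each identity
  below is obtained by choosing \<open>a\<close> and \<open>Y\<close>. The form
  \<open>has_bochner_integral\<close> lets such identities be combined linearly without separate
  integrability proofs.\<close>

lemma has_integral_div_zero:
  fixes a :: "R3 \<Rightarrow> real" and Y :: "R3 \<Rightarrow> R3" and DY :: "R3 \<Rightarrow> real^3^3"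
  assumes a: "is_C1 a ga" and Y: "\<And>i. is_C1 (\<lambda>x. Y x $ i) (\<lambda>x. DY x $ i)"
    and s: "bounded {x. a x *\<^sub>R Y x \<noteq> 0}"
  shows "has_bochner_integral lebesgue (\<lambda>x. ga x \<bullet> Y x + a x * trace (DY x)) 0"
proof -
  let ?G = "\<lambda>i x. a x *\<^sub>R DY x $ i + Y x $ i *\<^sub>R ga x"
  have C: "is_C1 (\<lambda>x. a x * Y x $ i) (?G i)" for i
    by (rule is_C1_mult[OF a Y])
  have b: "bounded {x. a x * Y x $ i \<noteq> 0}" for i
    by (rule bounded_subset[OF s]) (auto simp: vec_eq_iff)
  have int: "integrable lebesgue (\<lambda>x. ?G i x \<bullet> axis i 1)" for i
  proof (rule integrable_continuous_support)
    show "continuous_on UNIV (\<lambda>x. ?G i x \<bullet> axis i 1)"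
      by (intro continuous_intros is_C1_continuous_grad[OF C])
    show "bounded {x. ?G i x \<bullet> axis i 1 \<noteq> 0}"
      by (rule bounded_subset[OF is_C1_support[OF C[of i] b[of i]]]) auto
  qed
  have "has_bochner_integral lebesgue (\<lambda>x. ?G i x \<bullet> axis i 1) 0" for i
    using has_bochner_integral_integrable[OF int[of i]] by (simp add: integral_grad_zero[OF C b])
  then have "has_bochner_integral lebesgue (\<lambda>x. \<Sum>i\<in>UNIV. ?G i x \<bullet> axis i 1) (\<Sum>i\<in>(UNIV::3 set). 0)"
    by (rule has_bochner_integral_sum)
  moreover have "(\<Sum>i\<in>UNIV. ?G i x \<bullet> axis i 1) = ga x \<bullet> Y x + a x * trace (DY x)" for x
    by (simp add: inner_add_left inner_axis sum.distrib sum_distrib_left trace_def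
        inner_vec_def[of "ga x" "Y x"] mult.commute)
  ultimately show ?thesis by simp
qed

text \<open>Symmetry of the Hessian is part of the notion: the explicit radial kernels have it,
  convolution preserves it entry by entry, and \<open>pohozaev_identity\<close> relies on
  it.\<close>

definition is_C2 :: "(R3 \<Rightarrow> real) \<Rightarrow> (R3 \<Rightarrow> R3) \<Rightarrow> (R3 \<Rightarrow> real^3^3) \<Rightarrow> bool" where
  "is_C2 w g H \<longleftrightarrow> is_C1 w g \<and> (\<forall>i. is_C1 (\<lambda>x. g x $ i) (\<lambda>x. H x $ i)) \<and>
     (\<forall>x i j. H x $ i $ j = H x $ j $ i)"

lemma is_C2_imp_C1: "is_C2 w g H \<Longrightarrow> is_C1 w g"
  by (simp add: is_C2_def)

lemma is_C2_grad_C1: "is_C2 w g H \<Longrightarrow> is_C1 (\<lambda>x. g x $ i) (\<lambda>x. H x $ i)"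
  by (simp add: is_C2_def)

lemma is_C2_continuous_trace: "is_C2 w g H \<Longrightarrow> continuous_on UNIV (\<lambda>x. trace (H x))"
  unfolding trace_def
  by (intro continuous_on_sum continuous_on_component[OF is_C1_continuous_grad[OF is_C2_grad_C1]])

lemma is_C2_cmult: "is_C2 w g H \<Longrightarrow> is_C2 (\<lambda>x. c * w x) (\<lambda>x. c *\<^sub>R g x) (\<lambda>x. c *\<^sub>R H x)"
  by (auto simp: is_C2_def intro: is_C1_cmult)

section \<open>Radial cutoff functions\<close>

text \<open>A polynomial profile for cutoffs and mollifiers. It is of class C^(k-1), and its
  derivative is again a multiple of a truncated power, which keeps all constants explicit.\<close>

definition tpow :: "nat \<Rightarrow> real \<Rightarrow> real" where
  "tpow k s = (max 0 (1 - s)) ^ k"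

lemma tpow_nonneg: "0 \<le> tpow k s"
  by (simp add: tpow_def)

lemma tpow_le_1: "0 \<le> s \<Longrightarrow> tpow k s \<le> 1"
  by (simp add: tpow_def power_le_one)

lemma tpow_eq_0: "1 \<le> s \<Longrightarrow> k > 0 \<Longrightarrow> tpow k s = 0"
  by (simp add: tpow_def)

lemma continuous_tpow: "continuous_on A (tpow k)"
  unfolding tpow_def by (intro continuous_intros)

lemma tpow_deriv:
  assumes "k \<ge> 2"
  shows "(tpow k has_real_derivative - real k * tpow (k - 1) t) (at t)"
proof -
  consider "t < 1" | "t > 1" | "t = 1" by linarith
  then show ?thesis
  proof cases
    case 1
    have "((\<lambda>s. (1 - s) ^ k) has_real_derivative - real k * tpow (k - 1) t) (at t)"
      using 1 by (auto simp: tpow_def intro!: derivative_eq_intros)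
    then show ?thesis
      by (rule has_field_derivative_transform_within_open[of _ _ _ "{..<1}"]) (use 1 in \<open>auto simp: tpow_def\<close>)
  next
    case 2
    have "((\<lambda>s. 0) has_real_derivative - real k * tpow (k - 1) t) (at t)"
      using 2 assms by (simp add: tpow_eq_0)
    then show ?thesis
      by (rule has_field_derivative_transform_within_open[of _ _ _ "{1<..}"]) (use 2 assms in \<open>auto simp: tpow_eq_0\<close>)
  next
    case 3
    \<comment> \<open>At the kink the difference quotient is at most |h|^(k-1) in absolute value,
      which tends to 0 because k is at least 2.\<close>
    have "((\<lambda>h. (tpow k (1 + h) - tpow k 1) / h) \<longlongrightarrow> 0) (at 0)"
    proof (rule Lim_null_comparison)
      show "((\<lambda>h::real. \<bar>h\<bar> ^ (k - 1)) \<longlongrightarrow> 0) (at 0)"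
        by (rule tendsto_eq_intros | simp)+ (use assms in auto)
      show "\<forall>\<^sub>F h in at 0. norm ((tpow k (1 + h) - tpow k 1) / h) \<le> \<bar>h\<bar> ^ (k - 1)"
      proof (rule always_eventually, rule allI)
        fix h :: real
        have "tpow k (1 + h) \<le> \<bar>h\<bar> ^ k"
          unfolding tpow_def by (rule power_mono) auto
        moreover have "\<bar>h\<bar> ^ k = \<bar>h\<bar> ^ (k - 1) * \<bar>h\<bar>"
          using assms by (cases k) auto
        ultimately show "norm ((tpow k (1 + h) - tpow k 1) / h) \<le> \<bar>h\<bar> ^ (k - 1)"
          using assms tpow_nonneg[of k "1 + h"] by (cases "h = 0") (auto simp: tpow_eq_0 divide_simps)
      qed
    qed
    then show ?thesis
      using 3 assms by (simp add: DERIV_def tpow_eq_0)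
  qed
qed

text \<open>The profile is applied to the squared norm, a polynomial, so that the origin needs no
  special treatment. In the applications \<open>c\<close> is the inverse square of a radius.\<close>

lemma is_C2_radial:
  assumes d1: "\<And>t. (T has_real_derivative T1 t) (at t)"
    and d2: "\<And>t. (T1 has_real_derivative T2 t) (at t)" and c2: "continuous_on UNIV T2"
  shows "is_C2 (\<lambda>x. T (c * (norm x)\<^sup>2)) (\<lambda>x. (2 * c * T1 (c * (norm x)\<^sup>2)) *\<^sub>R x)
    (\<lambda>x. \<chi> i j. 2 * c * T1 (c * (norm x)\<^sup>2) * (if i = j then 1 else 0) +
       4 * c\<^sup>2 * T2 (c * (norm x)\<^sup>2) * (x $ i * x $ j))"
  unfolding is_C2_def
proof (intro conjI allI)
  have s: "is_C1 (\<lambda>x. c * (norm x)\<^sup>2) (\<lambda>x. (2 * c) *\<^sub>R x)"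
    using is_C1_cmult[OF is_C1_norm2, of c] by (simp add: mult.commute)
  have c1: "continuous_on UNIV T1"
    using d2 by (meson DERIV_isCont continuous_at_imp_continuous_on)
  show "is_C1 (\<lambda>x. T (c * (norm x)\<^sup>2)) (\<lambda>x. (2 * c * T1 (c * (norm x)\<^sup>2)) *\<^sub>R x)"
    by (rule is_C1_cong[OF is_C1_compose[OF s d1 c1]]) (simp_all add: mult_ac)
  fix i :: 3
  show "is_C1 (\<lambda>x. ((2 * c * T1 (c * (norm x)\<^sup>2)) *\<^sub>R x) $ i) (\<lambda>x. (\<chi> i j. 2 * c * T1 (c * (norm x)\<^sup>2)
      * (if i = j then 1 else 0) + 4 * c\<^sup>2 * T2 (c * (norm x)\<^sup>2) * (x $ i * x $ j)) $ i)"
    by (rule is_C1_cong[OF is_C1_mult[OF is_C1_cmult[OF is_C1_compose[OF s d2 c2], of "2 * c"]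
            is_C1_nth[of i]]])
      (auto simp: vec_eq_iff axis_def power2_eq_square algebra_simps)
qed (simp add: mult_ac)

text \<open>For the Hessian in \<open>is_C2_radial\<close> this is the Laplacian of a radial
  function; the 3 is the dimension.\<close>

lemma trace_radial:
  "trace (\<chi> i j. a * (if i = j then 1 else 0) + b * (x $ i * x $ j)) = 3 * a + b * (norm (x::R3))\<^sup>2"
proof -
  have "(norm x)\<^sup>2 = (\<Sum>i\<in>UNIV. x $ i * x $ i)"
    by (simp add: power2_norm_eq_inner inner_vec_def)
  then show ?thesis
    by (simp add: trace_def sum.distrib sum_distrib_left)
qed

section \<open>Mollification\<close>

definition conv :: "(R3 \<Rightarrow> real) \<Rightarrow> (R3 \<Rightarrow> real) \<Rightarrow> R3 \<Rightarrow> real" where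
  "conv f k x = (LINT y|lebesgue. f y * k (x - y))"

lemma L1_loc_integrable:
  "f \<in> L1_loc \<Longrightarrow> integrable lebesgue (\<lambda>y. indicat_real (cball a R) y *\<^sub>R f y)"
  by (auto simp: L1_loc_def set_integrable_def)

text \<open>Stated for any bilinear operation because weak gradients pair scalars with vectors in
  both orders.\<close>

lemma integrable_bilinear_test:
  fixes f :: "R3 \<Rightarrow> 'a::euclidean_space" and k :: "R3 \<Rightarrow> 'b::euclidean_space"
    and op :: "'a \<Rightarrow> 'b \<Rightarrow> 'c::euclidean_space"
  assumes f: "f \<in> L1_loc" and k: "continuous_on UNIV k" and s: "bounded {x. k x \<noteq> 0}"
    and op: "bounded_bilinear op"
  shows "integrable lebesgue (\<lambda>y. op (f y) (k y))"
proof -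
  interpret op: bounded_bilinear op by (fact op)
  obtain R where R: "\<And>x. x \<notin> cball 0 R \<Longrightarrow> k x = 0"
    using bounded_support_obtain[OF s] by blast
  obtain B where B: "B > 0" "\<And>x. norm (k x) \<le> B"
    using continuous_support_bounded[OF k s] by blast
  obtain C where C: "C > 0" "\<And>a b. norm (op a b) \<le> norm a * norm b * C"
    using op.pos_bounded by blast
  \<comment> \<open>The indicator makes the first factor integrable on the whole space; this also
    supplies measurability, which \<open>L1_loc\<close> gives only on compact sets.\<close>
  have eq: "(\<lambda>y. op (f y) (k y)) = (\<lambda>y. op (cball_ind R y *\<^sub>R f y) (k y))"
    using R by (auto simp: fun_eq_iff indicator_def op.zero_right)
  have i: "integrable lebesgue (\<lambda>y. cball_ind R y *\<^sub>R f y)"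
    by (rule L1_loc_integrable[OF f])
  show ?thesis
    unfolding eq
  proof (rule Bochner_Integration.integrable_bound)
    show "integrable lebesgue (\<lambda>y. (B * C) * norm (cball_ind R y *\<^sub>R f y))"
      by (intro integrable_mult_right integrable_norm i)
    show "(\<lambda>y. op (cball_ind R y *\<^sub>R f y) (k y)) \<in> borel_measurable lebesgue"
    proof (rule borel_measurable_continuous_Pair[OF borel_measurable_integrable[OF i]
          continuous_imp_lebesgue_measurable[OF k]])
      show "continuous_on UNIV (\<lambda>x. op (fst x) (snd x))"
        by (intro op.continuous_on continuous_intros)
    qed
    show "AE y in lebesgue. norm (op (cball_ind R y *\<^sub>R f y) (k y))
        \<le> norm ((B * C) * norm (cball_ind R y *\<^sub>R f y))"
    proof (rule AE_I2)
      fix y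
      let ?a = "cball_ind R y *\<^sub>R f y"
      have "norm (op ?a (k y)) \<le> norm ?a * norm (k y) * C"
        by (rule C)
      also have "\<dots> \<le> norm ?a * B * C"
        using B C by (intro mult_right_mono mult_left_mono) auto
      also have "\<dots> = norm ((B * C) * norm ?a)"
        using B C by (simp add: abs_mult)
      finally show "norm (op ?a (k y)) \<le> norm ((B * C) * norm ?a)" .
    qed
  qed
qed

lemma integrable_mult_test:
  fixes f k :: "R3 \<Rightarrow> real"
  assumes "f \<in> L1_loc" "continuous_on UNIV k" "bounded {x. k x \<noteq> 0}"
  shows "integrable lebesgue (\<lambda>y. f y * k y)"
  by (rule integrable_bilinear_test[OF assms bounded_bilinear_mult])

lemma bounded_support_reflect:
  fixes k :: "R3 \<Rightarrow> 'b::zero"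
  assumes "bounded {x. k x \<noteq> 0}"
  shows "bounded {y. k (x - y) \<noteq> 0}"
proof -
  have "{y. k (x - y) \<noteq> 0} \<subseteq> (\<lambda>z. x - z) ` {x. k x \<noteq> 0}"
    by (auto simp: image_iff intro!: exI[of _ "x - _"])
  moreover have "bounded ((\<lambda>z. x - z) ` {x. k x \<noteq> 0})"
    using bounded_translation[of "uminus ` {x. k x \<noteq> 0}" x] assms by (simp add: image_image)
  ultimately show ?thesis by (rule bounded_subset[rotated])
qed

lemma continuous_reflect:
  "continuous_on UNIV k \<Longrightarrow> continuous_on UNIV (\<lambda>y. k (x - y))" for x :: R3
  by (rule continuous_on_compose2[of UNIV k]) (auto intro!: continuous_intros)

lemma conv_integrable:
  fixes f k :: "R3 \<Rightarrow> real"
  assumes "f \<in> L1_loc" "continuous_on UNIV k" "bounded {x. k x \<noteq> 0}"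
  shows "integrable lebesgue (\<lambda>y. f y * k (x - y))"
  using assms by (intro integrable_mult_test[where k="\<lambda>y. k (x - y)"] continuous_reflect bounded_support_reflect)

lemma conv_estimate:
  fixes f q :: "R3 \<Rightarrow> real"
  assumes f: "f \<in> L1_loc" and e: "\<And>y. \<bar>q y\<bar> \<le> e" and z: "\<And>y. y \<notin> cball x R \<Longrightarrow> q y = 0"
  shows "\<bar>LINT y|lebesgue. f y * q y\<bar> \<le> e * (LINT y|lebesgue. \<bar>indicat_real (cball x R) y *\<^sub>R f y\<bar>)"
proof -
  have i: "integrable lebesgue (\<lambda>y. e * \<bar>indicat_real (cball x R) y *\<^sub>R f y\<bar>)"
    using integrable_norm[OF L1_loc_integrable[OF f]] by simp
  show ?thesis
  proof (cases "integrable lebesgue (\<lambda>y. f y * q y)")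
    case True
    have "norm (LINT y|lebesgue. f y * q y) \<le> (LINT y|lebesgue. e * \<bar>indicat_real (cball x R) y *\<^sub>R f y\<bar>)"
    proof (rule Bochner_Integration.integral_norm_bound_integral[OF True i])
      fix y
      show "norm (f y * q y) \<le> e * \<bar>indicat_real (cball x R) y *\<^sub>R f y\<bar>"
        using e[of y] z[of y]
        by (cases "y \<in> cball x R") (auto simp: abs_mult mult.commute[of e] intro: mult_left_mono)
    qed
    then show ?thesis by simp
  next
    case False
    \<comment> \<open>The Bochner integral of a non-integrable function is 0, so the bound holds by
      default.\<close>
    have "0 \<le> e" using e[of x] by linarith
    then show ?thesis using False by (simp add: not_integrable_integral_eq)
  qed
qed

lemma conv_continuous:
  assumes f: "f \<in> L1_loc" and k: "continuous_on UNIV k" and s: "bounded {x. k x \<noteq> 0}"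
  shows "continuous_on UNIV (conv f k)"
proof (rule continuous_on_sequentiallyI)
  fix X :: "nat \<Rightarrow> R3" and a assume X: "X \<longlonglongrightarrow> a"
  obtain R where R: "\<And>x. x \<notin> cball 0 R \<Longrightarrow> k x = 0"
    using bounded_support_obtain[OF s] by blast
  obtain B where B: "\<And>x. norm (k x) \<le> B"
    using continuous_support_bounded[OF k s] by blast
  obtain b where b: "\<And>n. norm (X n) \<le> b"
    using convergent_imp_Bseq[OF convergentI[OF X]] by (auto simp: Bseq_def)
  note m = borel_measurable_integrable[OF conv_integrable[OF f k s]]
  show "(\<lambda>n. conv f k (X n)) \<longlonglongrightarrow> conv f k a"
    unfolding conv_def
  proof (rule integral_dominated_convergence[OF m m])
    show "integrable lebesgue (\<lambda>y. B * norm (cball_ind (R + b) y *\<^sub>R f y))"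
      by (intro integrable_mult_right integrable_norm L1_loc_integrable f)
    show "AE y in lebesgue. (\<lambda>n. f y * k (X n - y)) \<longlonglongrightarrow> f y * k (a - y)"
      by (intro AE_I2 tendsto_intros continuous_on_tendsto_compose[OF k] X) simp_all
    show "AE y in lebesgue. norm (f y * k (X n - y)) \<le> B * norm (cball_ind (R + b) y *\<^sub>R f y)" for n
    proof (rule AE_I2)
      fix y
      show "norm (f y * k (X n - y)) \<le> B * norm (cball_ind (R + b) y *\<^sub>R f y)"
      proof (cases "y \<in> cball 0 (R + b)")
        case True
        then show ?thesis
          using mult_left_mono[OF B[of "X n - y"], of "\<bar>f y\<bar>"] by (simp add: abs_mult mult.commute)
      next
        case False
        then have "k (X n - y) = 0"
          using b[of n] norm_triangle_sub[of y "X n"] by (intro R) (simp add: norm_minus_commute)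
        then show ?thesis using False by simp
      qed
    qed
  qed
qed

text \<open>Differentiation under the integral sign for a merely locally integrable
  \<open>f\<close>: uniform continuity of \<open>k'\<close> makes the first-order Taylor remainder
  of the kernel at most \<open>e / (A + 1) * norm h\<close> everywhere, and the remainder meets only
  the mass \<open>A\<close> of \<open>f\<close> near \<open>x\<close>.\<close>

lemma conv_is_C1:
  assumes f: "f \<in> L1_loc" and k: "is_C1 k k'" and s: "bounded {x. k x \<noteq> 0}"
  shows "is_C1 (conv f k) (\<lambda>x. \<chi> i. conv f (\<lambda>z. k' z $ i) x)"
  unfolding is_C1_def
proof (intro conjI allI)
  have ck: "continuous_on UNIV k" and ck': "continuous_on UNIV k'"
    using k is_C1_continuous is_C1_continuous_grad by blast+
  have ci: "continuous_on UNIV (\<lambda>z. k' z $ i)" for i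
    by (intro continuous_intros ck')
  have si: "bounded {x. k' x $ i \<noteq> 0}" for i
    by (rule bounded_subset[OF is_C1_support[OF k s]]) auto
  show "continuous_on UNIV (\<lambda>x. \<chi> i. conv f (\<lambda>z. k' z $ i) x)"
    by (intro continuous_intros conv_continuous f ci si)
  fix x
  obtain R where R: "R > 0" "\<And>x. x \<notin> cball 0 R \<Longrightarrow> k x = 0"
    using bounded_support_obtain[OF s] by blast
  \<comment> \<open>For increments shorter than 1 the Taylor remainder vanishes unless
    \<open>y\<close> is within \<open>R + 1\<close> of \<open>x\<close>.\<close>
  define A where "A = (LINT y|lebesgue. \<bar>indicat_real (cball x (R + 1)) y *\<^sub>R f y\<bar>)"
  have A: "A \<ge> 0" by (simp add: A_def)
  show "GDERIV (conv f k) x :> (\<chi> i. conv f (\<lambda>z. k' z $ i) x)"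
    unfolding gderiv_def has_derivative_at_alt
  proof (intro conjI allI impI)
    show "bounded_linear (\<lambda>h. h \<bullet> (\<chi> i. conv f (\<lambda>z. k' z $ i) x))"
      by (rule bounded_linear_inner_left)
    fix e :: real assume e: "e > 0"
    \<comment> \<open>The segment from \<open>x - y\<close> to \<open>x' - y\<close> stays in this
      ball when \<open>y \<in> cball x (R + 1)\<close> and the increment is shorter than 1. The
      denominator \<open>A + 1\<close> below avoids division by 0.\<close>
    have "uniformly_continuous_on (cball 0 (R + 2)) k'"
      by (rule compact_uniformly_continuous) (use ck' continuous_on_subset in auto)
    then obtain d where d: "d > 0"
      "\<And>y z. y \<in> cball 0 (R + 2) \<Longrightarrow> z \<in> cball 0 (R + 2) \<Longrightarrow> dist y z < d \<Longrightarrow> dist (k' y) (k' z) < e / (A + 1)"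
      unfolding uniformly_continuous_on_def using e A by (metis divide_pos_pos add_nonneg_pos zero_less_one)
    show "\<exists>d>0. \<forall>y. norm (y - x) < d \<longrightarrow> norm (conv f k y - conv f k x - (y - x) \<bullet> (\<chi> i. conv f (\<lambda>z. k' z $ i) x))
        \<le> e * norm (y - x)"
    proof (intro exI[of _ "min d 1"] conjI allI impI)
      fix x' assume x': "norm (x' - x) < min d 1"
      define h where "h = x' - x"
      have "h \<bullet> (\<chi> i. conv f (\<lambda>z. k' z $ i) x) = (\<Sum>i\<in>UNIV. h $ i * conv f (\<lambda>z. k' z $ i) x)"
        by (simp add: inner_vec_def)
      also have "\<dots> = (LINT y|lebesgue. (\<Sum>i\<in>UNIV. h $ i * (f y * k' (x - y) $ i)))"
        unfolding conv_def
        by (subst Bochner_Integration.integral_sum) (auto intro!: conv_integrable f ci si)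
      also have "\<dots> = (LINT y|lebesgue. f y * (h \<bullet> k' (x - y)))"
        by (simp add: inner_vec_def sum_distrib_left mult_ac)
      finally have 1: "h \<bullet> (\<chi> i. conv f (\<lambda>z. k' z $ i) x) = (LINT y|lebesgue. f y * (h \<bullet> k' (x - y)))" .
      have 2: "integrable lebesgue (\<lambda>y. f y * (h \<bullet> k' (x - y)))"
        by (rule conv_integrable[OF f, where k="\<lambda>z. h \<bullet> k' z"])
          (auto intro!: continuous_intros ck' bounded_subset[OF is_C1_support[OF k s]])
      have i: "integrable lebesgue (\<lambda>y. f y * k (z - y))" for z
        by (rule conv_integrable[OF f ck s])
      have "conv f k x' - conv f k x - h \<bullet> (\<chi> i. conv f (\<lambda>z. k' z $ i) x)
          = (LINT y|lebesgue. f y * (k (x' - y) - k (x - y) - h \<bullet> k' (x - y)))"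
        unfolding 1 unfolding conv_def right_diff_distrib
        using i 2 by (simp add: Bochner_Integration.integral_diff)
      moreover have "\<bar>LINT y|lebesgue. f y * (k (x' - y) - k (x - y) - h \<bullet> k' (x - y))\<bar>
          \<le> e / (A + 1) * norm h * A"
        unfolding A_def
      proof (rule conv_estimate[OF f], fold A_def)
        fix y
        show 0: "k (x' - y) - k (x - y) - h \<bullet> k' (x - y) = 0" if "y \<notin> cball x (R + 1)"
        proof -
          have "norm (x - y) > R + 1" "norm (x' - y) > R"
            using that x' dist_triangle[of x y x'] by (auto simp: dist_commute dist_norm)
          then have "k (x - y) = 0" "k (x' - y) = 0" "k' (x - y) = 0"
            using R(1) by (auto intro!: R(2) is_C1_zero_outside[OF k R(2)] simp: norm_minus_commute)
          then show ?thesis by simp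
        qed
        show "\<bar>k (x' - y) - k (x - y) - h \<bullet> k' (x - y)\<bar> \<le> e / (A + 1) * norm h"
        proof (cases "y \<in> cball x (R + 1)")
          case True
          let ?S = "closed_segment (x - y) (x' - y)"
          have S: "dist (k' z) (k' (x - y)) < e / (A + 1)" if z: "z \<in> ?S" for z
          proof -
            have "norm (z - (x - y)) \<le> norm h"
              using segment_bound(1)[OF z] by (simp add: h_def)
            moreover have "norm (x - y) \<le> R + 1"
              using True by (simp add: dist_norm)
            ultimately show ?thesis
              using x' norm_triangle_sub[of z "x - y"]
              by (intro d(2)) (auto simp: h_def dist_norm norm_minus_commute)
          qed
          have "norm (k (x' - y) - k (x - y) - (x' - y - (x - y)) \<bullet> k' (x - y))
              \<le> norm (x' - y - (x - y)) * (e / (A + 1))"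
          proof (rule differentiable_bound_linearization[of _ _ ?S k "\<lambda>z h. h \<bullet> k' z" "x - y"])
            show "x - y + t *\<^sub>R (x' - y - (x - y)) \<in> ?S" if "t \<in> {0..1}" for t
              using that by (auto simp: in_segment algebra_simps intro!: exI[of _ t])
            show "(k has_derivative (\<lambda>h. h \<bullet> k' z)) (at z within ?S)" for z
              using k by (auto simp: is_C1_def gderiv_def intro: has_derivative_at_withinI)
            show "onorm ((\<lambda>v. v \<bullet> k' z) - (\<lambda>v. v \<bullet> k' (x - y))) \<le> e / (A + 1)" if "z \<in> ?S" for z
              unfolding fun_diff_def
            proof (rule onorm_le)
              fix v
              have "\<bar>v \<bullet> (k' z - k' (x - y))\<bar> \<le> norm v * norm (k' z - k' (x - y))"
                by (rule Cauchy_Schwarz_ineq2)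
              also have "\<dots> \<le> norm v * (e / (A + 1))"
                using S[OF that] by (intro mult_left_mono) (auto simp: dist_norm)
              finally show "norm (v \<bullet> k' z - v \<bullet> k' (x - y)) \<le> e / (A + 1) * norm v"
                by (simp add: inner_diff_right mult.commute)
            qed
          qed auto
          then show ?thesis by (simp add: h_def mult.commute)
        qed (use 0 e A in auto)
      qed
      moreover have "e / (A + 1) * norm h * A \<le> e * norm h"
      proof -
        have "e / (A + 1) * A \<le> e"
          using e A by (simp add: field_simps)
        then show ?thesis
          using mult_right_mono[of "e / (A + 1) * A" e "norm h"] by (simp add: mult_ac)
      qed
      ultimately show "norm (conv f k x' - conv f k x - (x' - x) \<bullet> (\<chi> i. conv f (\<lambda>z. k' z $ i) x))
          \<le> e * norm (x' - x)"
        by (simp add: h_def)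
    qed (use d in auto)
  qed
qed

lemma conv_is_C2:
  assumes f: "f \<in> L1_loc" and k: "is_C2 k k' k''" and s: "bounded {x. k x \<noteq> 0}"
  shows "is_C2 (conv f k) (\<lambda>x. \<chi> i. conv f (\<lambda>z. k' z $ i) x)
    (\<lambda>x. \<chi> i j. conv f (\<lambda>z. k'' z $ i $ j) x)"
  unfolding is_C2_def
proof (intro conjI allI)
  note k1 = is_C2_imp_C1[OF k]
  show "is_C1 (conv f k) (\<lambda>x. \<chi> i. conv f (\<lambda>z. k' z $ i) x)"
    by (rule conv_is_C1[OF f k1 s])
  have si: "bounded {x. k' x $ i \<noteq> 0}" for i
    by (rule bounded_subset[OF is_C1_support[OF k1 s]]) auto
  show "is_C1 (\<lambda>x. (\<chi> i. conv f (\<lambda>z. k' z $ i) x) $ i) (\<lambda>x. (\<chi> i j. conv f (\<lambda>z. k'' z $ i $ j) x) $ i)" for i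
    using conv_is_C1[OF f is_C2_grad_C1[OF k] si, of i] by simp
  show "(\<chi> i j. conv f (\<lambda>z. k'' z $ i $ j) x) $ i $ j = (\<chi> i j. conv f (\<lambda>z. k'' z $ i $ j) x) $ j $ i" for x i j
    using k by (simp add: is_C2_def)
qed

section \<open>Mollification of weak gradients and weak solutions\<close>

lemma L1_loc_component:
  fixes g :: "R3 \<Rightarrow> R3"
  assumes "g \<in> L1_loc"
  shows "(\<lambda>y. g y $ i) \<in> L1_loc"
  using assms integrable_bounded_linear[OF bounded_linear_vec_nth[of i]]
  by (fastforce simp: L1_loc_def set_integrable_def)

text \<open>A convolution evaluated at \<open>x\<close> is the pairing with this test function,
  which is how the weak formulations become pointwise statements about mollifications.\<close>

lemma reflected_test:
  assumes k: "is_C1 k k'" and s: "bounded {x. k x \<noteq> 0}"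
  shows "(\<lambda>y. k (x - y)) \<in> C1c" and "grad (\<lambda>y. k (x - y)) = (\<lambda>y. - k' (x - y))"
proof -
  have "(k has_derivative (\<lambda>h. h \<bullet> k' (x - y))) (at (x - y))" for y
    using k by (simp add: is_C1_def gderiv_def)
  then have "((\<lambda>y. k (x - y)) has_derivative (\<lambda>h. (- h) \<bullet> k' (x - y))) (at y)" for y
    by (rule has_derivative_compose[rotated]) (auto intro!: derivative_eq_intros)
  then have C1: "is_C1 (\<lambda>y. k (x - y)) (\<lambda>y. - k' (x - y))"
    by (auto simp: is_C1_def gderiv_def
        intro!: continuous_intros continuous_reflect is_C1_continuous_grad[OF k])
  then show "(\<lambda>y. k (x - y)) \<in> C1c"
    by (rule C1c_I) (rule bounded_support_reflect[OF s])
  show "grad (\<lambda>y. k (x - y)) = (\<lambda>y. - k' (x - y))"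
    by (rule is_C1_grad[OF C1])
qed

text \<open>The sign of the reflected gradient cancels the sign of the weak integration by parts, so
  a derivative of the kernel turns into the weak gradient under the convolution.\<close>

lemma weak_gradient_conv:
  assumes wg: "has_weak_gradient u g" and k: "is_C1 k k'" and s: "bounded {x. k x \<noteq> 0}"
  shows "conv u (\<lambda>z. k' z $ i) x = conv (\<lambda>y. g y $ i) k x"
proof -
  have ck: "continuous_on UNIV k" and ck': "continuous_on UNIV k'"
    using k is_C1_continuous is_C1_continuous_grad by blast+
  note test = reflected_test[OF k s, of x]
  have L1: "u \<in> L1_loc" "g \<in> L1_loc" using wg by (auto simp: has_weak_gradient_def)
  have eq: "(LINT y|lebesgue. u y *\<^sub>R (- k' (x - y))) = - (LINT y|lebesgue. k (x - y) *\<^sub>R g y)"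
    using wg[unfolded has_weak_gradient_def, THEN conjunct2, THEN conjunct2, rule_format, OF test(1)]
    unfolding test(2) .
  have bd': "bounded {y. - k' (x - y) \<noteq> 0}"
    using bounded_support_reflect[OF is_C1_support[OF k s]] by simp
  have 1: "integrable lebesgue (\<lambda>y. u y *\<^sub>R (- k' (x - y)))"
    by (rule integrable_bilinear_test[OF L1(1) _ bd' bounded_bilinear_scaleR])
      (intro continuous_intros continuous_reflect ck')
  have 2: "integrable lebesgue (\<lambda>y. k (x - y) *\<^sub>R g y)"
    by (rule integrable_bilinear_test[OF L1(2) _ _ bounded_bilinear.flip[OF bounded_bilinear_scaleR]])
      (intro continuous_reflect ck bounded_support_reflect s)+
  have "- conv u (\<lambda>z. k' z $ i) x = (LINT y|lebesgue. (u y *\<^sub>R (- k' (x - y))) \<bullet> axis i 1)"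
    by (simp add: conv_def inner_axis)
  also have "\<dots> = (LINT y|lebesgue. u y *\<^sub>R (- k' (x - y))) \<bullet> axis i 1"
    by (rule integral_inner_left) (rule 1)
  also have "\<dots> = - (LINT y|lebesgue. (k (x - y) *\<^sub>R g y) \<bullet> axis i 1)"
    unfolding eq by (subst integral_inner_left) (auto intro: 2)
  also have "\<dots> = - conv (\<lambda>y. g y $ i) k x"
    by (simp add: conv_def inner_axis mult.commute)
  finally show ?thesis by simp
qed

text \<open>In classical terms, minus the Laplacian of the mollified \<open>u\<close> is the
  mollified \<open>f\<close>. One of the two derivatives moves to the weak gradient by
  \<open>weak_gradient_conv\<close>; the sum over the diagonal is then the weak equation tested with
  the reflected kernel.\<close>

lemma weak_poisson_conv:
  assumes w: "weakly_solves_poisson u f" and k: "is_C2 k k' k''" and s: "bounded {x. k x \<noteq> 0}"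
  shows "trace (\<chi> i j. conv u (\<lambda>z. k'' z $ i $ j) x) = - conv f k x"
proof -
  note k1 = is_C2_imp_C1[OF k]
  have ck': "continuous_on UNIV k'"
    using k1 by (rule is_C1_continuous_grad)
  obtain g where g: "has_weak_gradient u g" and eq: "\<And>\<eta>. \<eta> \<in> C1c \<Longrightarrow>
      (LINT x|lebesgue. g x \<bullet> grad \<eta> x) = (LINT x|lebesgue. f x * \<eta> x)"
    using w by (auto simp: weakly_solves_poisson_def)
  have L1: "u \<in> L1_loc" "g \<in> L1_loc" using g by (auto simp: has_weak_gradient_def)
  note test = reflected_test[OF k1 s, of x]
  have si: "bounded {x. k' x $ i \<noteq> 0}" for i
    by (rule bounded_subset[OF is_C1_support[OF k1 s]]) auto
  have "(\<chi> j. conv u (\<lambda>z. k'' z $ i $ j) x) = (\<chi> j. conv (\<lambda>y. g y $ i) (\<lambda>z. k' z $ j) x)" for i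
  proof -
    have "is_C1 (conv u (\<lambda>z. k' z $ i)) (\<lambda>x. \<chi> j. conv u (\<lambda>z. k'' z $ i $ j) x)"
      by (rule conv_is_C1[OF L1(1) is_C2_grad_C1[OF k] si])
    moreover have "is_C1 (conv (\<lambda>y. g y $ i) k) (\<lambda>x. \<chi> j. conv (\<lambda>y. g y $ i) (\<lambda>z. k' z $ j) x)"
      by (rule conv_is_C1[OF L1_loc_component[OF L1(2)] k1 s])
    moreover have "conv u (\<lambda>z. k' z $ i) = conv (\<lambda>y. g y $ i) k"
      by (rule ext) (rule weak_gradient_conv[OF g k1 s])
    \<comment> \<open>Both expressions are gradients of the same function, so uniqueness of the
      gradient identifies them.\<close>
    ultimately have "(\<lambda>x. \<chi> j. conv u (\<lambda>z. k'' z $ i $ j) x) = (\<lambda>x. \<chi> j. conv (\<lambda>y. g y $ i) (\<lambda>z. k' z $ j) x)"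
      by (metis is_C1_grad)
    then show ?thesis by (rule fun_cong)
  qed
  then have "conv u (\<lambda>z. k'' z $ i $ i) x = conv (\<lambda>y. g y $ i) (\<lambda>z. k' z $ i) x" for i
    by (simp add: vec_eq_iff)
  then have "trace (\<chi> i j. conv u (\<lambda>z. k'' z $ i $ j) x) = (\<Sum>i\<in>UNIV. LINT y|lebesgue. g y $ i * k' (x - y) $ i)"
    by (simp add: trace_def conv_def)
  also have "\<dots> = (LINT y|lebesgue. (\<Sum>i\<in>UNIV. g y $ i * k' (x - y) $ i))"
    by (rule Bochner_Integration.integral_sum[symmetric])
      (rule conv_integrable[OF L1_loc_component[OF L1(2)] continuous_on_component[OF ck'] si])
  also have "\<dots> = - (LINT y|lebesgue. g y \<bullet> grad (\<lambda>y. k (x - y)) y)"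
    by (simp add: test inner_vec_def sum_negf)
  also have "\<dots> = - conv f k x"
    unfolding eq[OF test(1)] conv_def ..
  finally show ?thesis .
qed

section \<open>Mollifiers and their existence\<close>

definition is_mollifier :: "real \<Rightarrow> (R3 \<Rightarrow> real) \<Rightarrow> bool" where
  "is_mollifier \<epsilon> k \<longleftrightarrow> (\<exists>k' k''. is_C2 k k' k'') \<and> (\<forall>x. 0 \<le> k x) \<and> (\<forall>x. x \<notin> cball 0 \<epsilon> \<longrightarrow> k x = 0) \<and>
     (\<forall>x. k (- x) = k x) \<and> (LINT x|lebesgue. k x) = 1"

lemma is_mollifier_support: "is_mollifier \<epsilon> k \<Longrightarrow> bounded {x. k x \<noteq> 0}"
  by (rule bounded_subset[OF bounded_cball[of 0 \<epsilon>]]) (auto simp: is_mollifier_def)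

lemma is_mollifier_continuous: "is_mollifier \<epsilon> k \<Longrightarrow> continuous_on UNIV k"
  by (auto simp: is_mollifier_def intro: is_C1_continuous is_C2_imp_C1)

lemma tpow_eq_0_outside:
  assumes "r > 0" "x \<notin> cball 0 r" "k > 0"
  shows "tpow k ((1 / r\<^sup>2) * (norm (x::R3))\<^sup>2) = 0"
proof -
  have "r\<^sup>2 \<le> (norm x)\<^sup>2"
    using assms by (intro power_mono) auto
  then show ?thesis
    using assms by (intro tpow_eq_0) (auto simp: field_simps)
qed

lemma is_C2_tpow4: "is_C2 (\<lambda>x. tpow 4 (c * (norm x)\<^sup>2)) (\<lambda>x. (2 * c * (- 4 * tpow 3 (c * (norm x)\<^sup>2))) *\<^sub>R x)
    (\<lambda>x. \<chi> i j. 2 * c * (- 4 * tpow 3 (c * (norm x)\<^sup>2)) * (if i = j then 1 else 0) +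
       4 * c\<^sup>2 * (12 * tpow 2 (c * (norm x)\<^sup>2)) * (x $ i * x $ j))"
proof (rule is_C2_radial)
  show "(tpow 4 has_real_derivative - 4 * tpow 3 t) (at t)" for t
    using tpow_deriv[of 4 t] by simp
  show "((\<lambda>t. - 4 * tpow 3 t) has_real_derivative 12 * tpow 2 t) (at t)" for t
    using DERIV_cmult[OF tpow_deriv[of 3 t], of "-4"] by simp
qed (intro continuous_intros continuous_tpow)

lemma integral_pos:
  fixes k :: "R3 \<Rightarrow> real"
  assumes "continuous_on UNIV k" "bounded {x. k x \<noteq> 0}" "\<And>x. k x \<ge> 0"
    "k 0 > 0"
  shows "(LINT x|lebesgue. k x) > 0"
proof -
  have i: "integrable lebesgue k" by (rule integrable_continuous_support[OF assms(1,2)])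
  have "(LINT x|lebesgue. k x) \<noteq> 0"
  proof
    assume "(LINT x|lebesgue. k x) = 0"
    then have "AE x in lebesgue. k x = 0"
      using integral_nonneg_eq_0_iff_AE[OF i] assms(3) by auto
    \<comment> \<open>A closed set that contains almost every point is the whole space, which
      contradicts \<open>k 0 > 0\<close>.\<close>
    then have "AE x in lebesgue. x \<in> {x. k x = 0}" by simp
    moreover have "closed {x. k x = 0}"
      using continuous_closed_preimage[OF assms(1), of "{0}"] by (simp add: vimage_def)
    ultimately have "\<forall>x. x \<in> {x. k x = 0}"
      using mem_closed_if_AE_lebesgue by blast
    then show False using assms(4) by auto
  qed
  moreover have "(LINT x|lebesgue. k x) \<ge> 0" by (simp add: assms(3))
  ultimately show ?thesis by simp
qed

lemma mollifier_exists:
  assumes "\<epsilon> > 0"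
  shows "\<exists>k. is_mollifier \<epsilon> k"
proof -
  define p where "p x = tpow 4 ((1 / \<epsilon>\<^sup>2) * (norm (x::R3))\<^sup>2)" for x
  have C2: "\<exists>p' p''. is_C2 p p' p''"
    unfolding p_def by (intro exI) (rule is_C2_tpow4)
  have z: "p x = 0" if "x \<notin> cball 0 \<epsilon>" for x
    unfolding p_def using tpow_eq_0_outside[OF assms that] by simp
  have "(LINT x|lebesgue. p x) > 0"
  proof (rule integral_pos)
    show "continuous_on UNIV p" using C2 is_C1_continuous is_C2_imp_C1 by blast
    show "bounded {x. p x \<noteq> 0}"
      by (rule bounded_subset[OF bounded_cball[of 0 \<epsilon>]]) (use z in blast)
  qed (auto simp: p_def tpow_nonneg, simp add: tpow_def)
  moreover have "0 \<le> p x" "p (- x) = p x" for x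
    by (simp_all add: p_def tpow_nonneg)
  moreover have "\<exists>p' p''. is_C2 (\<lambda>x. (1 / (LINT x|lebesgue. p x)) * p x) p' p''"
    using C2 is_C2_cmult by blast
  ultimately have "is_mollifier \<epsilon> (\<lambda>x. (1 / (LINT x|lebesgue. p x)) * p x)"
    unfolding is_mollifier_def using z by simp
  then show ?thesis by blast
qed

section \<open>Almost everywhere convergence of mollifications\<close>

lemma conv_cong_AE:
  assumes "AE x in lebesgue. f x = g x" "f \<in> borel_measurable lebesgue" "g \<in> borel_measurable lebesgue"
    "continuous_on UNIV k"
  shows "conv f k x = conv g k x"
  unfolding conv_def
proof (rule integral_cong_AE)
  have k: "(\<lambda>y. k (x - y)) \<in> borel_measurable lebesgue"
    by (intro continuous_imp_lebesgue_measurable continuous_reflect assms)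
  show "(\<lambda>y. f y * k (x - y)) \<in> borel_measurable lebesgue" "(\<lambda>y. g y * k (x - y)) \<in> borel_measurable lebesgue"
    by (intro borel_measurable_times assms k)+
qed (use assms(1) in auto)

lemma bounded_L1_loc:
  fixes f :: "R3 \<Rightarrow> real"
  assumes f: "f \<in> borel_measurable lebesgue" and b: "\<And>x. \<bar>f x\<bar> \<le> M"
  shows "f \<in> L1_loc"
  unfolding L1_loc_def set_integrable_def
proof (intro CollectI allI impI)
  fix K :: "R3 set" assume K: "compact K"
  then obtain R where R: "K \<subseteq> cball 0 R"
    using bounded_subset_cball compact_imp_bounded by (metis bounded_subset_ballD subset_trans ball_subset_cball)
  show "integrable lebesgue (\<lambda>x. indicat_real K x *\<^sub>R f x)"
  proof (rule integrable_bounded_support[where C=M and R=R])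
    have "K \<in> sets lebesgue"
      using K by (simp add: borel_compact)
    then show "(\<lambda>x. indicat_real K x *\<^sub>R f x) \<in> borel_measurable lebesgue"
      by (intro borel_measurable_scaleR f borel_measurable_indicator)
    have "M \<ge> 0" using b[of 0] by linarith
    then show "norm (indicat_real K x *\<^sub>R f x) \<le> M" for x
      using b[of x] by (simp add: indicator_def)
  qed (use R in \<open>auto simp: indicator_def\<close>)
qed

text \<open>A measurable function is an almost everywhere limit of continuous ones
  (\<open>measurable_on\<close>). Truncating these at level \<open>M\<close> keeps the limit and
  makes the convergence on the ball dominated.\<close>

lemma bounded_continuous_L1_approx:
  fixes h :: "R3 \<Rightarrow> real"
  assumes h: "h \<in> borel_measurable lebesgue" and b: "\<And>x. \<bar>h x\<bar> \<le> M" and e: "e > 0"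
  obtains \<phi> where "continuous_on UNIV \<phi>" "\<And>x. \<bar>\<phi> x\<bar> \<le> M"
    "(LINT x|lebesgue. cball_ind R x * \<bar>h x - \<phi> x\<bar>) < e"
proof -
  have M: "M \<ge> 0" using b[of 0] by linarith
  have "h measurable_on UNIV"
    by (rule lebesgue_measurable_imp_measurable_on) (use h in auto)
  then obtain N g where N: "negligible N" and g: "\<And>n. continuous_on UNIV (g n)"
    and lim: "\<And>x. x \<notin> N \<Longrightarrow> (\<lambda>n. g n x) \<longlonglongrightarrow> h x"
    unfolding measurable_on_def by auto
  define c where "c n x = max (- M) (min M (g n x))" for n x
  have c: "continuous_on UNIV (c n)" "\<bar>c n x\<bar> \<le> M" for n x
    using M by (auto simp: c_def intro!: continuous_intros g)
  have "(\<lambda>n. LINT x|lebesgue. cball_ind R x * \<bar>h x - c n x\<bar>) \<longlonglongrightarrow> (LINT x|(lebesgue :: R3 measure). 0)"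
  proof (rule integral_dominated_convergence[where w="\<lambda>x. cball_ind R x * (2 * M)"])
    show "integrable lebesgue (\<lambda>x::R3. cball_ind R x * (2 * M))"
      by (rule integrable_indicator_cball)
    show "(\<lambda>x. cball_ind R x * \<bar>h x - c n x\<bar>) \<in> borel_measurable lebesgue" for n
      by (intro borel_measurable_times borel_measurable_abs borel_measurable_diff h
          continuous_imp_lebesgue_measurable c borel_measurable_indicator) auto
    have "AE x in lebesgue. x \<notin> N"
      using N by (simp add: negligible_iff_null_sets AE_not_in)
    then show "AE x in lebesgue. (\<lambda>n. cball_ind R x * \<bar>h x - c n x\<bar>) \<longlonglongrightarrow> 0"
    proof eventually_elim
      case (elim x)
      have "(\<lambda>n. c n x) \<longlonglongrightarrow> max (- M) (min M (h x))"
        unfolding c_def by (intro tendsto_intros lim elim)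
      moreover have "max (- M) (min M (h x)) = h x"
        using b[of x] by linarith
      ultimately have "(\<lambda>n. cball_ind R x * \<bar>h x - c n x\<bar>) \<longlonglongrightarrow> cball_ind R x * \<bar>h x - h x\<bar>"
        by (intro tendsto_intros) auto
      then show ?case by simp
    qed
    show "AE x in lebesgue. norm (cball_ind R x * \<bar>h x - c n x\<bar>) \<le> cball_ind R x * (2 * M)" for n
    proof (rule AE_I2)
      fix x
      have "\<bar>h x - c n x\<bar> \<le> 2 * M" using b[of x] c(2)[of n x] by linarith
      then show "norm (cball_ind R x * \<bar>h x - c n x\<bar>) \<le> cball_ind R x * (2 * M)"
        by (simp add: indicator_def)
    qed
  qed auto
  then have "eventually (\<lambda>n. (LINT x|lebesgue. cball_ind R x * \<bar>h x - c n x\<bar>) < e) sequentially"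
    using e by (simp add: order_tendsto_iff)
  then obtain n where "(LINT x|lebesgue. cball_ind R x * \<bar>h x - c n x\<bar>) < e"
    by (meson eventually_happens trivial_limit_sequentially)
  with c show thesis by (rule that[of "c n"])
qed

text \<open>Translation settles the integral in \<open>x\<close>; evenness of the kernel exchanges
  the two variables.\<close>

lemma mollifier_integral:
  assumes k: "is_mollifier \<epsilon> k"
  shows "(LINT x|lebesgue. k (x - y)) = 1" "(LINT y|lebesgue. k (x - y)) = 1"
proof -
  have *: "(LINT x|lebesgue. k (x - y)) = 1" for y
    using lebesgue_integral_translation[of k "- y"] k is_mollifier_continuous[OF k]
    by (simp add: is_mollifier_def borel_measurable_continuous_onI)
  show "(LINT x|lebesgue. k (x - y)) = 1" by (rule *)
  have "k (x - y) = k (y - x)" for y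
    using k unfolding is_mollifier_def by (metis minus_diff_eq)
  then show "(LINT y|lebesgue. k (x - y)) = 1" using *[of x] by simp
qed

lemma mollifier_conv_bounded:
  fixes f :: "R3 \<Rightarrow> real"
  assumes f: "f \<in> borel_measurable lebesgue" and b: "\<And>x. \<bar>f x\<bar> \<le> M" and k: "is_mollifier \<epsilon> k"
  shows "\<bar>conv f k x\<bar> \<le> M"
proof -
  note kc = is_mollifier_continuous[OF k] and ks = is_mollifier_support[OF k]
  have i: "integrable lebesgue (\<lambda>y. k (x - y))"
    by (intro integrable_continuous_support continuous_reflect kc bounded_support_reflect ks)
  have "norm (LINT y|lebesgue. f y * k (x - y)) \<le> (LINT y|lebesgue. M * k (x - y))"
  proof (rule Bochner_Integration.integral_norm_bound_integral)
    show "integrable lebesgue (\<lambda>y. f y * k (x - y))"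
      by (rule conv_integrable[OF bounded_L1_loc[OF f b] kc ks])
    show "norm (f y * k (x - y)) \<le> M * k (x - y)" for y
      using b[of y] k by (auto simp: abs_mult is_mollifier_def intro: mult_right_mono)
  qed (intro integrable_mult_right i)
  then show ?thesis
    by (simp add: conv_def mollifier_integral[OF k])
qed

text \<open>Averaging against a probability density does not increase the L^1 norm, by Tonelli. The
  ball grows by 1 because the kernel reaches no further than \<open>\<epsilon> \<le> 1\<close>.
  Borel measurability of \<open>\<psi>\<close> makes the integrand measurable on the product of two
  copies of \<open>lborel\<close>.\<close>

lemma mollifier_conv_L1_bound:
  fixes \<psi> :: "R3 \<Rightarrow> real"
  assumes \<psi>: "\<psi> \<in> borel_measurable borel" and b: "\<And>x. \<bar>\<psi> x\<bar> \<le> M"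
    and k: "is_mollifier \<epsilon> k" and \<epsilon>: "\<epsilon> \<le> 1"
  shows "(LINT x|lebesgue. cball_ind R x * \<bar>conv \<psi> k x\<bar>) \<le> (LINT y|lebesgue. cball_ind (R + 1) y * \<bar>\<psi> y\<bar>)"
proof -
  note kc = is_mollifier_continuous[OF k] and ks = is_mollifier_support[OF k]
  note [measurable] = \<psi> borel_measurable_continuous_onI[OF kc]
  have \<psi>l: "\<psi> \<in> borel_measurable lebesgue"
    using \<psi> by (simp add: measurable_completion)
  note L1 = bounded_L1_loc[OF \<psi>l b]
  have int: "integrable lebesgue (\<lambda>x. cball_ind r x * \<bar>g x\<bar>)"
    if "g \<in> borel_measurable lebesgue" "\<And>x. \<bar>g x\<bar> \<le> M" for g :: "R3 \<Rightarrow> real" and r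
    using integrable_norm[OF L1_loc_integrable[OF bounded_L1_loc[OF that], of 0 r]] by (simp add: abs_mult)
  define F where "F x y = ennreal (cball_ind R x * (cball_ind (R + 1) y * \<bar>\<psi> y\<bar> * k (x - y)))" for x y
  have F: "case_prod F \<in> borel_measurable (lborel \<Otimes>\<^sub>M lborel)"
  proof -
    have "(\<lambda>z. ennreal (a (fst z) * (c (snd z) * \<bar>\<psi> (snd z)\<bar> * k (fst z - snd z)))) \<in> borel_measurable (lborel \<Otimes>\<^sub>M lborel)"
      if [measurable]: "a \<in> borel_measurable borel" "c \<in> borel_measurable borel" for a c :: "R3 \<Rightarrow> real"
      by measurable
    from this[of "cball_ind R" "cball_ind (R + 1)"] show ?thesis
      unfolding F_def split_beta by (simp add: borel_measurable_indicator mult.assoc)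
  qed
  have "ennreal (LINT x|lebesgue. cball_ind R x * \<bar>conv \<psi> k x\<bar>) = (\<integral>\<^sup>+x. ennreal (cball_ind R x * \<bar>conv \<psi> k x\<bar>) \<partial>lborel)"
    using nn_integral_eq_integral[OF int[OF continuous_imp_lebesgue_measurable[OF conv_continuous[OF L1 kc ks]]
          mollifier_conv_bounded[OF \<psi>l b k]], of R] by (simp add: nn_integral_completion)
  also have "\<dots> \<le> (\<integral>\<^sup>+x. (\<integral>\<^sup>+y. F x y \<partial>lborel) \<partial>lborel)"
  proof (rule nn_integral_mono)
    fix x
    show "ennreal (cball_ind R x * \<bar>conv \<psi> k x\<bar>) \<le> (\<integral>\<^sup>+y. F x y \<partial>lborel)"
    proof (cases "x \<in> cball 0 R")
      case True
      have "ennreal \<bar>conv \<psi> k x\<bar> \<le> (\<integral>\<^sup>+y. ennreal (norm (\<psi> y * k (x - y))) \<partial>lebesgue)"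
        using integral_norm_bound_ennreal[OF conv_integrable[OF L1 kc ks]] by (simp add: conv_def)
      also have "\<dots> = (\<integral>\<^sup>+y. F x y \<partial>lebesgue)"
      proof (rule nn_integral_cong)
        fix y
        have "k (x - y) = 0" if "y \<notin> cball 0 (R + 1)"
          using that True k \<epsilon> norm_triangle_ineq2[of y x] by (auto simp: is_mollifier_def norm_minus_commute)
        then show "ennreal (norm (\<psi> y * k (x - y))) = F x y"
          using True k by (cases "y \<in> cball 0 (R + 1)") (auto simp: F_def abs_mult is_mollifier_def)
      qed
      finally show ?thesis using True by (simp add: nn_integral_completion)
    qed simp
  qed
  also have "\<dots> = (\<integral>\<^sup>+y. (\<integral>\<^sup>+x. F x y \<partial>lborel) \<partial>lborel)"
    by (rule lborel_pair.Fubini'[OF F, symmetric])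
  also have "\<dots> \<le> (\<integral>\<^sup>+y. ennreal (cball_ind (R + 1) y * \<bar>\<psi> y\<bar>) \<partial>lborel)"
  proof (rule nn_integral_mono)
    fix y
    let ?c = "cball_ind (R + 1) y * \<bar>\<psi> y\<bar>"
    have "k (x - y) = k (y - x)" for x
      using k unfolding is_mollifier_def by (metis minus_diff_eq)
    then have "integrable lebesgue (\<lambda>x. k (x - y))"
      using integrable_continuous_support[OF continuous_reflect[OF kc] bounded_support_reflect[OF ks], of y] by simp
    then have 1: "(\<integral>\<^sup>+x. ennreal (?c * k (x - y)) \<partial>lebesgue) = ennreal ?c"
      using k mollifier_integral(1)[OF k, of y]
      by (subst nn_integral_eq_integral) (auto simp: is_mollifier_def)
    have "(\<integral>\<^sup>+x. F x y \<partial>lborel) \<le> (\<integral>\<^sup>+x. ennreal (?c * k (x - y)) \<partial>lborel)"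
      using k by (intro nn_integral_mono) (auto simp: F_def indicator_def is_mollifier_def)
    then show "(\<integral>\<^sup>+x. F x y \<partial>lborel) \<le> ennreal ?c"
      using 1 by (simp add: nn_integral_completion)
  qed
  also have "\<dots> = ennreal (LINT y|lebesgue. cball_ind (R + 1) y * \<bar>\<psi> y\<bar>)"
    using nn_integral_eq_integral[OF int[OF \<psi>l b], of "R + 1"] by (simp add: nn_integral_completion)
  finally show ?thesis
    by (subst (asm) ennreal_le_iff) (auto intro!: integral_nonneg_AE)
qed

lemma mollifier_conv_continuous_close:
  assumes \<phi>: "continuous_on UNIV \<phi>" and b: "\<And>x. \<bar>\<phi> x\<bar> \<le> M" and k: "is_mollifier \<epsilon> k"
    and close: "\<And>y. dist y x \<le> \<epsilon> \<Longrightarrow> \<bar>\<phi> y - \<phi> x\<bar> \<le> e"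
  shows "\<bar>conv \<phi> k x - \<phi> x\<bar> \<le> e"
proof -
  note kc = is_mollifier_continuous[OF k] and ks = is_mollifier_support[OF k]
  have L1: "\<phi> \<in> L1_loc"
    by (rule bounded_L1_loc[OF continuous_imp_lebesgue_measurable[OF \<phi>] b])
  have i: "integrable lebesgue (\<lambda>y. k (x - y))"
    by (intro integrable_continuous_support continuous_reflect kc bounded_support_reflect ks)
  have i2: "integrable lebesgue (\<lambda>y. \<phi> y * k (x - y))"
    by (rule conv_integrable[OF L1 kc ks])
  have "conv \<phi> k x - \<phi> x = (LINT y|lebesgue. \<phi> y * k (x - y)) - (LINT y|lebesgue. \<phi> x * k (x - y))"
    by (simp add: conv_def mollifier_integral[OF k])
  also have "\<dots> = (LINT y|lebesgue. (\<phi> y - \<phi> x) * k (x - y))"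
    unfolding left_diff_distrib using i i2
    by (subst Bochner_Integration.integral_diff) auto
  also have "norm \<dots> \<le> (LINT y|lebesgue. e * k (x - y))"
  proof (rule Bochner_Integration.integral_norm_bound_integral)
    show "integrable lebesgue (\<lambda>y. (\<phi> y - \<phi> x) * k (x - y))"
      unfolding left_diff_distrib using i i2 by auto
    show "norm ((\<phi> y - \<phi> x) * k (x - y)) \<le> e * k (x - y)" for y
    proof (cases "dist y x \<le> \<epsilon>")
      case True
      then show ?thesis
        using close[of y] k by (auto simp: abs_mult is_mollifier_def intro: mult_right_mono)
    next
      case False
      then have "k (x - y) = 0"
        using k by (auto simp: is_mollifier_def dist_norm norm_minus_commute)
      then show ?thesis by simp
    qed
  qed (intro integrable_mult_right i)
  finally show ?thesis
    by (simp add: mollifier_integral[OF k])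
qed

text \<open>The density argument: up to a null set, \<open>h\<close> is a continuous function, which
  mollification moves by at most \<open>w\<close> on the ball, plus a function small in L^1, on
  which mollification is a contraction up to enlarging the ball. The threshold \<open>d\<close>
  serves every mollifier, so that one kernel can later be shared by several functions.\<close>

lemma mollifier_L1_converges:
  fixes h :: "R3 \<Rightarrow> real"
  assumes h: "h \<in> borel_measurable lebesgue" and b: "\<And>x. \<bar>h x\<bar> \<le> M" and e: "e > 0"
  shows "\<exists>d>0. \<forall>\<epsilon> k. \<epsilon> \<le> d \<longrightarrow> is_mollifier \<epsilon> k \<longrightarrow>
    (LINT x|lebesgue. cball_ind R x * \<bar>conv h k x - h x\<bar>) < e"
proof -
  have M: "M \<ge> 0" using b[of 0] by linarith
  let ?I = "\<lambda>r x. cball_ind r x"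
  \<comment> \<open>\<open>mollifier_conv_L1_bound\<close> asks for a Borel function, hence this
    representative; truncation in \<open>h'\<close> makes its bound hold at every point.\<close>
  obtain g where g: "g \<in> borel_measurable lborel" "AE x in lborel. h x = g x"
    using completion_ex_borel_measurable_real[OF h] by blast
  define h' where "h' x = max (- M) (min M (g x))" for x
  have "(\<lambda>x. max (- M) (min M (g x))) \<in> borel_measurable borel"
    using g(1) by simp
  then have h': "h' \<in> borel_measurable borel" "\<bar>h' x\<bar> \<le> M" for x
    using M by (auto simp: h'_def[abs_def])
  have h'l: "h' \<in> borel_measurable lebesgue"
    using h'(1) by (simp add: measurable_completion)
  have hh': "AE x in lebesgue. h x = h' x"
    using AE_completion[OF g(2)]
  proof eventually_elim
    case (elim x)
    then show ?case using b[of x] by (auto simp: h'_def)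
  qed
  define V where "V = measure lebesgue (cball (0::R3) R)"
  have V: "V \<ge> 0" by (simp add: V_def)
  \<comment> \<open>The final bound is twice this integral plus \<open>V * w\<close>, each of the
    three contributions being less than \<open>e / 4\<close>.\<close>
  obtain \<phi> where \<phi>: "continuous_on UNIV \<phi>" "\<And>x. \<bar>\<phi> x\<bar> \<le> M"
    "(LINT x|lebesgue. ?I (R + 1) x * \<bar>h' x - \<phi> x\<bar>) < e / 4"
    using bounded_continuous_L1_approx[OF h'l h'(2), of "e / 4" "R + 1"] e by auto
  have \<phi>b: "\<phi> \<in> borel_measurable borel" using \<phi>(1) by (rule borel_measurable_continuous_onI)
  have \<phi>l: "\<phi> \<in> borel_measurable lebesgue" using \<phi>(1) by (rule continuous_imp_lebesgue_measurable)
  define w where "w = e / (4 * (V + 1))"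
  have w: "w > 0" using e V by (simp add: w_def)
  have "uniformly_continuous_on (cball 0 (R + 1)) \<phi>"
    by (rule compact_uniformly_continuous) (use \<phi>(1) continuous_on_subset in auto)
  then obtain d where d: "d > 0"
    "\<And>x y. x \<in> cball 0 (R + 1) \<Longrightarrow> y \<in> cball 0 (R + 1) \<Longrightarrow> dist y x < d \<Longrightarrow> dist (\<phi> y) (\<phi> x) < w"
    unfolding uniformly_continuous_on_def using w by metis
  have int: "integrable lebesgue (\<lambda>x. ?I r x * \<bar>q x\<bar>)"
    if "q \<in> borel_measurable lebesgue" "\<And>x. \<bar>q x\<bar> \<le> 2 * M" for q :: "R3 \<Rightarrow> real" and r
  proof (rule integrable_bounded_support[where C="2 * M" and R=r])
    show "(\<lambda>x. ?I r x * \<bar>q x\<bar>) \<in> borel_measurable lebesgue"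
      by (intro borel_measurable_times borel_measurable_abs that borel_measurable_indicator) auto
    show "norm (?I r x * \<bar>q x\<bar>) \<le> 2 * M" for x
      using that(2)[of x] M by (simp add: indicator_def)
  qed simp
  show ?thesis
  proof (intro exI[of _ "min (d / 2) 1"] conjI allI impI)
    fix \<epsilon> k assume \<epsilon>: "\<epsilon> \<le> min (d / 2) 1" and k: "is_mollifier \<epsilon> k"
    note kc = is_mollifier_continuous[OF k] and ks = is_mollifier_support[OF k]
    have cm: "conv f k \<in> borel_measurable lebesgue" if "f \<in> borel_measurable lebesgue" "\<And>x. \<bar>f x\<bar> \<le> M'" for f M'
      by (intro continuous_imp_lebesgue_measurable conv_continuous bounded_L1_loc[OF that] kc ks)
    define \<psi> where "\<psi> x = h' x - \<phi> x" for x
    have \<psi>: "\<psi> \<in> borel_measurable borel" "\<And>x. \<bar>\<psi> x\<bar> \<le> 2 * M"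
    proof -
      show "\<psi> \<in> borel_measurable borel"
        unfolding \<psi>_def[abs_def] by (intro borel_measurable_diff h'(1) \<phi>b)
      show "\<bar>\<psi> x\<bar> \<le> 2 * M" for x
        using h'(2)[of x] \<phi>(2)[of x] unfolding \<psi>_def by linarith
    qed
    have \<psi>l: "\<psi> \<in> borel_measurable lebesgue" using \<psi>(1) by (simp add: measurable_completion)
    have split: "conv h k x = conv \<psi> k x + conv \<phi> k x" for x
    proof -
      have "conv h k x = conv h' k x"
        by (rule conv_cong_AE[OF hh' h h'l kc])
      also have "\<dots> = (LINT y|lebesgue. \<psi> y * k (x - y) + \<phi> y * k (x - y))"
        by (simp add: conv_def \<psi>_def algebra_simps)
      also have "\<dots> = conv \<psi> k x + conv \<phi> k x"
        unfolding conv_def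
        by (intro Bochner_Integration.integral_add conv_integrable bounded_L1_loc[OF \<psi>l \<psi>(2)] bounded_L1_loc[OF \<phi>l \<phi>(2)] kc ks)
      finally show ?thesis .
    qed
    have I: "integrable lebesgue (\<lambda>x. ?I R x * \<bar>conv \<psi> k x\<bar>)" "integrable lebesgue (\<lambda>x. ?I R x * w)"
      "integrable lebesgue (\<lambda>x. ?I r x * \<bar>\<psi> x\<bar>)" for r
      by (intro int cm[OF \<psi>l \<psi>(2)] mollifier_conv_bounded[OF \<psi>l \<psi>(2) k] integrable_indicator_cball \<psi>l \<psi>(2))+
    have "(LINT x|lebesgue. ?I R x * \<bar>conv h k x - h x\<bar>) = (LINT x|lebesgue. ?I R x * \<bar>conv h k x - h' x\<bar>)"
    proof (rule integral_cong_AE)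
      show "(\<lambda>x. ?I R x * \<bar>conv h k x - h x\<bar>) \<in> borel_measurable lebesgue"
        "(\<lambda>x. ?I R x * \<bar>conv h k x - h' x\<bar>) \<in> borel_measurable lebesgue"
        by (intro borel_measurable_times borel_measurable_abs borel_measurable_diff
            borel_measurable_indicator cm[OF h b] h h'l; simp)+
    qed (use hh' in auto)
    also have "\<dots> \<le> (LINT x|lebesgue. ?I R x * \<bar>conv \<psi> k x\<bar> + ?I R x * w + ?I R x * \<bar>\<psi> x\<bar>)"
    proof (rule integral_mono_AE')
      show "integrable lebesgue (\<lambda>x. ?I R x * \<bar>conv \<psi> k x\<bar> + ?I R x * w + ?I R x * \<bar>\<psi> x\<bar>)"
        by (intro Bochner_Integration.integrable_add I)
      show "AE x in lebesgue. ?I R x * \<bar>conv h k x - h' x\<bar> \<le> ?I R x * \<bar>conv \<psi> k x\<bar> + ?I R x * w + ?I R x * \<bar>\<psi> x\<bar>"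
      proof (rule AE_I2)
        fix x
        show "?I R x * \<bar>conv h k x - h' x\<bar> \<le> ?I R x * \<bar>conv \<psi> k x\<bar> + ?I R x * w + ?I R x * \<bar>\<psi> x\<bar>"
        proof (cases "x \<in> cball 0 R")
          case True
          have "\<bar>conv \<phi> k x - \<phi> x\<bar> \<le> w"
          proof (rule mollifier_conv_continuous_close[OF \<phi>(1,2) k])
            fix y assume y: "dist y x \<le> \<epsilon>"
            then have "dist y x < d" "y \<in> cball 0 (R + 1)" "x \<in> cball 0 (R + 1)"
              using \<epsilon> d(1) True norm_triangle_sub[of y x] by (auto simp: dist_norm)
            then show "\<bar>\<phi> y - \<phi> x\<bar> \<le> w"
              using d(2)[of x y] by (simp add: dist_real_def)
          qed
          then show ?thesis
            using True by (simp add: split \<psi>_def)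
        qed simp
      qed
    qed (use w in \<open>auto simp: indicator_def\<close>)
    also have "\<dots> = (LINT x|lebesgue. ?I R x * \<bar>conv \<psi> k x\<bar>) + (LINT x|lebesgue. ?I R x * w) + (LINT x|lebesgue. ?I R x * \<bar>\<psi> x\<bar>)"
      using I by (simp add: Bochner_Integration.integral_add)
    also have "(LINT x|lebesgue. ?I R x * w) = V * w"
      by (simp add: V_def)
    also have "V * w < e / 4"
      using e V by (simp add: w_def field_simps)
    also have "(LINT x|lebesgue. ?I R x * \<bar>conv \<psi> k x\<bar>) \<le> (LINT x|lebesgue. ?I (R + 1) x * \<bar>\<psi> x\<bar>)"
      by (rule mollifier_conv_L1_bound[OF \<psi> k]) (use \<epsilon> in auto)
    also have "(LINT x|lebesgue. ?I R x * \<bar>\<psi> x\<bar>) \<le> (LINT x|lebesgue. ?I (R + 1) x * \<bar>\<psi> x\<bar>)"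
      by (intro integral_mono I mult_right_mono) (auto simp: indicator_def)
    finally show "(LINT x|lebesgue. ?I R x * \<bar>conv h k x - h x\<bar>) < e"
      using \<phi>(3) e by (simp add: \<psi>_def)
  qed (use d in auto)
qed

text \<open>Passing from L^1 to almost everywhere convergence costs a subsequence. Adding the errors
  of all \<open>h \<in> A\<close> in \<open>Y\<close> gives one subsequence for all of them, and
  letting the ball of index \<open>n\<close> have radius \<open>n\<close> gives one for the whole
  space.\<close>

lemma mollifiers_AE_converge:
  fixes A :: "(R3 \<Rightarrow> real) set"
  assumes A: "finite A" "\<And>h. h \<in> A \<Longrightarrow> h \<in> borel_measurable lebesgue" "\<And>h x. h \<in> A \<Longrightarrow> \<bar>h x\<bar> \<le> M"
  obtains k where "\<And>n::nat. \<exists>\<epsilon>. is_mollifier \<epsilon> (k n)"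
    "\<And>h. h \<in> A \<Longrightarrow> AE x in lebesgue. (\<lambda>n. conv h (k n) x) \<longlonglongrightarrow> h x"
proof -
  define Z where "Z R k h x = cball_ind R x * \<bar>conv h k x - h x\<bar>" for R k h and x :: R3
  \<comment> \<open>Dividing by \<open>N\<close> keeps the sum of the errors over \<open>A\<close>
    below \<open>inverse (real (Suc n))\<close>; the 1 covers an empty \<open>A\<close>, as does
    \<open>insert 1\<close> in the minimum below.\<close>
  define N where "N = real (card A) + 1"
  have N: "N > 0" by (simp add: N_def add_nonneg_pos)
  have "\<exists>\<epsilon> k. is_mollifier \<epsilon> k \<and> (\<forall>h\<in>A. (LINT x|lebesgue. Z (real n) k h x) < inverse (real (Suc n)) / N)" for n
  proof -
    have "\<forall>h\<in>A. \<exists>d>0. \<forall>\<epsilon> k. \<epsilon> \<le> d \<longrightarrow> is_mollifier \<epsilon> k \<longrightarrow>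
        (LINT x|lebesgue. Z (real n) k h x) < inverse (real (Suc n)) / N"
      unfolding Z_def using N by (intro ballI mollifier_L1_converges[OF A(2,3)]) auto
    from bchoice[OF this] obtain d where d: "\<And>h. h \<in> A \<Longrightarrow> d h > 0" "\<And>h \<epsilon> k. h \<in> A \<Longrightarrow> \<epsilon> \<le> d h \<Longrightarrow> is_mollifier \<epsilon> k \<Longrightarrow>
        (LINT x|lebesgue. Z (real n) k h x) < inverse (real (Suc n)) / N"
      by blast
    define \<epsilon> where "\<epsilon> = Min (insert 1 (d ` A))"
    have \<epsilon>: "\<epsilon> > 0" "\<And>h. h \<in> A \<Longrightarrow> \<epsilon> \<le> d h"
      using A(1) d(1) unfolding \<epsilon>_def by (auto simp del: Min_insert)
    obtain k where k: "is_mollifier \<epsilon> k"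
      using mollifier_exists[OF \<epsilon>(1)] by blast
    show ?thesis
      by (intro exI[of _ \<epsilon>] exI[of _ k] conjI ballI k) (rule d(2)[OF _ \<epsilon>(2) k])
  qed
  then have "\<exists>k. \<forall>n. (\<exists>\<epsilon>. is_mollifier \<epsilon> (k n)) \<and>
      (\<forall>h\<in>A. (LINT x|lebesgue. Z (real n) (k n) h x) < inverse (real (Suc n)) / N)"
    by (intro choice) blast
  then obtain k where "\<And>n. \<exists>\<epsilon>. is_mollifier \<epsilon> (k n)" and k2:
    "\<And>n h. h \<in> A \<Longrightarrow> (LINT x|lebesgue. Z (real n) (k n) h x) < inverse (real (Suc n)) / N"
    by blast
  then obtain \<epsilon> where k: "\<And>n. is_mollifier (\<epsilon> n) (k n)"
    by metis
  have Zi: "integrable lebesgue (Z R (k n) h)" if "h \<in> A" for R n h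
  proof -
    have "(conv h (k n)) \<in> borel_measurable lebesgue"
      by (intro continuous_imp_lebesgue_measurable conv_continuous bounded_L1_loc[OF A(2,3)[OF that]]
          is_mollifier_continuous[OF k(1)] is_mollifier_support[OF k(1)])
    moreover have "\<bar>conv h (k n) x - h x\<bar> \<le> 2 * M" for x
    proof -
      have "\<bar>conv h (k n) x\<bar> \<le> M"
        by (rule mollifier_conv_bounded[OF A(2)[OF that] A(3)[OF that] k(1)])
      then show ?thesis using A(3)[OF that, of x] by linarith
    qed
    moreover have "M \<ge> 0" using A(3)[OF that, of 0] by linarith
    moreover have "Z R (k n) h \<in> borel_measurable lebesgue"
      unfolding Z_def[abs_def]
      by (intro borel_measurable_times borel_measurable_abs borel_measurable_diff borel_measurable_indicator
          calculation(1) A(2)[OF that]) simp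
    ultimately show ?thesis
      by (intro integrable_bounded_support[where C="2 * M" and R=R]) (simp_all add: Z_def indicator_def)
  qed
  define Y where "Y n x = (\<Sum>h\<in>A. Z (real n) (k n) h x)" for n x
  have Zn: "Z R k h x \<ge> 0" for R k h x by (simp add: Z_def)
  have "\<exists>r::nat\<Rightarrow>nat. strict_mono r \<and> (AE x in lebesgue. (\<lambda>n. Y (r n) x) \<longlonglongrightarrow> 0)"
  proof (rule tendsto_L1_AE_subseq)
    show Yi: "integrable lebesgue (Y n)" for n
      unfolding Y_def by (intro Bochner_Integration.integrable_sum Zi)
    show "(\<lambda>n. LINT x|lebesgue. norm (Y n x)) \<longlonglongrightarrow> 0"
    proof (rule tendsto_sandwich[OF _ _ tendsto_const LIMSEQ_inverse_real_of_nat])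
      show "\<forall>\<^sub>F n in sequentially. (LINT x|lebesgue. norm (Y n x)) \<le> inverse (real (Suc n))"
      proof (rule always_eventually, rule allI)
        fix n
        have "(LINT x|lebesgue. norm (Y n x)) = (LINT x|lebesgue. Y n x)"
          by (simp add: Y_def Zn sum_nonneg)
        also have "\<dots> = (\<Sum>h\<in>A. LINT x|lebesgue. Z (real n) (k n) h x)"
          unfolding Y_def by (rule Bochner_Integration.integral_sum) (rule Zi)
        also have "\<dots> \<le> (\<Sum>h\<in>A. inverse (real (Suc n)) / N)"
          by (intro sum_mono less_imp_le k2)
        also have "\<dots> = real (card A) / N * inverse (real (Suc n))"
          by simp
        also have "\<dots> \<le> 1 * inverse (real (Suc n))"
          by (intro mult_right_mono) (auto simp: N_def)
        finally show "(LINT x|lebesgue. norm (Y n x)) \<le> inverse (real (Suc n))" by simp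
      qed
    qed auto
  qed
  then obtain r :: "nat \<Rightarrow> nat" where r: "strict_mono r" "AE x in lebesgue. (\<lambda>n. Y (r n) x) \<longlonglongrightarrow> 0"
    by blast
  show thesis
  proof (rule that[of "\<lambda>n. k (r n)"])
    show "\<exists>\<epsilon>. is_mollifier \<epsilon> (k (r n))" for n using k by blast
    fix h assume h: "h \<in> A"
    from r(2) show "AE x in lebesgue. (\<lambda>n. conv h (k (r n)) x) \<longlonglongrightarrow> h x"
    proof eventually_elim
      case (elim x)
      have "(\<lambda>n. conv h (k (r n)) x - h x) \<longlonglongrightarrow> 0"
      proof (rule Lim_null_comparison[OF _ elim])
        \<comment> \<open>Once \<open>x\<close> lies in the ball of radius \<open>r n\<close>, its
          error for \<open>h\<close> is one of the nonnegative summands of \<open>Y\<close>.\<close>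
        have "\<forall>\<^sub>F n in sequentially. norm x \<le> real n"
          using filterlim_real_sequentially unfolding filterlim_at_top by blast
        then have "\<forall>\<^sub>F n in sequentially. norm x \<le> real (r n)"
          using filterlim_subseq[OF r(1)] by (auto simp: filterlim_iff)
        then show "\<forall>\<^sub>F n in sequentially. norm (conv h (k (r n)) x - h x) \<le> Y (r n) x"
        proof eventually_elim
          case (elim n)
          have "norm (conv h (k (r n)) x - h x) = Z (real (r n)) (k (r n)) h x"
            using elim by (simp add: Z_def)
          also have "\<dots> \<le> Y (r n) x"
            unfolding Y_def by (rule member_le_sum) (use h A(1) Zn in auto)
          finally show ?case .
        qed
      qed
      then show ?case by (simp add: LIM_zero_iff)
    qed
  qed
qed

section \<open>Stability outside a ball\<close>

lemma C1c_add:
  assumes "f \<in> C1c" "g \<in> C1c"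
  shows "f + g \<in> C1c" "grad (f + g) x = grad f x + grad g x"
proof -
  have C1: "is_C1 (f + g) (\<lambda>x. grad f x + grad g x)"
    unfolding plus_fun_def by (intro is_C1_add C1c_D assms)
  have "{x. (f + g) x \<noteq> 0} \<subseteq> {x. f x \<noteq> 0} \<union> {x. g x \<noteq> 0}" by auto
  then have "bounded {x. (f + g) x \<noteq> 0}"
    using bounded_subset bounded_Un C1c_D(2)[OF assms(1)] C1c_D(2)[OF assms(2)] by metis
  with C1 show "f + g \<in> C1c" by (rule C1c_I)
  show "grad (f + g) x = grad f x + grad g x" by (simp add: is_C1_grad[OF C1])
qed

lemma C1c_scaleR:
  assumes "f \<in> C1c"
  shows "c *\<^sub>R f \<in> C1c" "grad (c *\<^sub>R f) x = c *\<^sub>R grad f x"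
proof -
  have C1: "is_C1 (c *\<^sub>R f) (\<lambda>x. c *\<^sub>R grad f x)"
    unfolding scaleR_fun_def real_scaleR_def by (intro is_C1_cmult C1c_D assms)
  have "bounded {x. (c *\<^sub>R f) x \<noteq> 0}"
    by (rule bounded_subset[OF C1c_D(2)[OF assms]]) auto
  with C1 show "c *\<^sub>R f \<in> C1c" by (rule C1c_I)
  show "grad (c *\<^sub>R f) x = c *\<^sub>R grad f x" by (simp add: is_C1_grad[OF C1])
qed

lemma C1c_zero: "0 \<in> C1c" "grad 0 x = 0"
proof -
  have C1: "is_C1 0 (\<lambda>x. 0)" using is_C1_const[of 0] by (simp add: zero_fun_def)
  then show "0 \<in> C1c" by (rule C1c_I) simp
  show "grad 0 x = 0" by (simp add: is_C1_grad[OF C1])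
qed

lemma subspace_C1c: "subspace (C1c \<times> C1c)"
  by (auto simp: subspace_def zero_prod_def C1c_zero C1c_add C1c_scaleR)

lemma edim_finite:
  assumes "edim W \<noteq> \<infinity>"
  obtains B where "finite B" "W \<subseteq> span B" "edim W = enat (dim W)"
proof -
  obtain B where B: "finite B" "W \<subseteq> span B"
    using assms by (auto simp: edim_def split: if_splits)
  then show thesis
    by (intro that[OF B]) (auto simp: edim_def)
qed

lemma integrable_continuous_weight:
  fixes f k :: "R3 \<Rightarrow> real"
  assumes f: "f \<in> borel_measurable lebesgue" "\<And>x. \<bar>f x\<bar> \<le> C"
    and k: "continuous_on UNIV k" "bounded {x. k x \<noteq> 0}"
  shows "integrable lebesgue (\<lambda>x. f x * k x)"
  by (rule integrable_mult_test[OF bounded_L1_loc[OF f] k])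

definition Q_density :: "(R3 \<Rightarrow> real) \<Rightarrow> (R3 \<Rightarrow> real) \<Rightarrow> (R3 \<Rightarrow> real) \<Rightarrow> (R3 \<Rightarrow> real) \<Rightarrow> R3 \<Rightarrow> real" where
  "Q_density u v \<phi> \<psi> x = (v x)\<^sup>2 * (\<phi> x)\<^sup>2 + (u x)\<^sup>2 * (\<psi> x)\<^sup>2 + 4 * u x * v x * \<phi> x * \<psi> x"

lemma Q_density_integrable:
  assumes u: "u \<in> borel_measurable lebesgue" "\<And>x. \<bar>u x\<bar> \<le> M"
    and v: "v \<in> borel_measurable lebesgue" "\<And>x. \<bar>v x\<bar> \<le> M"
    and \<phi>: "\<phi> \<in> C1c" and \<psi>: "\<psi> \<in> C1c"
  shows "integrable lebesgue (Q_density u v \<phi> \<psi>)"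
proof -
  note c = is_C1_continuous[OF C1c_D(1)]
  have sq: "integrable lebesgue (\<lambda>x. (f x)\<^sup>2 * (\<eta> x)\<^sup>2)"
    if f: "f \<in> borel_measurable lebesgue" "\<And>x. \<bar>f x\<bar> \<le> M" and \<eta>: "\<eta> \<in> C1c" for f \<eta>
  proof (rule integrable_continuous_weight[where C="M\<^sup>2"])
    show "\<bar>(f x)\<^sup>2\<bar> \<le> M\<^sup>2" for x
      using power_mono[OF f(2)[of x], of 2] by simp
    show "bounded {x. (\<eta> x)\<^sup>2 \<noteq> 0}"
      by (rule bounded_subset[OF C1c_D(2)[OF \<eta>]]) auto
  qed (use f in \<open>auto intro!: continuous_intros c[OF \<eta>]\<close>)
  have 1: "integrable lebesgue (\<lambda>x. (v x)\<^sup>2 * (\<phi> x)\<^sup>2)"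
    by (rule sq[OF v \<phi>])
  have 2: "integrable lebesgue (\<lambda>x. (u x)\<^sup>2 * (\<psi> x)\<^sup>2)"
    by (rule sq[OF u \<psi>])
  have 3: "integrable lebesgue (\<lambda>x. (u x * v x) * (4 * \<phi> x * \<psi> x))"
  proof (rule integrable_continuous_weight[where C="M * M"])
    show "bounded {x. 4 * \<phi> x * \<psi> x \<noteq> 0}"
      by (rule bounded_subset[OF C1c_D(2)[OF \<phi>]]) auto
    show "\<bar>u x * v x\<bar> \<le> M * M" for x
      unfolding abs_mult using u(2)[of x] v(2)[of x] by (intro mult_mono) auto
  qed (use u v in \<open>auto intro!: continuous_intros c[OF \<phi>] c[OF \<psi>]\<close>)
  have "integrable lebesgue (\<lambda>x. (v x)\<^sup>2 * (\<phi> x)\<^sup>2 + (u x)\<^sup>2 * (\<psi> x)\<^sup>2 + (u x * v x) * (4 * \<phi> x * \<psi> x))"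
    by (intro Bochner_Integration.integrable_add 1 2 3)
  then show ?thesis
    by (simp add: Q_density_def[abs_def] mult_ac)
qed

lemma norm_grad_integrable:
  assumes "\<phi> \<in> C1c" "\<psi> \<in> C1c"
  shows "integrable lebesgue (\<lambda>x. (norm (grad \<phi> x))\<^sup>2 + (norm (grad \<psi> x))\<^sup>2)"
proof (rule integrable_continuous_support)
  show "continuous_on UNIV (\<lambda>x. (norm (grad \<phi> x))\<^sup>2 + (norm (grad \<psi> x))\<^sup>2)"
    by (intro continuous_intros is_C1_continuous_grad[OF C1c_D(1)] assms)
  have "{x. (norm (grad \<phi> x))\<^sup>2 + (norm (grad \<psi> x))\<^sup>2 \<noteq> 0} \<subseteq> {x. grad \<phi> x \<noteq> 0} \<union> {x. grad \<psi> x \<noteq> 0}"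
    by auto
  then show "bounded {x. (norm (grad \<phi> x))\<^sup>2 + (norm (grad \<psi> x))\<^sup>2 \<noteq> 0}"
    by (rule bounded_subset[rotated]) (simp add: is_C1_support[OF C1c_D[OF assms(1)]] is_C1_support[OF C1c_D[OF assms(2)]])
qed

text \<open>At every point one of the two pairs vanishes together with its gradient, so the
  quadratic form has no cross terms. The gap between \<open>r\<close> and \<open>r + 1\<close> makes
  the gradients of the outer pair vanish on the closed ball of radius \<open>r\<close>, boundary
  included.\<close>

lemma Q_form_disjoint_add:
  assumes u: "u \<in> borel_measurable lebesgue" "\<And>x. \<bar>u x\<bar> \<le> M"
    and v: "v \<in> borel_measurable lebesgue" "\<And>x. \<bar>v x\<bar> \<le> M"
    and C: "\<phi>\<^sub>0 \<in> C1c" "\<psi>\<^sub>0 \<in> C1c" "\<phi> \<in> C1c" "\<psi> \<in> C1c"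
    and out: "\<And>x. x \<notin> cball 0 r \<Longrightarrow> \<phi>\<^sub>0 x = 0 \<and> \<psi>\<^sub>0 x = 0"
    and inn: "\<And>x. x \<in> cball 0 (r + 1) \<Longrightarrow> \<phi> x = 0 \<and> \<psi> x = 0"
  shows "Q_form u v ((\<phi>\<^sub>0, \<psi>\<^sub>0) + c *\<^sub>R (\<phi>, \<psi>)) = Q_form u v (\<phi>\<^sub>0, \<psi>\<^sub>0) + c\<^sup>2 * Q_form u v (\<phi>, \<psi>)"
proof -
  let ?E = "\<lambda>\<phi> \<psi> x. (norm (grad \<phi> x))\<^sup>2 + (norm (grad \<psi> x))\<^sup>2"
  have gradout: "grad f x = 0" if "f \<in> C1c" "\<And>x. x \<notin> cball 0 r \<Longrightarrow> f x = 0" "x \<notin> cball 0 r" for f x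
    by (rule is_C1_zero_outside[OF C1c_D(1)[OF that(1)] that(2,3)])
  have gradin: "grad f x = 0" if "f \<in> C1c" "\<And>x. x \<in> cball 0 (r + 1) \<Longrightarrow> f x = 0" "x \<in> cball 0 r" for f x
    by (rule is_C1_zero_on_open[OF C1c_D(1)[OF that(1)], of "ball 0 (r + 1)"]) (use that in auto)
  have E: "?E (\<phi>\<^sub>0 + c *\<^sub>R \<phi>) (\<psi>\<^sub>0 + c *\<^sub>R \<psi>) x = ?E \<phi>\<^sub>0 \<psi>\<^sub>0 x + c\<^sup>2 * ?E \<phi> \<psi> x" for x
  proof (cases "x \<in> cball 0 r")
    case True
    then have "grad \<phi> x = 0" "grad \<psi> x = 0" using gradin[OF C(3)] gradin[OF C(4)] inn by auto
    then show ?thesis by (simp add: C1c_add C1c_scaleR C)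
  next
    case False
    then have "grad \<phi>\<^sub>0 x = 0" "grad \<psi>\<^sub>0 x = 0" using gradout[OF C(1)] gradout[OF C(2)] out by auto
    then show ?thesis by (simp add: C1c_add C1c_scaleR C power_mult_distrib algebra_simps)
  qed
  have D: "Q_density u v (\<phi>\<^sub>0 + c *\<^sub>R \<phi>) (\<psi>\<^sub>0 + c *\<^sub>R \<psi>) x =
      Q_density u v \<phi>\<^sub>0 \<psi>\<^sub>0 x + c\<^sup>2 * Q_density u v \<phi> \<psi> x" for x
  proof (cases "x \<in> cball 0 r")
    case True
    then have "\<phi> x = 0" "\<psi> x = 0" using inn by auto
    then show ?thesis by (simp add: Q_density_def)
  next
    case False
    then have "\<phi>\<^sub>0 x = 0" "\<psi>\<^sub>0 x = 0" using out by auto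
    then show ?thesis by (simp add: Q_density_def power_mult_distrib algebra_simps power2_eq_square)
  qed
  have Q: "Q_form u v (f, g) = (LINT x|lebesgue. ?E f g x) - (LINT x|lebesgue. Q_density u v f g x)" for f g
    by (simp add: Q_form_def Q_density_def)
  have "Q_form u v ((\<phi>\<^sub>0, \<psi>\<^sub>0) + c *\<^sub>R (\<phi>, \<psi>)) = Q_form u v (\<phi>\<^sub>0 + c *\<^sub>R \<phi>, \<psi>\<^sub>0 + c *\<^sub>R \<psi>)"
    by simp
  also have "\<dots> = ((LINT x|lebesgue. ?E \<phi>\<^sub>0 \<psi>\<^sub>0 x) + c\<^sup>2 * (LINT x|lebesgue. ?E \<phi> \<psi> x)) -
     ((LINT x|lebesgue. Q_density u v \<phi>\<^sub>0 \<psi>\<^sub>0 x) + c\<^sup>2 * (LINT x|lebesgue. Q_density u v \<phi> \<psi> x))"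
    unfolding Q E D using norm_grad_integrable[OF C(1,2)] norm_grad_integrable[OF C(3,4)]
      Q_density_integrable[OF u v C(1,2)] Q_density_integrable[OF u v C(3,4)]
    by (simp only: Bochner_Integration.integral_add integrable_mult_right integral_mult_right_zero)
  finally show ?thesis by (simp add: Q algebra_simps)
qed

lemma finite_morse_index_imp_stable_outside_ball:
  assumes u: "u \<in> borel_measurable lebesgue" "\<And>x. \<bar>u x\<bar> \<le> M"
    and v: "v \<in> borel_measurable lebesgue" "\<And>x. \<bar>v x\<bar> \<le> M"
    and fin: "morse_index u v < \<infinity>"
  obtains r where "r > 0" "\<And>\<phi> \<psi>. \<phi> \<in> C1c \<Longrightarrow> \<psi> \<in> C1c \<Longrightarrow>
    (\<And>x. x \<in> cball 0 r \<Longrightarrow> \<phi> x = 0 \<and> \<psi> x = 0) \<Longrightarrow> Q_form u v (\<phi>, \<psi>) \<ge> 0"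
proof -
  define S where "S = {W. subspace W \<and> W \<subseteq> C1c \<times> C1c \<and> (\<forall>w\<in>W. w \<noteq> 0 \<longrightarrow> Q_form u v w < 0)}"
  obtain m where m: "morse_index u v = enat m"
    using fin by (cases "morse_index u v") auto
  have Q0: "Q_form u v 0 = 0"
    by (simp add: Q_form_def zero_prod_def C1c_zero zero_fun_def) (simp add: C1c_zero(2)[unfolded zero_fun_def])
  have le: "edim W \<le> enat m" if "W \<in> S" for W
    unfolding m[symmetric] morse_index_def using that by (intro SUP_upper) (simp add: S_def)
  then have nInf: "edim W \<noteq> \<infinity>" if "W \<in> S" for W
    using le[OF that] by (cases "edim W") auto
  have dimle: "dim W \<le> m" if "W \<in> S" for W
  proof -
    have "edim W = enat (dim W)"
      using edim_finite[OF nInf[OF that]] by blast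
    then show ?thesis using le[OF that] by simp
  qed
  have "{0} \<in> S"
    using C1c_zero(1) by (auto simp: S_def subspace_single_0 zero_prod_def[symmetric] mem_Times_iff)
  \<comment> \<open>Dimensions in \<open>S\<close> are bounded by the Morse index, so the greatest
    one is attained.\<close>
  then obtain W where W: "W \<in> S" and max: "\<And>W'. W' \<in> S \<Longrightarrow> dim W' \<le> dim W"
    using ex_has_greatest_nat[of "\<lambda>W. W \<in> S" "{0}" dim "Suc m"] dimle
    by (auto simp: less_Suc_eq_le)
  obtain B\<^sub>1 where B\<^sub>1: "finite B\<^sub>1" "W \<subseteq> span B\<^sub>1"
    using edim_finite[OF nInf[OF W]] by blast
  obtain B where B: "B \<subseteq> W" "independent B" "W \<subseteq> span B" "card B = dim W"
    using basis_exists by blast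
  have finB: "finite B"
    using independent_span_bound[OF B\<^sub>1(1) B(2)] B(1) B\<^sub>1(2) by blast
  have sW: "subspace W" "W \<subseteq> C1c \<times> C1c" "\<And>w. w \<in> W \<Longrightarrow> w \<noteq> 0 \<Longrightarrow> Q_form u v w < 0"
    using W by (auto simp: S_def)
  have spanB: "span B = W"
    by (rule subset_antisym[OF span_minimal[OF B(1) sW(1)] B(3)])
  \<comment> \<open>The basis is finite, so a single ball contains the supports of all elements of
    \<open>W\<close>.\<close>
  have "bounded (\<Union>b\<in>B. {x. fst b x \<noteq> 0} \<union> {x. snd b x \<noteq> 0})"
  proof (rule bounded_UN[OF finB], rule ballI)
    fix b assume "b \<in> B"
    then have "fst b \<in> C1c" "snd b \<in> C1c" using B(1) sW(2) by auto
    then show "bounded ({x. fst b x \<noteq> 0} \<union> {x. snd b x \<noteq> 0})"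
      using C1c_D(2) by simp
  qed
  then obtain r where r: "r > 0" "\<And>x b. b \<in> B \<Longrightarrow> fst b x \<noteq> 0 \<or> snd b x \<noteq> 0 \<Longrightarrow> norm x \<le> r"
    unfolding bounded_pos by blast
  have Wout: "\<forall>x. x \<notin> cball 0 r \<longrightarrow> fst w x = 0 \<and> snd w x = 0" if "w \<in> W" for w
  proof -
    have "w \<in> span B" using that B(3) by blast
    then show ?thesis
    proof (rule span_induct)
      show "subspace {w. \<forall>x. x \<notin> cball 0 r \<longrightarrow> fst w x = 0 \<and> snd w x = (0::real)}"
        by (auto simp: subspace_def)
    qed (use r(2) in auto)
  qed
  show thesis
  \<comment> \<open>The additional 1 is the gap required by
    \<open>Q_form_disjoint_add\<close>.\<close>
  proof (rule that[of "r + 1"])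
    fix \<phi> \<psi> assume C: "\<phi> \<in> C1c" "\<psi> \<in> C1c" and inn: "\<And>x. x \<in> cball 0 (r + 1) \<Longrightarrow> \<phi> x = 0 \<and> \<psi> x = 0"
    show "Q_form u v (\<phi>, \<psi>) \<ge> 0"
    proof (rule ccontr)
      assume "\<not> Q_form u v (\<phi>, \<psi>) \<ge> 0"
      then have neg: "Q_form u v (\<phi>, \<psi>) < 0" by simp
      let ?p = "(\<phi>, \<psi>)"
      have pnW: "?p \<notin> W"
      proof
        assume "?p \<in> W"
        then have "\<phi> x = 0 \<and> \<psi> x = 0" for x
          using Wout[of ?p] inn[of x] by (cases "x \<in> cball 0 r") auto
        then have "?p = 0" by (auto simp: zero_prod_def fun_eq_iff)
        then show False using neg Q0 by simp
      qed
      let ?W = "span (insert ?p B)"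
      have "?W \<in> S"
        unfolding S_def
      proof (intro CollectI conjI ballI impI)
        show "?W \<subseteq> C1c \<times> C1c"
          by (rule span_minimal[OF _ subspace_C1c]) (use C B(1) sW(2) in auto)
        fix w assume w: "w \<in> ?W" "w \<noteq> 0"
        then obtain c where c: "w - c *\<^sub>R ?p \<in> W"
          by (auto simp: span_insert spanB)
        define w0 where "w0 = w - c *\<^sub>R ?p"
        have w0: "w0 \<in> W" "w = w0 + c *\<^sub>R ?p" using c by (simp_all add: w0_def)
        have C0: "fst w0 \<in> C1c" "snd w0 \<in> C1c" using w0(1) sW(2) by auto
        have "Q_form u v ((fst w0, snd w0) + c *\<^sub>R ?p) = Q_form u v (fst w0, snd w0) + c\<^sup>2 * Q_form u v ?p"
          by (rule Q_form_disjoint_add[OF u v C0 C, of r]) (use Wout[OF w0(1)] inn in auto)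
        then have eq: "Q_form u v w = Q_form u v w0 + c\<^sup>2 * Q_form u v ?p"
          by (simp add: w0(2))
        show "Q_form u v w < 0"
        proof (cases "w0 = 0")
          case True
          then have "c \<noteq> 0" using w(2) w0(2) by (auto simp: zero_prod_def)
          then show ?thesis using eq True Q0 neg by (simp add: mult_pos_neg)
        next
          case False
          then have "Q_form u v w0 < 0" using sW(3) w0(1) by blast
          moreover have "c\<^sup>2 * Q_form u v ?p \<le> 0" using neg by (simp add: mult_nonneg_nonpos)
          ultimately show ?thesis using eq by linarith
        qed
      qed (rule subspace_span)
      moreover have "dim ?W = Suc (dim W)"
      proof -
        have "?p \<notin> span B" using pnW spanB by simp
        then have "independent (insert ?p B)" "?p \<notin> B"
          using B(2) by (auto simp: independent_insert span_base)
        then show ?thesis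
          using finB B(4) by (simp add: dim_span_eq_card_independent del: dim_span)
      qed
      ultimately show False using max[of ?W] by simp
    qed
  qed (use r in auto)
qed

section \<open>Integral identities\<close>

text \<open>Turns a vanishing divergence integral into an equation between two integrals;
  integrability of \<open>B\<close> follows from \<open>B = A - X\<close>. The value
  \<open>c\<close> is left open because combined identities produce values such as
  \<open>0 - 1/2 * 0\<close>.\<close>

lemma has_integral_diff_zero_imp_eq:
  fixes A B :: "R3 \<Rightarrow> real"
  assumes X: "has_bochner_integral lebesgue X c" and c: "c = 0" and eq: "\<And>x. X x = A x - B x"
    and A: "integrable lebesgue A"
  shows "(LINT x|lebesgue. A x) = (LINT x|lebesgue. B x)"
proof -
  have B: "B = (\<lambda>x. A x - X x)" by (simp add: eq fun_eq_iff)
  have "has_bochner_integral lebesgue B ((LINT x|lebesgue. A x) - 0)"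
    unfolding B using X c by (intro has_bochner_integral_diff has_bochner_integral_integrable A) simp
  then show ?thesis
    by (simp add: has_bochner_integral_iff)
qed

lemma integrable_continuous_mult_support:
  fixes f k :: "R3 \<Rightarrow> real"
  assumes "continuous_on UNIV f" "continuous_on UNIV k" "bounded {x. k x \<noteq> 0}"
  shows "integrable lebesgue (\<lambda>x. f x * k x)"
proof (rule integrable_continuous_support)
  show "bounded {x. f x * k x \<noteq> 0}"
    by (rule bounded_subset[OF assms(3)]) auto
qed (intro continuous_intros assms)

text \<open>Pointwise, |grad (w \<phi>)|^2 differs from the integrand on the right by the divergence
  of w \<phi>^2 grad w. This makes the test pair \<open>(u \<phi>, v \<phi>)\<close>
  computable.\<close>

lemma integral_norm_grad_mult:
  assumes w: "is_C2 w g H" and \<phi>: "is_C1 \<phi> \<phi>'" and s: "bounded {x. \<phi> x \<noteq> 0}"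
  shows "(LINT x|lebesgue. (norm (grad (\<lambda>x. w x * \<phi> x) x))\<^sup>2) =
    (LINT x|lebesgue. - trace (H x) * w x * (\<phi> x)\<^sup>2 + (w x)\<^sup>2 * (norm (\<phi>' x))\<^sup>2)"
    (is "integral\<^sup>L _ ?A = integral\<^sup>L _ ?B")
proof -
  note w1 = is_C2_imp_C1[OF w]
  have gr: "is_C1 (\<lambda>x. w x * \<phi> x) (\<lambda>x. w x *\<^sub>R \<phi>' x + \<phi> x *\<^sub>R g x)"
    by (rule is_C1_mult[OF w1 \<phi>])
  have X: "has_bochner_integral lebesgue (\<lambda>x. (w x *\<^sub>R (2 * \<phi> x) *\<^sub>R \<phi>' x + (\<phi> x)\<^sup>2 *\<^sub>R g x) \<bullet> g x
      + (w x * (\<phi> x)\<^sup>2) * trace (H x)) 0" (is "has_bochner_integral _ ?X _")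
    by (rule has_integral_div_zero[OF is_C1_mult[OF w1 is_C1_power2[OF \<phi>]] is_C2_grad_C1[OF w]])
      (rule bounded_subset[OF s], auto)
  show ?thesis
  proof (rule has_integral_diff_zero_imp_eq[OF X refl])
    show "?X x = ?A x - ?B x" for x
      unfolding is_C1_grad[OF gr] power2_norm_eq_inner
      by (simp add: inner_add_left inner_add_right inner_commute power2_eq_square algebra_simps)
    have "bounded {x. w x * \<phi> x \<noteq> 0}"
      by (rule bounded_subset[OF s]) auto
    then have "(\<lambda>x. w x * \<phi> x) \<in> C1c" by (rule C1c_I[OF gr])
    from norm_grad_integrable[OF this C1c_zero(1)]
    show "integrable lebesgue (\<lambda>x. (norm (grad (\<lambda>x. w x * \<phi> x) x))\<^sup>2)"
      by (simp add: C1c_zero)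
  qed
qed

text \<open>The integrands differ by the divergence of w \<phi> grad w minus half the divergence of
  w^2 grad \<phi>. The second field removes the mixed term, so the right-hand side contains only
  \<open>w\<close> and its Laplacian, which have limits along the mollifications.\<close>

lemma energy_identity:
  assumes w: "is_C2 w g H" and \<phi>: "is_C2 \<phi> \<phi>' \<phi>''" and s: "bounded {x. \<phi> x \<noteq> 0}"
  shows "(LINT x|lebesgue. (norm (g x))\<^sup>2 * \<phi> x) =
    (LINT x|lebesgue. - trace (H x) * w x * \<phi> x + (w x)\<^sup>2 * (trace (\<phi>'' x) / 2))"
    (is "integral\<^sup>L _ ?A = integral\<^sup>L _ ?B")
proof -
  note w1 = is_C2_imp_C1[OF w] and \<phi>1 = is_C2_imp_C1[OF \<phi>]
  have X1: "has_bochner_integral lebesgue (\<lambda>x. (w x *\<^sub>R \<phi>' x + \<phi> x *\<^sub>R g x) \<bullet> g x + (w x * \<phi> x) * trace (H x)) 0"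
    (is "has_bochner_integral _ ?X1 _")
    by (rule has_integral_div_zero[OF is_C1_mult[OF w1 \<phi>1] is_C2_grad_C1[OF w]])
      (rule bounded_subset[OF s], auto)
  have X2: "has_bochner_integral lebesgue (\<lambda>x. ((2 * w x) *\<^sub>R g x) \<bullet> \<phi>' x + (w x)\<^sup>2 * trace (\<phi>'' x)) 0"
    (is "has_bochner_integral _ ?X2 _")
    by (rule has_integral_div_zero[OF is_C1_power2[OF w1] is_C2_grad_C1[OF \<phi>]])
      (rule bounded_subset[OF is_C1_support[OF \<phi>1 s]], auto)
  show ?thesis
  proof (rule has_integral_diff_zero_imp_eq[OF has_bochner_integral_diff[OF X1
          has_bochner_integral_mult_right[OF X2, of "1/2"]]])
    show "?X1 x - 1/2 * ?X2 x = ?A x - ?B x" for x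
      unfolding power2_norm_eq_inner
      by (simp add: inner_add_left inner_commute algebra_simps)
    show "integrable lebesgue (\<lambda>x. (norm (g x))\<^sup>2 * \<phi> x)"
      by (intro integrable_continuous_mult_support continuous_intros s
          is_C1_continuous_grad[OF w1] is_C1_continuous[OF \<phi>1])
  qed simp
qed

lemma is_C1_inner_id:
  assumes "is_C2 w g H"
  shows "is_C1 (\<lambda>x. x \<bullet> g x) (\<lambda>x. (\<Sum>i\<in>UNIV. x $ i *\<^sub>R H x $ i) + g x)"
proof (rule is_C1_cong)
  show "is_C1 (\<lambda>x. \<Sum>i\<in>UNIV. x $ i * g x $ i) (\<lambda>x. \<Sum>i\<in>UNIV. x $ i *\<^sub>R H x $ i + g x $ i *\<^sub>R axis i 1)"
    by (intro is_C1_sum is_C1_mult is_C1_nth is_C2_grad_C1[OF assms])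
qed (simp_all add: inner_vec_def sum.distrib vec_eq_iff axis_def if_distrib sum.If_cases cong: if_cong)

lemma is_C1_norm_grad2:
  assumes "is_C2 w g H"
  shows "is_C1 (\<lambda>x. (norm (g x))\<^sup>2) (\<lambda>x. 2 *\<^sub>R (\<Sum>i\<in>UNIV. g x $ i *\<^sub>R H x $ i))"
proof (rule is_C1_cong)
  show "is_C1 (\<lambda>x. \<Sum>i\<in>UNIV. (g x $ i)\<^sup>2) (\<lambda>x. \<Sum>i\<in>UNIV. (2 * g x $ i) *\<^sub>R H x $ i)"
    by (intro is_C1_sum is_C1_power2 is_C2_grad_C1[OF assms])
  show "(\<Sum>i\<in>UNIV. (g x $ i)\<^sup>2) = (norm (g x))\<^sup>2" for x
    unfolding power2_norm_eq_inner by (simp add: inner_vec_def power2_eq_square)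
qed (simp add: scaleR_sum_right)

lemma trace_identity_R3: "trace (\<chi> i. axis i 1 :: real^3^3) = 3"
  by (simp add: trace_def axis_def)

text \<open>The multiplier x . grad w generates dilations. Up to sign the integrands differ by the
  divergence of \<phi> (x . grad w) grad w - \<phi> |grad w|^2 x / 2. The coefficient -1/2 of the
  energy is 1 - 3/2, where 3 is the divergence of x.\<close>

lemma pohozaev_identity:
  assumes w: "is_C2 w g H" and \<phi>: "is_C1 \<phi> \<phi>'" and s: "bounded {x. \<phi> x \<noteq> 0}"
  shows "(LINT x|lebesgue. - trace (H x) * (x \<bullet> g x) * \<phi> x) =
    (LINT x|lebesgue. - (norm (g x))\<^sup>2 * \<phi> x / 2 + ((g x \<bullet> \<phi>' x) * (x \<bullet> g x) - (x \<bullet> \<phi>' x) * (norm (g x))\<^sup>2 / 2))"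
    (is "integral\<^sup>L _ ?A = integral\<^sup>L _ ?B")
proof -
  note w1 = is_C2_imp_C1[OF w]
  define h where "h x = (\<Sum>i\<in>UNIV. x $ i *\<^sub>R H x $ i)" for x
  define k where "k x = (\<Sum>i\<in>UNIV. g x $ i *\<^sub>R H x $ i)" for x
  have hs: "H x $ i $ j = H x $ j $ i" for x i j
    using w unfolding is_C2_def by blast
  \<comment> \<open>The second derivatives enter through the Hessian applied to \<open>x\<close> and
    \<open>g x\<close>, once in each order; its symmetry makes them cancel.\<close>
  have sym: "k x \<bullet> x = h x \<bullet> g x" for x
  proof -
    have "k x \<bullet> x = (\<Sum>i\<in>UNIV. \<Sum>j\<in>UNIV. g x $ i * H x $ i $ j * x $ j)"
      unfolding k_def inner_sum_left inner_scaleR_left by (simp add: inner_vec_def sum_distrib_left mult.assoc)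
    also have "\<dots> = (\<Sum>j\<in>UNIV. \<Sum>i\<in>UNIV. g x $ i * H x $ i $ j * x $ j)"
      by (rule sum.swap)
    also have "\<dots> = (\<Sum>j\<in>UNIV. \<Sum>i\<in>UNIV. g x $ i * H x $ j $ i * x $ j)"
      using hs by (intro sum.cong refl) (subst hs, rule refl)
    also have "\<dots> = h x \<bullet> g x"
      unfolding h_def inner_sum_left inner_scaleR_left by (simp add: inner_vec_def sum_distrib_left mult_ac)
    finally show ?thesis .
  qed
  have X1: "has_bochner_integral lebesgue (\<lambda>x. (\<phi> x *\<^sub>R (h x + g x) + (x \<bullet> g x) *\<^sub>R \<phi>' x) \<bullet> g x
      + (\<phi> x * (x \<bullet> g x)) * trace (H x)) 0" (is "has_bochner_integral _ ?X1 _")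
    unfolding h_def
    by (rule has_integral_div_zero[OF is_C1_mult[OF \<phi> is_C1_inner_id[OF w]] is_C2_grad_C1[OF w]])
      (rule bounded_subset[OF s], auto)
  have X2: "has_bochner_integral lebesgue (\<lambda>x. (\<phi> x *\<^sub>R (2 *\<^sub>R k x) + (norm (g x))\<^sup>2 *\<^sub>R \<phi>' x) \<bullet> x
      + (\<phi> x * (norm (g x))\<^sup>2) * trace (\<chi> i. axis i 1 :: real^3^3)) 0" (is "has_bochner_integral _ ?X2 _")
    unfolding k_def
    by (rule has_integral_div_zero[OF is_C1_mult[OF \<phi> is_C1_norm_grad2[OF w]]])
      (simp add: is_C1_nth, rule bounded_subset[OF s], auto)
  show ?thesis
  proof (rule has_integral_diff_zero_imp_eq[OF has_bochner_integral_minus[OF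
          has_bochner_integral_diff[OF X1 has_bochner_integral_mult_right[OF X2, of "1/2"]]]])
    show "- (?X1 x - 1/2 * ?X2 x) = ?A x - ?B x" for x
      unfolding inner_add_left inner_scaleR_left sym dot_square_norm inner_commute[of "\<phi>' x"]
        trace_identity_R3
      by (simp add: algebra_simps)
    show "integrable lebesgue (\<lambda>x. - trace (H x) * (x \<bullet> g x) * \<phi> x)"
      by (intro integrable_continuous_mult_support continuous_intros s is_C2_continuous_trace[OF w]
          is_C1_continuous_grad[OF w1] is_C1_continuous[OF \<phi>])
  qed simp
qed

text \<open>The divergence of \<open>a \<phi>\<close> times the position field, which itself has
  divergence 3.\<close>

lemma radial_derivative_identity:
  assumes a: "is_C1 a ga" and \<phi>: "is_C1 \<phi> \<phi>'" and s: "bounded {x. \<phi> x \<noteq> 0}"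
  shows "(LINT x|lebesgue. (x \<bullet> ga x) * \<phi> x) = (LINT x|lebesgue. - a x * (3 * \<phi> x + x \<bullet> \<phi>' x))"
    (is "integral\<^sup>L _ ?A = integral\<^sup>L _ ?B")
proof -
  have X: "has_bochner_integral lebesgue (\<lambda>x. (a x *\<^sub>R \<phi>' x + \<phi> x *\<^sub>R ga x) \<bullet> x
      + (a x * \<phi> x) * trace (\<chi> i. axis i 1 :: real^3^3)) 0" (is "has_bochner_integral _ ?X _")
    by (rule has_integral_div_zero[OF is_C1_mult[OF a \<phi>]])
      (simp add: is_C1_nth, rule bounded_subset[OF s], auto)
  show ?thesis
  proof (rule has_integral_diff_zero_imp_eq[OF X refl])
    show "?X x = ?A x - ?B x" for x
      by (simp add: trace_identity_R3 inner_add_left inner_commute algebra_simps)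
    show "integrable lebesgue (\<lambda>x. (x \<bullet> ga x) * \<phi> x)"
      by (intro integrable_continuous_mult_support continuous_intros s
          is_C1_continuous_grad[OF a] is_C1_continuous[OF \<phi>])
  qed
qed

section \<open>The cutoff functions of the Pohozaev argument\<close>

text \<open>The exponent 4 is the least for which \<open>zeta\<close>, with its cube, is still of
  class C^2.\<close>

definition theta :: "real \<Rightarrow> R3 \<Rightarrow> real" where
  "theta R x = tpow 4 ((1 / R\<^sup>2) * (norm x)\<^sup>2)"

definition theta' :: "real \<Rightarrow> R3 \<Rightarrow> R3" where
  "theta' R x = (2 * (1 / R\<^sup>2) * (- 4 * tpow 3 ((1 / R\<^sup>2) * (norm x)\<^sup>2))) *\<^sub>R x"

text \<open>By \<open>inner_theta'\<close> this is the radial derivative of \<open>theta\<close>, up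
  to the factor -8: the weight of the cutoff errors in the Pohozaev argument. Being nonnegative and
  C^2, it can itself be used in \<open>energy_identity\<close>.\<close>

definition zeta :: "real \<Rightarrow> R3 \<Rightarrow> real" where
  "zeta R x = ((1 / R\<^sup>2) * (norm x)\<^sup>2) * tpow 3 ((1 / R\<^sup>2) * (norm x)\<^sup>2)"

lemma theta_support: "R > 0 \<Longrightarrow> x \<notin> cball 0 R \<Longrightarrow> theta R x = 0"
  unfolding theta_def by (rule tpow_eq_0_outside) auto

lemma zeta_support: "R > 0 \<Longrightarrow> x \<notin> cball 0 R \<Longrightarrow> zeta R x = 0"
  unfolding zeta_def by (subst tpow_eq_0_outside) auto

lemma theta_bounded_support: "R > 0 \<Longrightarrow> bounded {x. theta R x \<noteq> 0}"
  by (rule bounded_subset[OF bounded_cball[of 0 R]]) (use theta_support in blast)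

lemma zeta_bounded_support: "R > 0 \<Longrightarrow> bounded {x. zeta R x \<noteq> 0}"
  by (rule bounded_subset[OF bounded_cball[of 0 R]]) (use zeta_support in blast)

lemma theta_continuous: "continuous_on UNIV (theta R)"
  unfolding theta_def[abs_def]
  by (intro continuous_on_compose2[OF continuous_tpow[of UNIV]] continuous_on_mult_left
      continuous_on_power continuous_on_norm continuous_on_id) simp

lemma zeta_continuous: "continuous_on UNIV (zeta R)"
  unfolding zeta_def[abs_def]
  by (intro continuous_on_mult[OF continuous_on_mult_left] continuous_on_compose2[OF continuous_tpow[of UNIV]]
      continuous_on_mult_left continuous_on_power continuous_on_norm continuous_on_id) simp

lemma theta_01: "0 \<le> theta R x" "theta R x \<le> 1"
  by (simp_all add: theta_def tpow_nonneg tpow_le_1)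

lemma zeta_01: "0 \<le> zeta R x" "zeta R x \<le> 1"
proof -
  have "0 \<le> s * tpow 3 s \<and> s * tpow 3 s \<le> 1" if "0 \<le> s" for s
    using that mult_mono[of s 1 "tpow 3 s" 1]
    by (cases "s \<le> 1") (auto simp: tpow_nonneg tpow_le_1 tpow_eq_0)
  from this[of "(1 / R\<^sup>2) * (norm x)\<^sup>2"] show "0 \<le> zeta R x" "zeta R x \<le> 1"
    unfolding zeta_def by simp_all
qed

lemma theta_ge:
  assumes R: "R > 0" and x: "x \<in> cball 0 (R / 2)"
  shows "theta R x \<ge> 1 / 4"
proof -
  have "(norm x)\<^sup>2 \<le> (R / 2)\<^sup>2"
    using x by (intro power_mono) auto
  then have "(1 / R\<^sup>2) * (norm x)\<^sup>2 \<le> 1 / 4"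
    using R by (simp add: field_simps power2_eq_square)
  then have "3 / 4 \<le> 1 - (1 / R\<^sup>2) * (norm x)\<^sup>2" by linarith
  then have "3 / 4 \<le> max 0 (1 - (1 / R\<^sup>2) * (norm x)\<^sup>2)" by (rule max.coboundedI2)
  then have "(3 / 4) ^ 4 \<le> (max 0 (1 - (1 / R\<^sup>2) * (norm x)\<^sup>2)) ^ 4"
    by (rule power_mono) simp
  moreover have "1 / 4 \<le> (3 / 4 :: real) ^ 4" by (simp add: power4_eq_xxxx)
  ultimately show ?thesis
    unfolding theta_def tpow_def by linarith
qed

lemma inner_theta': "x \<bullet> theta' R x = - 8 * zeta R x"
  by (simp add: theta'_def zeta_def power2_norm_eq_inner)

text \<open>With s = |x|^2/R^2 the Laplacian of a radial profile is R^-2 (6 T1 + 4 s T2). The number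
  72 is the sum of the absolute coefficients in both applications: 24 + 48 for \<open>theta\<close>
  and 6 + 42 + 24 for \<open>zeta\<close>.\<close>

lemma radial_trace_bound:
  assumes R: "R > 0" and b: "\<And>s. 0 \<le> s \<Longrightarrow> s \<le> 1 \<Longrightarrow> \<bar>6 * T1 s + 4 * s * T2 s\<bar> \<le> 72"
    and z: "\<And>s. 1 < s \<Longrightarrow> T1 s = 0 \<and> T2 s = (0::real)"
  shows "\<bar>3 * (2 * (1 / R\<^sup>2) * T1 ((1 / R\<^sup>2) * (norm x)\<^sup>2)) + (4 * (1 / R\<^sup>2)\<^sup>2 * T2 ((1 / R\<^sup>2) * (norm x)\<^sup>2)) * (norm x)\<^sup>2\<bar>
    \<le> 72 / R\<^sup>2 * cball_ind R (x::R3)" (is "\<bar>?L\<bar> \<le> _")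
proof -
  define s where "s = (1 / R\<^sup>2) * (norm x)\<^sup>2"
  have L: "?L = (1 / R\<^sup>2) * (6 * T1 s + 4 * s * T2 s)"
    unfolding s_def[symmetric] by (simp add: s_def power2_eq_square algebra_simps)
  have s0: "0 \<le> s" by (simp add: s_def)
  show ?thesis
  proof (cases "x \<in> cball 0 R")
    case True
    then have "(norm x)\<^sup>2 \<le> R\<^sup>2" by (intro power_mono) auto
    then have "s \<le> 1" using R by (simp add: s_def)
    then have "(1 / R\<^sup>2) * \<bar>6 * T1 s + 4 * s * T2 s\<bar> \<le> (1 / R\<^sup>2) * 72"
      by (intro mult_left_mono b s0) auto
    then show ?thesis using True unfolding L abs_mult by simp
  next
    case False
    then have "R\<^sup>2 < (norm x)\<^sup>2" using R by (intro power_strict_mono) auto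
    then have "1 < s" using R by (simp add: s_def)
    then show ?thesis using False z[of s] unfolding L by simp
  qed
qed

lemma theta_C2:
  assumes R: "R > 0"
  obtains H where "is_C2 (theta R) (theta' R) H"
    "\<And>x. \<bar>trace (H x)\<bar> \<le> 72 / R\<^sup>2 * cball_ind R x"
proof (rule that)
  show "is_C2 (theta R) (theta' R)
    (\<lambda>x. \<chi> i j. 2 * (1 / R\<^sup>2) * (- 4 * tpow 3 ((1 / R\<^sup>2) * (norm x)\<^sup>2)) * (if i = j then 1 else 0) +
       4 * (1 / R\<^sup>2)\<^sup>2 * (12 * tpow 2 ((1 / R\<^sup>2) * (norm x)\<^sup>2)) * (x $ i * x $ j))" (is "is_C2 _ _ ?H")
    unfolding theta_def[abs_def] theta'_def[abs_def] by (rule is_C2_tpow4)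
  show "\<bar>trace (?H x)\<bar> \<le> 72 / R\<^sup>2 * cball_ind R x" for x
    unfolding trace_radial
  proof (rule radial_trace_bound[OF R])
    fix s :: real assume s: "0 \<le> s" "s \<le> 1"
    have 1: "0 \<le> tpow 3 s" "tpow 3 s \<le> 1" "0 \<le> s * tpow 2 s" "s * tpow 2 s \<le> 1"
      using s by (auto simp: tpow_nonneg tpow_le_1 intro: mult_le_one)
    have "6 * (- 4 * tpow 3 s) + 4 * s * (12 * tpow 2 s) = - 24 * tpow 3 s + 48 * (s * tpow 2 s)" by simp
    with 1 show "\<bar>6 * (- 4 * tpow 3 s) + 4 * s * (12 * tpow 2 s)\<bar> \<le> 72" by linarith
  qed (simp add: tpow_eq_0)
qed

lemma zeta_C2:
  assumes R: "R > 0"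
  obtains g H where "is_C2 (zeta R) g H"
    "\<And>x. \<bar>trace (H x)\<bar> \<le> 72 / R\<^sup>2 * cball_ind R x"
proof -
  define T1 where "T1 s = tpow 3 s - 3 * (s * tpow 2 s)" for s
  define T2 where "T2 s = - 6 * tpow 2 s + 6 * (s * tpow 1 s)" for s
  define H where "H = (\<lambda>x::R3. \<chi> i j. 2 * (1 / R\<^sup>2) * T1 ((1 / R\<^sup>2) * (norm x)\<^sup>2) * (if i = j then 1 else 0) +
       4 * (1 / R\<^sup>2)\<^sup>2 * T2 ((1 / R\<^sup>2) * (norm x)\<^sup>2) * (x $ i * x $ j) :: real^3^3)"
  have "is_C2 (\<lambda>x. (\<lambda>s. s * tpow 3 s) ((1 / R\<^sup>2) * (norm x)\<^sup>2)) (\<lambda>x. (2 * (1 / R\<^sup>2) * T1 ((1 / R\<^sup>2) * (norm x)\<^sup>2)) *\<^sub>R x) H"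
    unfolding H_def
  proof (rule is_C2_radial)
    show "((\<lambda>s. s * tpow 3 s) has_real_derivative T1 t) (at t)" for t
      by (rule DERIV_cong[OF DERIV_mult[OF DERIV_ident tpow_deriv]]) (auto simp: T1_def)
    show "(T1 has_real_derivative T2 t) (at t)" for t
      unfolding T1_def[abs_def]
      by (rule DERIV_cong[OF DERIV_diff[OF tpow_deriv DERIV_cmult[OF DERIV_mult[OF DERIV_ident tpow_deriv]]]])
        (auto simp: T2_def)
    show "continuous_on UNIV T2"
      unfolding T2_def[abs_def] by (intro continuous_intros continuous_tpow)
  qed
  then have C2: "is_C2 (zeta R) (\<lambda>x. (2 * (1 / R\<^sup>2) * T1 ((1 / R\<^sup>2) * (norm x)\<^sup>2)) *\<^sub>R x) H"
    by (simp add: zeta_def[abs_def])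
  show thesis
  proof (rule that[OF C2])
    show "\<bar>trace (H x)\<bar> \<le> 72 / R\<^sup>2 * cball_ind R x" for x
      unfolding H_def trace_radial
    proof (rule radial_trace_bound[OF R])
      fix s :: real assume s: "0 \<le> s" "s \<le> 1"
      have 1: "0 \<le> tpow 3 s" "tpow 3 s \<le> 1" "0 \<le> s * tpow 2 s" "s * tpow 2 s \<le> 1"
        "0 \<le> s * (s * tpow 1 s)" "s * (s * tpow 1 s) \<le> 1"
        using s by (auto simp: tpow_nonneg tpow_le_1 intro!: mult_le_one)
      have "6 * T1 s + 4 * s * T2 s = 6 * tpow 3 s - 42 * (s * tpow 2 s) + 24 * (s * (s * tpow 1 s))"
        by (simp add: T1_def T2_def algebra_simps)
      with 1 show "\<bar>6 * T1 s + 4 * s * T2 s\<bar> \<le> 72" by linarith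
    qed (simp add: tpow_eq_0 T1_def T2_def)
  qed
qed

lemma norm_theta':
  assumes R: "R > 0"
  shows "(norm (theta' R x))\<^sup>2 \<le> 64 / R\<^sup>2 * cball_ind R x"
proof (cases "x \<in> cball 0 R")
  case True
  define s where "s = (1 / R\<^sup>2) * (norm x)\<^sup>2"
  have "(norm x)\<^sup>2 \<le> R\<^sup>2" using True by (intro power_mono) auto
  then have s: "0 \<le> s" "s \<le> 1" using R by (simp_all add: s_def)
  have "(norm (theta' R x))\<^sup>2 = 64 / R\<^sup>2 * ((tpow 3 s)\<^sup>2 * s)"
    unfolding theta'_def s_def[symmetric] norm_scaleR power_mult_distrib
    by (simp add: s_def power2_eq_square)
  also have "\<dots> \<le> 64 / R\<^sup>2 * (1\<^sup>2 * 1)"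
    using s by (intro mult_left_mono mult_mono power_mono tpow_le_1 tpow_nonneg) auto
  finally show ?thesis using True by simp
next
  case False
  then show ?thesis using tpow_eq_0_outside[OF R False, of 3] by (simp add: theta'_def)
qed

text \<open>\<open>theta' R x\<close> is a nonpositive multiple of \<open>x\<close>: the first
  product lies between -8 \<open>zeta\<close> |g|^2 and 0, and the subtracted term contributes
  exactly +4 \<open>zeta\<close> |g|^2.\<close>

lemma pohozaev_error_bound:
  "\<bar>(g \<bullet> theta' R x) * (x \<bullet> g) - (x \<bullet> theta' R x) * (norm g)\<^sup>2 / 2\<bar> \<le> 4 * zeta R x * (norm g)\<^sup>2"
proof -
  define t where "t = tpow 3 ((1 / R\<^sup>2) * (norm x)\<^sup>2) / R\<^sup>2"
  have t: "t \<ge> 0" by (simp add: t_def tpow_nonneg)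
  have z: "zeta R x = t * (norm x)\<^sup>2" by (simp add: zeta_def t_def)
  have "(g \<bullet> theta' R x) * (x \<bullet> g) = - 8 * (t * (x \<bullet> g)\<^sup>2)"
    by (simp add: theta'_def t_def inner_commute power2_eq_square)
  moreover have "t * (x \<bullet> g)\<^sup>2 \<le> t * ((norm x)\<^sup>2 * (norm g)\<^sup>2)"
    using power_mono[OF Cauchy_Schwarz_ineq2[of x g], of 2] t
    by (intro mult_left_mono) (auto simp: power_mult_distrib)
  moreover have "0 \<le> t * (x \<bullet> g)\<^sup>2" using t by simp
  ultimately show ?thesis
    unfolding inner_theta' z by (simp add: abs_le_iff algebra_simps)
qed

lemma theta_tendsto: "(\<lambda>n. theta (real n) x) \<longlonglongrightarrow> 1"
  and zeta_tendsto: "(\<lambda>n. zeta (real n) x) \<longlonglongrightarrow> 0"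
proof -
  have "(\<lambda>n. (norm x)\<^sup>2 * (inverse (real n))\<^sup>2) \<longlonglongrightarrow> (norm x)\<^sup>2 * 0\<^sup>2"
    by (intro tendsto_intros lim_inverse_n)
  then have s: "(\<lambda>n. (1 / (real n)\<^sup>2) * (norm x)\<^sup>2) \<longlonglongrightarrow> 0"
    by (simp add: field_simps)
  have c: "isCont (tpow k) 0" for k
    using continuous_tpow[of UNIV k] by (simp add: continuous_on_eq_continuous_at)
  have t: "(\<lambda>n. tpow k ((1 / (real n)\<^sup>2) * (norm x)\<^sup>2)) \<longlonglongrightarrow> tpow k 0" for k
    by (rule isCont_tendsto_compose[OF c s])
  show "(\<lambda>n. theta (real n) x) \<longlonglongrightarrow> 1"
    using t[of 4] by (simp add: theta_def tpow_def)
  show "(\<lambda>n. zeta (real n) x) \<longlonglongrightarrow> 0"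
    using tendsto_mult[OF s t[of 3]] by (simp add: zeta_def)
qed

text \<open>Two truncated squares flatten the profile at both ends: the inner one is 0 for
  \<open>s x \<ge> 1\<close>, where the outer one equals 1, and the outer one is 0 once the inner
  one reaches 1. With s = 2 - |x|^2/r^2 the first happens up to norm \<open>r\<close>, the second at
  the latest from norm \<open>2 * r\<close> on.\<close>

lemma plateau_exists:
  assumes r: "r > 0"
  obtains \<tau> \<tau>' where "is_C1 \<tau> \<tau>'" "\<And>x. 0 \<le> \<tau> x" "\<And>x. \<tau> x \<le> 1"
    "\<And>x. x \<in> cball 0 r \<Longrightarrow> \<tau> x = 1" "\<And>x. x \<notin> cball 0 (2 * r) \<Longrightarrow> \<tau> (x::R3) = 0"
proof -
  define s where "s x = 2 + (- (1 / r\<^sup>2)) * (norm x)\<^sup>2" for x :: R3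
  have s: "is_C1 s (\<lambda>x. 0 + (- (1 / r\<^sup>2)) *\<^sub>R (2 *\<^sub>R x))"
    unfolding s_def[abs_def] by (intro is_C1_add is_C1_const is_C1_cmult is_C1_norm2)
  have t: "(tpow 2 has_real_derivative - 2 * tpow 1 t) (at t)" for t
    using tpow_deriv[of 2 t] by simp
  have c: "continuous_on UNIV (\<lambda>t. - 2 * tpow 1 t)"
    by (intro continuous_intros continuous_tpow)
  define \<tau> where "\<tau> x = tpow 2 (tpow 2 (s x))" for x
  have C1: "is_C1 \<tau> (\<lambda>x. (- 2 * tpow 1 (tpow 2 (s x))) *\<^sub>R ((- 2 * tpow 1 (s x)) *\<^sub>R (0 + (- (1 / r\<^sup>2)) *\<^sub>R (2 *\<^sub>R x))))"
    unfolding \<tau>_def[abs_def] by (rule is_C1_compose[OF is_C1_compose[OF s t c] t c])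
  show thesis
  proof (rule that[OF C1])
    show "0 \<le> \<tau> x" "\<tau> x \<le> 1" for x by (simp_all add: \<tau>_def tpow_nonneg tpow_le_1)
    show "\<tau> x = 1" if "x \<in> cball 0 r" for x
    proof -
      have "(norm x)\<^sup>2 \<le> r\<^sup>2" using that by (intro power_mono) auto
      then have "s x \<ge> 1" using r by (simp add: s_def)
      then have "tpow 2 (s x) = 0" by (simp add: tpow_eq_0)
      then show ?thesis by (simp add: \<tau>_def tpow_def)
    qed
    show "\<tau> x = 0" if "x \<notin> cball 0 (2 * r)" for x
    proof -
      have "(2 * r)\<^sup>2 \<le> (norm x)\<^sup>2" using that r by (intro power_mono) auto
      then have "s x \<le> - 2" using r by (simp add: s_def field_simps)
      then have "1 \<le> (max 0 (1 - s x))\<^sup>2" by (simp add: one_le_power)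
      then have "1 \<le> tpow 2 (s x)" by (simp add: tpow_def)
      then show ?thesis by (simp add: \<tau>_def tpow_eq_0)
    qed
  qed
qed

section \<open>Estimates for an approximated solution\<close>

lemma bounded_convergence_test:
  fixes s :: "nat \<Rightarrow> R3 \<Rightarrow> real"
  assumes s: "\<And>n. s n \<in> borel_measurable lebesgue" "\<And>n x. \<bar>s n x\<bar> \<le> C" "t \<in> borel_measurable lebesgue"
    and lim: "AE x in lebesgue. (\<lambda>n. s n x) \<longlonglongrightarrow> t x"
    and k: "continuous_on UNIV k" "bounded {x. k x \<noteq> 0}"
  shows "(\<lambda>n. LINT x|lebesgue. s n x * k x) \<longlonglongrightarrow> (LINT x|lebesgue. t x * k x)"
proof (rule integral_dominated_convergence[where w="\<lambda>x. C * norm (k x)"])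
  show "integrable lebesgue (\<lambda>x. C * norm (k x))"
    by (intro integrable_mult_right integrable_norm integrable_continuous_support k)
  show "(\<lambda>x. t x * k x) \<in> borel_measurable lebesgue" "(\<lambda>x. s n x * k x) \<in> borel_measurable lebesgue" for n
    by (intro borel_measurable_times s continuous_imp_lebesgue_measurable k)+
  from lim show "AE x in lebesgue. (\<lambda>n. s n x * k x) \<longlonglongrightarrow> t x * k x"
    by eventually_elim (intro tendsto_intros)
  show "AE x in lebesgue. norm (s n x * k x) \<le> C * norm (k x)" for n
    by (intro AE_I2) (simp add: abs_mult mult_right_mono s(2))
qed

lemma abs_mult_le: "\<bar>a\<bar> \<le> A \<Longrightarrow> \<bar>b\<bar> \<le> B \<Longrightarrow> \<bar>a * b\<bar> \<le> A * (B::real)"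
  unfolding abs_mult by (rule mult_mono) auto

lemma abs_add_le: "\<bar>a\<bar> \<le> A \<Longrightarrow> \<bar>b\<bar> \<le> B \<Longrightarrow> \<bar>a + b\<bar> \<le> A + (B::real)"
  by linarith

lemma abs_diff_le: "\<bar>a\<bar> \<le> A \<Longrightarrow> \<bar>b\<bar> \<le> B \<Longrightarrow> \<bar>a - b\<bar> \<le> A + (B::real)"
  by linarith

lemma measure_cball_R3: "\<exists>\<omega>>0. \<forall>R\<ge>0. measure lebesgue (cball (0::R3) R) = \<omega> * R ^ 3"
  by (intro exI[of _ "unit_ball_vol 3"]) (auto simp: content_cball unit_ball_vol_pos)

text \<open>\<open>U n\<close> and \<open>V n\<close> will be mollifications of \<open>u\<close> and \<open>v\<close>, with gradients \<open>GU n\<close>, \<open>GV n\<close> and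
  Hessians \<open>HU n\<close>, \<open>HV n\<close>.\<close>

locale approximated_solution =
  fixes u v :: "R3 \<Rightarrow> real" and M r :: real
    and U V :: "nat \<Rightarrow> R3 \<Rightarrow> real" and GU GV :: "nat \<Rightarrow> R3 \<Rightarrow> R3" and HU HV :: "nat \<Rightarrow> R3 \<Rightarrow> real^3^3"
  assumes u_meas: "u \<in> borel_measurable lebesgue" and u_bound: "\<bar>u x\<bar> \<le> M"
    and v_meas: "v \<in> borel_measurable lebesgue" and v_bound: "\<bar>v x\<bar> \<le> M"
    and U_C2: "is_C2 (U n) (GU n) (HU n)" and V_C2: "is_C2 (V n) (GV n) (HV n)"
    and U_bound: "\<bar>U n x\<bar> \<le> M" and V_bound: "\<bar>V n x\<bar> \<le> M"
    and HU_bound: "\<bar>trace (HU n x)\<bar> \<le> M * (M * M)" and HV_bound: "\<bar>trace (HV n x)\<bar> \<le> M * (M * M)"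
    and U_lim: "AE x in lebesgue. (\<lambda>n. U n x) \<longlonglongrightarrow> u x"
    and V_lim: "AE x in lebesgue. (\<lambda>n. V n x) \<longlonglongrightarrow> v x"
    and HU_lim: "AE x in lebesgue. (\<lambda>n. - trace (HU n x)) \<longlonglongrightarrow> u x * (v x)\<^sup>2"
    and HV_lim: "AE x in lebesgue. (\<lambda>n. - trace (HV n x)) \<longlonglongrightarrow> (u x)\<^sup>2 * v x"
    and r_pos: "r > 0"
    and stable: "\<phi> \<in> C1c \<Longrightarrow> \<psi> \<in> C1c \<Longrightarrow> (\<And>x. x \<in> cball 0 r \<Longrightarrow> \<phi> x = 0 \<and> \<psi> x = 0) \<Longrightarrow>
      Q_form u v (\<phi>, \<psi>) \<ge> 0"
begin

section \<open>Densities of the pair and of its approximations, and their limits\<close>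

definition q :: "R3 \<Rightarrow> real" where "q x = (u x)\<^sup>2 + (v x)\<^sup>2"
definition w :: "R3 \<Rightarrow> real" where "w x = (u x)\<^sup>2 * (v x)\<^sup>2"
definition D :: "nat \<Rightarrow> R3 \<Rightarrow> real" where "D n x = (norm (GU n x))\<^sup>2 + (norm (GV n x))\<^sup>2"

abbreviation w\<^sub>n :: "nat \<Rightarrow> R3 \<Rightarrow> real" where
  "w\<^sub>n n x \<equiv> (U n x)\<^sup>2 * (V n x)\<^sup>2"
abbreviation q\<^sub>n :: "nat \<Rightarrow> R3 \<Rightarrow> real" where
  "q\<^sub>n n x \<equiv> (U n x)\<^sup>2 + (V n x)\<^sup>2"
text \<open>Each equation multiplied by its own unknown has right-hand side u^2 v^2, so the limit is
  \<open>2 * w x\<close>.\<close>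

abbreviation s\<^sub>n :: "nat \<Rightarrow> R3 \<Rightarrow> real" where
  "s\<^sub>n n x \<equiv> - trace (HU n x) * U n x + - trace (HV n x) * V n x"

lemma sq_bound: "\<bar>a\<bar> \<le> M \<Longrightarrow> \<bar>a\<^sup>2\<bar> \<le> M\<^sup>2"
  using power_mono[of "\<bar>a\<bar>" M 2] by simp

lemma q_bound: "\<bar>q x\<bar> \<le> 2 * M\<^sup>2"
  unfolding q_def using abs_add_le[OF sq_bound[OF u_bound[of x]] sq_bound[OF v_bound[of x]]] by simp

lemma w_bound: "\<bar>w x\<bar> \<le> M\<^sup>2 * M\<^sup>2"
  unfolding w_def by (intro abs_mult_le sq_bound u_bound v_bound)

lemma q_nonneg: "0 \<le> q x" and w_nonneg: "0 \<le> w x"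
  by (simp_all add: q_def w_def)

lemma q_meas: "q \<in> borel_measurable lebesgue" and w_meas: "w \<in> borel_measurable lebesgue"
  unfolding q_def[abs_def] w_def[abs_def] using u_meas v_meas by simp_all

lemma cont:
  "continuous_on UNIV (U n)" "continuous_on UNIV (V n)" "continuous_on UNIV (GU n)" "continuous_on UNIV (GV n)"
  "continuous_on UNIV (\<lambda>x. trace (HU n x))" "continuous_on UNIV (\<lambda>x. trace (HV n x))"
  using is_C1_continuous[OF is_C2_imp_C1[OF U_C2]] is_C1_continuous[OF is_C2_imp_C1[OF V_C2]]
    is_C1_continuous_grad[OF is_C2_imp_C1[OF U_C2]] is_C1_continuous_grad[OF is_C2_imp_C1[OF V_C2]]
    is_C2_continuous_trace[OF U_C2] is_C2_continuous_trace[OF V_C2]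
  by blast+

lemma cont_D: "continuous_on UNIV (D n)"
  unfolding D_def[abs_def] by (intro continuous_intros cont)

lemma D_nonneg: "0 \<le> D n x"
  by (simp add: D_def)

lemma integrable_weight_q:
  assumes "continuous_on UNIV k" "bounded {x. k x \<noteq> 0}"
  shows "integrable lebesgue (\<lambda>x. q x * k x)" "integrable lebesgue (\<lambda>x. w x * k x)"
  by (rule integrable_continuous_weight[OF q_meas q_bound assms],
      rule integrable_continuous_weight[OF w_meas w_bound assms])

lemma integrable_indicator_q:
  "integrable lebesgue (\<lambda>x. cball_ind R x * q x)"
  "integrable lebesgue (\<lambda>x. cball_ind R x * w x)"
proof -
  have *: "integrable lebesgue (\<lambda>x. cball_ind R x * f x)"
    if "f \<in> borel_measurable lebesgue" "\<And>x. \<bar>f x\<bar> \<le> C" for f :: "R3 \<Rightarrow> real" and C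
    using L1_loc_integrable[OF bounded_L1_loc[OF that], of 0 R] by simp
  show "integrable lebesgue (\<lambda>x. cball_ind R x * q x)"
    "integrable lebesgue (\<lambda>x. cball_ind R x * w x)"
    by (rule *[OF q_meas q_bound], rule *[OF w_meas w_bound])
qed

lemma stability_q:
  assumes \<phi>: "\<phi> \<in> C1c" and z: "\<And>x. x \<in> cball 0 r \<Longrightarrow> \<phi> x = 0"
  shows "(LINT x|lebesgue. q x * (\<phi> x)\<^sup>2) \<le> 2 * (LINT x|lebesgue. (norm (grad \<phi> x))\<^sup>2)"
proof -
  have k: "continuous_on UNIV (\<lambda>x. (\<phi> x)\<^sup>2)" "bounded {x. (\<phi> x)\<^sup>2 \<noteq> 0}"
    using C1c_D(2)[OF \<phi>] by (auto intro!: continuous_intros is_C1_continuous[OF C1c_D(1)[OF \<phi>]])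
  have i: "integrable lebesgue (\<lambda>x. (u x)\<^sup>2 * (\<phi> x)\<^sup>2)" "integrable lebesgue (\<lambda>x. (v x)\<^sup>2 * (\<phi> x)\<^sup>2)"
    by (rule integrable_continuous_weight[OF _ sq_bound[OF u_bound] k], use u_meas in simp,
        rule integrable_continuous_weight[OF _ sq_bound[OF v_bound] k], use v_meas in simp)
  have "Q_form u v (\<phi>, 0) \<ge> 0" "Q_form u v (0, \<phi>) \<ge> 0"
    using \<phi> C1c_zero(1) z by (auto intro!: stable)
  then have "(LINT x|lebesgue. (v x)\<^sup>2 * (\<phi> x)\<^sup>2) \<le> (LINT x|lebesgue. (norm (grad \<phi> x))\<^sup>2)"
    "(LINT x|lebesgue. (u x)\<^sup>2 * (\<phi> x)\<^sup>2) \<le> (LINT x|lebesgue. (norm (grad \<phi> x))\<^sup>2)"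
    by (simp_all add: Q_form_def C1c_zero(2))
  moreover have "(LINT x|lebesgue. q x * (\<phi> x)\<^sup>2) = (LINT x|lebesgue. (u x)\<^sup>2 * (\<phi> x)\<^sup>2) + (LINT x|lebesgue. (v x)\<^sup>2 * (\<phi> x)\<^sup>2)"
    unfolding q_def distrib_right using i by (rule Bochner_Integration.integral_add)
  ultimately show ?thesis by linarith
qed

lemma lim_source:
  assumes k: "continuous_on UNIV k" "bounded {x. k x \<noteq> 0}"
  shows "(\<lambda>n. LINT x|lebesgue. s\<^sub>n n x * k x)
    \<longlonglongrightarrow> (LINT x|lebesgue. (2 * w x) * k x)"
proof (rule bounded_convergence_test[OF _ _ _ _ k])
  show "\<bar>s\<^sub>n n x\<bar> \<le> M * (M * M) * M + M * (M * M) * M" for n x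
    using HU_bound HV_bound by (intro abs_add_le abs_mult_le U_bound V_bound) simp_all
  show "(\<lambda>x. s\<^sub>n n x) \<in> borel_measurable lebesgue" for n
    by (intro continuous_imp_lebesgue_measurable continuous_intros cont)
  show "(\<lambda>x. 2 * w x) \<in> borel_measurable lebesgue" using w_meas by simp
  from U_lim V_lim HU_lim HV_lim
  show "AE x in lebesgue. (\<lambda>n. s\<^sub>n n x) \<longlonglongrightarrow> 2 * w x"
  proof eventually_elim
    case (elim x)
    then have "(\<lambda>n. s\<^sub>n n x) \<longlonglongrightarrow>
        u x * (v x)\<^sup>2 * u x + (u x)\<^sup>2 * v x * v x"
      by (intro tendsto_intros)
    then show ?case by (simp add: w_def power2_eq_square mult_ac)
  qed
qed

lemma lim_squares:
  assumes k: "continuous_on UNIV k" "bounded {x. k x \<noteq> 0}"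
  shows "(\<lambda>n. LINT x|lebesgue. q\<^sub>n n x * k x) \<longlonglongrightarrow> (LINT x|lebesgue. q x * k x)"
proof (rule bounded_convergence_test[OF _ _ q_meas _ k])
  show "\<bar>q\<^sub>n n x\<bar> \<le> M\<^sup>2 + M\<^sup>2" for n x
    by (intro abs_add_le sq_bound U_bound V_bound)
  show "(\<lambda>x. q\<^sub>n n x) \<in> borel_measurable lebesgue" for n
    by (intro continuous_imp_lebesgue_measurable continuous_intros cont)
  from U_lim V_lim show "AE x in lebesgue. (\<lambda>n. q\<^sub>n n x) \<longlonglongrightarrow> q x"
    unfolding q_def by eventually_elim (intro tendsto_intros)
qed

lemma lim_products:
  assumes k: "continuous_on UNIV k" "bounded {x. k x \<noteq> 0}"
  shows "(\<lambda>n. LINT x|lebesgue. w\<^sub>n n x * k x) \<longlonglongrightarrow> (LINT x|lebesgue. w x * k x)"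
proof (rule bounded_convergence_test[OF _ _ w_meas _ k])
  show "\<bar>(U n x)\<^sup>2 * (V n x)\<^sup>2\<bar> \<le> M\<^sup>2 * M\<^sup>2" for n x
    by (intro abs_mult_le sq_bound U_bound V_bound)
  show "(\<lambda>x. (U n x)\<^sup>2 * (V n x)\<^sup>2) \<in> borel_measurable lebesgue" for n
    by (intro continuous_imp_lebesgue_measurable continuous_intros cont)
  from U_lim V_lim show "AE x in lebesgue. (\<lambda>n. (U n x)\<^sup>2 * (V n x)\<^sup>2) \<longlonglongrightarrow> w x"
    unfolding w_def by eventually_elim (intro tendsto_intros)
qed

text \<open>The squared defect of the mollified pair in the system; it is caused by mollification
  not commuting with the nonlinearity.\<close>

definition err :: "nat \<Rightarrow> R3 \<Rightarrow> real" where
  "err n x = (- trace (HU n x) - U n x * (V n x)\<^sup>2)\<^sup>2 + (- trace (HV n x) - (U n x)\<^sup>2 * V n x)\<^sup>2"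

lemma cont_err: "continuous_on UNIV (err n)"
  unfolding err_def[abs_def] by (intro continuous_intros cont)

lemma lim_err:
  assumes k: "continuous_on UNIV k" "bounded {x. k x \<noteq> 0}"
  shows "(\<lambda>n. LINT x|lebesgue. err n x * k x) \<longlonglongrightarrow> 0"
proof -
  have "(\<lambda>n. LINT x|lebesgue. err n x * k x) \<longlonglongrightarrow> (LINT x|lebesgue. 0 * k x)"
  proof (rule bounded_convergence_test[OF _ _ _ _ k])
    let ?C = "M * (M * M) + M * M\<^sup>2" let ?C' = "M * (M * M) + M\<^sup>2 * M"
    show "\<bar>err n x\<bar> \<le> ?C * ?C + ?C' * ?C'" for n x
      unfolding err_def power2_eq_square[of "_ - _"] using HU_bound HV_bound
      by (intro abs_add_le abs_mult_le abs_diff_le sq_bound U_bound V_bound) simp_all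
    show "err n \<in> borel_measurable lebesgue" for n
      by (intro continuous_imp_lebesgue_measurable cont_err)
    from U_lim V_lim HU_lim HV_lim show "AE x in lebesgue. (\<lambda>n. err n x) \<longlonglongrightarrow> 0"
    proof eventually_elim
      case (elim x)
      then have "(\<lambda>n. err n x) \<longlonglongrightarrow> (u x * (v x)\<^sup>2 - u x * (v x)\<^sup>2)\<^sup>2 + ((u x)\<^sup>2 * v x - (u x)\<^sup>2 * v x)\<^sup>2"
        unfolding err_def by (intro tendsto_intros)
      then show ?case by simp
    qed
  qed simp
  then show ?thesis by simp
qed

text \<open>The energies converge without any convergence of gradients, because
  \<open>energy_identity\<close> expresses them through \<open>U n\<close>, \<open>V n\<close> and
  their Laplacians alone.\<close>

lemma lim_energy:
  assumes \<phi>: "is_C2 \<phi> \<phi>' \<phi>''" and s: "bounded {x. \<phi> x \<noteq> 0}"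
  shows "(\<lambda>n. LINT x|lebesgue. D n x * \<phi> x) \<longlonglongrightarrow>
    (LINT x|lebesgue. (2 * w x) * \<phi> x) + (LINT x|lebesgue. q x * (trace (\<phi>'' x) / 2))"
proof -
  note \<phi>1 = is_C2_imp_C1[OF \<phi>]
  have k: "continuous_on UNIV \<phi>" by (rule is_C1_continuous[OF \<phi>1])
  have k2: "continuous_on UNIV (\<lambda>x. trace (\<phi>'' x) / 2)"
    by (intro continuous_intros is_C2_continuous_trace[OF \<phi>]) simp
  obtain R where R: "\<And>x. x \<notin> cball 0 R \<Longrightarrow> \<phi> x = 0"
    using bounded_support_obtain[OF s] by blast
  have "\<phi>'' x $ i $ i = 0" if "x \<notin> cball 0 R" for x i
  proof -
    have "\<phi>'' x $ i = 0"
    proof (rule is_C1_zero_outside[OF is_C2_grad_C1[OF \<phi>] _ that])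
      fix y :: R3 assume "y \<notin> cball 0 R"
      then have "\<phi>' y = 0" using is_C1_zero_outside[OF \<phi>1, of R y] R by blast
      then show "\<phi>' y $ i = 0" by simp
    qed
    then show ?thesis by simp
  qed
  then have "trace (\<phi>'' x) = 0" if "x \<notin> cball 0 R" for x
    unfolding trace_def using that by (intro sum.neutral) blast
  then have "{x. trace (\<phi>'' x) / 2 \<noteq> 0} \<subseteq> cball 0 R"
    by fastforce
  then have s2: "bounded {x. trace (\<phi>'' x) / 2 \<noteq> 0}"
    by (rule bounded_subset[OF bounded_cball])
  have eq: "(LINT x|lebesgue. D n x * \<phi> x) =
      (LINT x|lebesgue. s\<^sub>n n x * \<phi> x) +
      (LINT x|lebesgue. q\<^sub>n n x * (trace (\<phi>'' x) / 2))" for n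
  proof -
    have "(LINT x|lebesgue. D n x * \<phi> x) = (LINT x|lebesgue. (norm (GU n x))\<^sup>2 * \<phi> x) + (LINT x|lebesgue. (norm (GV n x))\<^sup>2 * \<phi> x)"
      unfolding D_def distrib_right
      by (intro Bochner_Integration.integral_add integrable_continuous_mult_support continuous_intros cont k s)
    also have "\<dots> = (LINT x|lebesgue. s\<^sub>n n x * \<phi> x +
        q\<^sub>n n x * (trace (\<phi>'' x) / 2))"
      unfolding energy_identity[OF U_C2 \<phi> s] energy_identity[OF V_C2 \<phi> s]
      by (subst Bochner_Integration.integral_add[symmetric],
          (intro Bochner_Integration.integrable_add integrable_continuous_mult_support
            continuous_intros cont k s k2 s2)+) (simp add: algebra_simps)
    also have "\<dots> = (LINT x|lebesgue. s\<^sub>n n x * \<phi> x) +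
      (LINT x|lebesgue. q\<^sub>n n x * (trace (\<phi>'' x) / 2))"
      by (intro Bochner_Integration.integral_add integrable_continuous_mult_support continuous_intros cont k s k2 s2)
    finally show ?thesis .
  qed
  show ?thesis
    unfolding eq by (intro tendsto_add lim_source lim_squares k s k2 s2)
qed

text \<open>The test pair is \<open>(U n \<phi>, V n \<phi>)\<close>, the mollified form of
  \<open>(u \<phi>, v \<phi>)\<close>, since test functions must be C^1. In the limit the potential
  term is 6 \<open>w\<close>, while \<open>integral_norm_grad_mult\<close> gives 2 \<open>w\<close>
  plus the right-hand side; the difference is the 4.\<close>

lemma stability_w:
  assumes \<phi>: "\<phi> \<in> C1c" and z: "\<And>x. x \<in> cball 0 r \<Longrightarrow> \<phi> x = 0"
  shows "4 * (LINT x|lebesgue. w x * (\<phi> x)\<^sup>2) \<le> (LINT x|lebesgue. q x * (norm (grad \<phi> x))\<^sup>2)"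
proof -
  note \<phi>1 = C1c_D(1)[OF \<phi>] and s = C1c_D(2)[OF \<phi>]
  have k: "continuous_on UNIV (\<lambda>x. (\<phi> x)\<^sup>2)" "bounded {x. (\<phi> x)\<^sup>2 \<noteq> 0}"
    using s by (auto intro!: continuous_intros is_C1_continuous[OF \<phi>1])
  have k': "continuous_on UNIV (\<lambda>x. (norm (grad \<phi> x))\<^sup>2)" "bounded {x. (norm (grad \<phi> x))\<^sup>2 \<noteq> 0}"
    using is_C1_support[OF \<phi>1 s] by (auto intro!: continuous_intros is_C1_continuous_grad[OF \<phi>1])
  have test: "(\<lambda>x. f x * \<phi> x) \<in> C1c" if "is_C2 f g H" for f g H
    by (rule C1c_I[OF is_C1_mult[OF is_C2_imp_C1[OF that] \<phi>1]]) (rule bounded_subset[OF s], auto)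
  \<comment> \<open>The weights come from \<open>Q_form u v\<close> and stay the original functions;
    only the test pair is mollified.\<close>
  define P where "P n x = (v x)\<^sup>2 * (U n x)\<^sup>2 + (u x)\<^sup>2 * (V n x)\<^sup>2 + 4 * (u x * v x * (U n x * V n x))" for n x
  have ineq: "(LINT x|lebesgue. P n x * (\<phi> x)\<^sup>2) \<le>
     (LINT x|lebesgue. s\<^sub>n n x * (\<phi> x)\<^sup>2) +
     (LINT x|lebesgue. q\<^sub>n n x * (norm (grad \<phi> x))\<^sup>2)" for n
  proof -
    let ?f = "\<lambda>x. U n x * \<phi> x" and ?g = "\<lambda>x. V n x * \<phi> x"
    have fg: "?f \<in> C1c" "?g \<in> C1c" by (rule test[OF U_C2], rule test[OF V_C2])
    have "0 \<le> Q_form u v (?f, ?g)"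
      by (rule stable[OF fg]) (simp add: z)
    then have "(LINT x|lebesgue. P n x * (\<phi> x)\<^sup>2) \<le> (LINT x|lebesgue. (norm (grad ?f x))\<^sup>2 + (norm (grad ?g x))\<^sup>2)"
      by (simp add: Q_form_def P_def power_mult_distrib power2_eq_square algebra_simps)
    also have "\<dots> = (LINT x|lebesgue. (norm (grad ?f x))\<^sup>2) + (LINT x|lebesgue. (norm (grad ?g x))\<^sup>2)"
      using norm_grad_integrable[OF fg(1) C1c_zero(1)] norm_grad_integrable[OF fg(2) C1c_zero(1)]
      by (intro Bochner_Integration.integral_add) (simp_all add: C1c_zero)
    also have "\<dots> = (LINT x|lebesgue. s\<^sub>n n x * (\<phi> x)\<^sup>2 +
        q\<^sub>n n x * (norm (grad \<phi> x))\<^sup>2)"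
      unfolding integral_norm_grad_mult[OF U_C2 \<phi>1 s] integral_norm_grad_mult[OF V_C2 \<phi>1 s]
      by (subst Bochner_Integration.integral_add[symmetric],
          (intro Bochner_Integration.integrable_add integrable_continuous_mult_support
            continuous_on_mult continuous_on_minus continuous_on_power cont k k')+) (simp add: algebra_simps)
    also have "\<dots> = (LINT x|lebesgue. s\<^sub>n n x * (\<phi> x)\<^sup>2) +
      (LINT x|lebesgue. q\<^sub>n n x * (norm (grad \<phi> x))\<^sup>2)"
      by (intro Bochner_Integration.integral_add integrable_continuous_mult_support
          continuous_on_add continuous_on_mult continuous_on_minus continuous_on_power cont k k')
    finally show ?thesis .
  qed
  have "(\<lambda>n. LINT x|lebesgue. P n x * (\<phi> x)\<^sup>2) \<longlonglongrightarrow> (LINT x|lebesgue. (6 * w x) * (\<phi> x)\<^sup>2)"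
  proof (rule bounded_convergence_test[OF _ _ _ _ k])
    show "\<bar>P n x\<bar> \<le> M\<^sup>2 * M\<^sup>2 + M\<^sup>2 * M\<^sup>2 + 4 * (M * M * (M * M))" for n x
      unfolding P_def
      by (intro abs_add_le abs_mult_le sq_bound u_bound v_bound U_bound V_bound) simp
    show "P n \<in> borel_measurable lebesgue" for n
      unfolding P_def[abs_def] using u_meas v_meas
        continuous_imp_lebesgue_measurable[OF cont(1)] continuous_imp_lebesgue_measurable[OF cont(2)]
      by (intro borel_measurable_add borel_measurable_times borel_measurable_power) auto
    show "(\<lambda>x. 6 * w x) \<in> borel_measurable lebesgue" using w_meas by simp
    from U_lim V_lim show "AE x in lebesgue. (\<lambda>n. P n x) \<longlonglongrightarrow> 6 * w x"
    proof eventually_elim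
      case (elim x)
      then have "(\<lambda>n. P n x) \<longlonglongrightarrow> (v x)\<^sup>2 * (u x)\<^sup>2 + (u x)\<^sup>2 * (v x)\<^sup>2 + 4 * (u x * v x * (u x * v x))"
        unfolding P_def by (intro tendsto_intros)
      then show ?case by (simp add: w_def power2_eq_square mult_ac)
    qed
  qed
  then have "(LINT x|lebesgue. (6 * w x) * (\<phi> x)\<^sup>2) \<le>
      (LINT x|lebesgue. (2 * w x) * (\<phi> x)\<^sup>2) + (LINT x|lebesgue. q x * (norm (grad \<phi> x))\<^sup>2)"
    by (rule LIMSEQ_le[OF _ tendsto_add[OF lim_source[OF k] lim_squares[OF k']]]) (use ineq in blast)
  then show ?thesis by (simp add: mult.assoc)
qed


text \<open>The product of \<open>theta R\<close> with one minus a plateau. Its gradient has one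
  part on a fixed ball, with a bound independent of \<open>R\<close>, and one of order 1/R. The 128
  is 2 * 64 from squaring a sum and \<open>norm_theta'\<close>; 1/16 is the square of the lower
  bound in \<open>theta_ge\<close>.\<close>

lemma cutoff_outside_ball:
  obtains B where "\<And>R. R > 0 \<Longrightarrow> \<exists>\<phi>\<in>C1c. (\<forall>x\<in>cball 0 r. \<phi> x = 0) \<and>
    (\<forall>x. x \<in> cball 0 (R / 2) \<longrightarrow> x \<notin> cball 0 (2 * r) \<longrightarrow> (\<phi> x)\<^sup>2 \<ge> 1 / 16) \<and>
    (\<forall>x. (norm (grad \<phi> x))\<^sup>2 \<le> cball_ind (2 * r) x * B + cball_ind R x * (128 / R\<^sup>2))"
    and "0 \<le> B"
proof -
  obtain \<tau> \<tau>' where \<tau>: "is_C1 \<tau> \<tau>'" "\<And>x. 0 \<le> \<tau> x" "\<And>x. \<tau> x \<le> 1"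
    "\<And>x. x \<in> cball 0 r \<Longrightarrow> \<tau> x = 1" "\<And>x. x \<notin> cball 0 (2 * r) \<Longrightarrow> \<tau> x = 0"
    using plateau_exists[OF r_pos] by blast
  have "bounded {x. \<tau> x \<noteq> 0}"
    by (rule bounded_subset[OF bounded_cball[of 0 "2 * r"]]) (use \<tau>(5) in blast)
  then obtain b where b: "\<And>x. norm (\<tau>' x) \<le> b"
    using continuous_support_bounded[OF is_C1_continuous_grad[OF \<tau>(1)] is_C1_support[OF \<tau>(1)]] by blast
  show thesis
  proof (rule that[of "2 * b\<^sup>2"])
    fix R :: real assume R: "R > 0"
    obtain H where H: "is_C2 (theta R) (theta' R) H"
      using theta_C2[OF R] by blast
    note th = is_C2_imp_C1[OF H]
    define \<phi> where "\<phi> x = (1 + - \<tau> x) * theta R x" for x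
    have C1: "is_C1 \<phi> (\<lambda>x. (1 + - \<tau> x) *\<^sub>R theta' R x + theta R x *\<^sub>R (0 + - \<tau>' x))"
      unfolding \<phi>_def[abs_def] by (intro is_C1_mult is_C1_add is_C1_const is_C1_uminus \<tau> th)
    have s: "bounded {x. \<phi> x \<noteq> 0}"
      by (rule bounded_subset[OF theta_bounded_support[OF R]]) (auto simp: \<phi>_def)
    show "\<exists>\<phi>\<in>C1c. (\<forall>x\<in>cball 0 r. \<phi> x = 0) \<and>
      (\<forall>x. x \<in> cball 0 (R / 2) \<longrightarrow> x \<notin> cball 0 (2 * r) \<longrightarrow> (\<phi> x)\<^sup>2 \<ge> 1 / 16) \<and>
      (\<forall>x. (norm (grad \<phi> x))\<^sup>2 \<le> cball_ind (2 * r) x * (2 * b\<^sup>2) + cball_ind R x * (128 / R\<^sup>2))"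
    proof (intro bexI[of _ \<phi>] conjI ballI allI impI)
      show "\<phi> \<in> C1c" by (rule C1c_I[OF C1 s])
      show "\<phi> x = 0" if "x \<in> cball 0 r" for x using \<tau>(4)[OF that] by (simp add: \<phi>_def)
      show "(\<phi> x)\<^sup>2 \<ge> 1 / 16" if "x \<in> cball 0 (R / 2)" "x \<notin> cball 0 (2 * r)" for x
      proof -
        have "1 / 4 \<le> \<phi> x" using \<tau>(5)[OF that(2)] theta_ge[OF R that(1)] by (simp add: \<phi>_def)
        then have "(1 / 4)\<^sup>2 \<le> (\<phi> x)\<^sup>2" by (rule power_mono) simp
        then show ?thesis by (simp add: power2_eq_square)
      qed
      fix x
      let ?a = "norm ((1 - \<tau> x) *\<^sub>R theta' R x)" and ?c = "norm (theta R x *\<^sub>R \<tau>' x)"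
      have 1: "?a\<^sup>2 \<le> 64 / R\<^sup>2 * cball_ind R x"
      proof -
        have "?a \<le> 1 * norm (theta' R x)"
          unfolding norm_scaleR using \<tau>(2,3)[of x] by (intro mult_right_mono) auto
        then have "?a\<^sup>2 \<le> (norm (theta' R x))\<^sup>2" by (intro power_mono) auto
        then show ?thesis using norm_theta'[OF R, of x] by linarith
      qed
      have 2: "?c\<^sup>2 \<le> b\<^sup>2 * cball_ind (2 * r) x"
      proof (cases "x \<in> cball 0 (2 * r)")
        case True
        have "?c \<le> 1 * norm (\<tau>' x)"
          unfolding norm_scaleR using theta_01[of R x] by (intro mult_right_mono) auto
        then have "?c \<le> b" using b[of x] by linarith
        then have "?c\<^sup>2 \<le> b\<^sup>2" by (intro power_mono) auto
        then show ?thesis using True by simp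
      next
        case False
        have "\<tau>' x = 0" using is_C1_zero_outside[OF \<tau>(1) _ False] \<tau>(5) by blast
        then show ?thesis by simp
      qed
      have "norm (grad \<phi> x) \<le> ?a + ?c"
        unfolding is_C1_grad[OF C1] using norm_triangle_ineq4[of "(1 - \<tau> x) *\<^sub>R theta' R x" "theta R x *\<^sub>R \<tau>' x"]
        by simp
      then have "(norm (grad \<phi> x))\<^sup>2 \<le> (?a + ?c)\<^sup>2" by (intro power_mono) auto
      also have "\<dots> \<le> 2 * ?a\<^sup>2 + 2 * ?c\<^sup>2"
        using zero_le_power2[of "?a - ?c"] unfolding power2_sum power2_diff by linarith
      finally have "(norm (grad \<phi> x))\<^sup>2 \<le> 2 * ?a\<^sup>2 + 2 * ?c\<^sup>2" .
      then show "(norm (grad \<phi> x))\<^sup>2 \<le> cball_ind (2 * r) x * (2 * b\<^sup>2) + cball_ind R x * (128 / R\<^sup>2)"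
      proof -
        have "cball_ind R x * (128 / R\<^sup>2) = 2 * (64 / R\<^sup>2 * cball_ind R x)"
          "cball_ind (2 * r) x * (2 * b\<^sup>2) = 2 * (b\<^sup>2 * cball_ind (2 * r) x)"
          by simp_all
        then show ?thesis using \<open>(norm (grad \<phi> x))\<^sup>2 \<le> 2 * ?a\<^sup>2 + 2 * ?c\<^sup>2\<close> 1 2 by linarith
      qed
    qed
  qed simp
qed

text \<open>On the fixed ball of radius \<open>2 * r\<close>, where the cutoff may vanish, the
  trivial bound \<open>C\<close> is used instead.\<close>

lemma indicator_le_cutoff:
  assumes f: "0 \<le> f" "f \<le> C" and \<phi>: "x \<in> cball 0 (R / 2) \<Longrightarrow> x \<notin> cball 0 (2 * r) \<Longrightarrow> (p::real) \<ge> 1 / 16"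
    and p: "0 \<le> p"
  shows "cball_ind (R / 2) x * f \<le> cball_ind (2 * r) x * C + 16 * (f * p)"
proof (cases "x \<in> cball 0 (R / 2) \<and> x \<notin> cball 0 (2 * r)")
  case True
  then have "f * (1 / 16) \<le> f * p" using \<phi> f by (intro mult_left_mono) auto
  then show ?thesis using True by simp
next
  case False
  have "0 \<le> f * p" using f p by simp
  then show ?thesis using False f by (auto simp: indicator_def)
qed

text \<open>Dimension three enters here: in \<open>stability_q\<close> the volume R^3 meets the
  squared gradient R^-2, which leaves R; with this growth the right-hand side of
  \<open>stability_w\<close> is of order R^-2 times R plus a constant. The fixed ball contributes
  constants only.\<close>

lemma growth_bounds:
  obtains C where "C \<ge> 0" "\<And>R. R \<ge> 1 \<Longrightarrow> (LINT x|lebesgue. cball_ind R x * q x) \<le> C * R"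
    "\<And>R. R \<ge> 1 \<Longrightarrow> (LINT x|lebesgue. cball_ind R x * w x) \<le> C"
proof -
  let ?I = "\<lambda>R x. cball_ind R x"
  obtain B where B: "0 \<le> B" and cutoff: "\<And>R. R > 0 \<Longrightarrow> \<exists>\<phi>\<in>C1c. (\<forall>x\<in>cball 0 r. \<phi> x = 0) \<and>
    (\<forall>x. x \<in> cball 0 (R / 2) \<longrightarrow> x \<notin> cball 0 (2 * r) \<longrightarrow> (\<phi> x)\<^sup>2 \<ge> 1 / 16) \<and>
    (\<forall>x. (norm (grad \<phi> x))\<^sup>2 \<le> ?I (2 * r) x * B + ?I R x * (128 / R\<^sup>2))"
    using cutoff_outside_ball by metis
  obtain \<omega> where \<omega>: "\<omega> \<ge> 0" "\<And>R. R \<ge> 0 \<Longrightarrow> measure lebesgue (cball (0::R3) R) = \<omega> * R ^ 3"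
    using measure_cball_R3 less_imp_le by metis
  have I: "(LINT x|lebesgue. ?I R x * c) = \<omega> * R ^ 3 * c" if "R \<ge> 0" for R c
    using \<omega>(2)[OF that] by simp
  have Ii: "integrable lebesgue (\<lambda>x. ?I R x * c)" for R c
    by (rule integrable_indicator_cball)
  define A where "A = \<omega> * (2 * r) ^ 3"
  have A: "A \<ge> 0" using \<omega>(1) r_pos by (simp add: A_def)
  \<comment> \<open>32 is 16 from \<open>indicator_le_cutoff\<close> times 2 from
    \<open>stability_q\<close>; 256 is 8 * 128 / 4, from the cutoff at scale
    \<open>2 * R\<close>.\<close>
  define C1 where "C1 = A * (2 * M\<^sup>2) + 32 * (A * B) + 32 * 256 * \<omega>"
  have C1: "C1 \<ge> 0" unfolding C1_def using A B \<omega>(1) by (intro add_nonneg_nonneg mult_nonneg_nonneg) auto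
  have q1: "(LINT x|lebesgue. ?I R x * q x) \<le> C1 * R" if R: "R \<ge> 1" for R
  proof -
    \<comment> \<open>The scale is \<open>2 * R\<close> because the cutoff is bounded below only on
      the ball of half its radius.\<close>
    obtain \<phi> where \<phi>: "\<phi> \<in> C1c" "\<And>x. x \<in> cball 0 r \<Longrightarrow> \<phi> x = 0"
      "\<And>x. x \<in> cball 0 R \<Longrightarrow> x \<notin> cball 0 (2 * r) \<Longrightarrow> (\<phi> x)\<^sup>2 \<ge> 1 / 16"
      "\<And>x. (norm (grad \<phi> x))\<^sup>2 \<le> ?I (2 * r) x * B + ?I (2 * R) x * (128 / (2 * R)\<^sup>2)"
      using cutoff[of "2 * R"] R by auto
    have k: "continuous_on UNIV (\<lambda>x. (\<phi> x)\<^sup>2)" "bounded {x. (\<phi> x)\<^sup>2 \<noteq> 0}"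
      using C1c_D(2)[OF \<phi>(1)] by (auto intro!: continuous_intros is_C1_continuous[OF C1c_D(1)[OF \<phi>(1)]])
    have "(LINT x|lebesgue. ?I R x * q x) \<le> (LINT x|lebesgue. ?I (2 * r) x * (2 * M\<^sup>2) + 16 * (q x * (\<phi> x)\<^sup>2))"
    proof (rule integral_mono)
      show "?I R x * q x \<le> ?I (2 * r) x * (2 * M\<^sup>2) + 16 * (q x * (\<phi> x)\<^sup>2)" for x
        using indicator_le_cutoff[of "q x" "2 * M\<^sup>2" x "2 * R" "(\<phi> x)\<^sup>2"] q_nonneg[of x] q_bound[of x] \<phi>(3)[of x]
        by simp
    qed (intro Bochner_Integration.integrable_add integrable_mult_right integrable_indicator_q Ii integrable_weight_q k)+
    also have "\<dots> = A * (2 * M\<^sup>2) + 16 * (LINT x|lebesgue. q x * (\<phi> x)\<^sup>2)"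
      using I[of "2 * r" "2 * M\<^sup>2"] r_pos integrable_weight_q(1)[OF k] Ii
      by (subst Bochner_Integration.integral_add) (auto simp: A_def)
    also have "(LINT x|lebesgue. q x * (\<phi> x)\<^sup>2) \<le> 2 * (LINT x|lebesgue. (norm (grad \<phi> x))\<^sup>2)"
      by (rule stability_q[OF \<phi>(1,2)])
    also have "(LINT x|lebesgue. (norm (grad \<phi> x))\<^sup>2) \<le> (LINT x|lebesgue. ?I (2 * r) x * B + ?I (2 * R) x * (128 / (2 * R)\<^sup>2))"
      using norm_grad_integrable[OF \<phi>(1) C1c_zero(1)]
      by (intro integral_mono Bochner_Integration.integrable_add Ii \<phi>(4)) (simp_all add: C1c_zero)
    also have "\<dots> = A * B + \<omega> * (2 * R) ^ 3 * (128 / (2 * R)\<^sup>2)"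
      unfolding Bochner_Integration.integral_add[OF Ii Ii] using r_pos R by (subst (1 2) I) (auto simp: A_def)
    also have "\<omega> * (2 * R) ^ 3 * (128 / (2 * R)\<^sup>2) = 256 * \<omega> * R"
      using R by (simp add: power2_eq_square power3_eq_cube)
    finally have "(LINT x|lebesgue. ?I R x * q x) \<le> A * (2 * M\<^sup>2) + 32 * (A * B) + 32 * 256 * \<omega> * R"
      by simp
    also have "\<dots> \<le> (A * (2 * M\<^sup>2) + 32 * (A * B)) * R + 32 * 256 * \<omega> * R"
      using mult_left_mono[OF R, of "A * (2 * M\<^sup>2) + 32 * (A * B)"] A B by simp
    also have "\<dots> = C1 * R" by (simp add: C1_def algebra_simps)
    finally show ?thesis .
  qed
  \<comment> \<open>The factor 16 of \<open>indicator_le_cutoff\<close> is 4 * 4, and one 4 is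
    absorbed by \<open>stability_w\<close>; 256 is the other 4 times 64, where 64 is 128 * 2 /
    4.\<close>
  define C2 where "C2 = A * (M\<^sup>2 * M\<^sup>2) + 4 * (A * (2 * M\<^sup>2 * B)) + 256 * C1"
  have C2: "C2 \<ge> 0" unfolding C2_def using A B C1 by (intro add_nonneg_nonneg mult_nonneg_nonneg) auto
  have w1: "(LINT x|lebesgue. ?I R x * w x) \<le> C2" if R: "R \<ge> 1" for R
  proof -
    obtain \<phi> where \<phi>: "\<phi> \<in> C1c" "\<And>x. x \<in> cball 0 r \<Longrightarrow> \<phi> x = 0"
      "\<And>x. x \<in> cball 0 R \<Longrightarrow> x \<notin> cball 0 (2 * r) \<Longrightarrow> (\<phi> x)\<^sup>2 \<ge> 1 / 16"
      "\<And>x. (norm (grad \<phi> x))\<^sup>2 \<le> ?I (2 * r) x * B + ?I (2 * R) x * (128 / (2 * R)\<^sup>2)"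
      using cutoff[of "2 * R"] R by auto
    have k: "continuous_on UNIV (\<lambda>x. (\<phi> x)\<^sup>2)" "bounded {x. (\<phi> x)\<^sup>2 \<noteq> 0}"
      using C1c_D(2)[OF \<phi>(1)] by (auto intro!: continuous_intros is_C1_continuous[OF C1c_D(1)[OF \<phi>(1)]])
    have k': "continuous_on UNIV (\<lambda>x. (norm (grad \<phi> x))\<^sup>2)" "bounded {x. (norm (grad \<phi> x))\<^sup>2 \<noteq> 0}"
      using is_C1_support[OF C1c_D[OF \<phi>(1)]]
      by (auto intro!: continuous_intros is_C1_continuous_grad[OF C1c_D(1)[OF \<phi>(1)]])
    have "(LINT x|lebesgue. ?I R x * w x) \<le> (LINT x|lebesgue. ?I (2 * r) x * (M\<^sup>2 * M\<^sup>2) + 16 * (w x * (\<phi> x)\<^sup>2))"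
    proof (rule integral_mono)
      show "?I R x * w x \<le> ?I (2 * r) x * (M\<^sup>2 * M\<^sup>2) + 16 * (w x * (\<phi> x)\<^sup>2)" for x
        using indicator_le_cutoff[of "w x" "M\<^sup>2 * M\<^sup>2" x "2 * R" "(\<phi> x)\<^sup>2"] w_nonneg[of x] w_bound[of x] \<phi>(3)[of x]
        by simp
    qed (intro Bochner_Integration.integrable_add integrable_mult_right integrable_indicator_q Ii integrable_weight_q k)+
    also have "\<dots> = A * (M\<^sup>2 * M\<^sup>2) + 4 * (4 * (LINT x|lebesgue. w x * (\<phi> x)\<^sup>2))"
      using I[of "2 * r" "M\<^sup>2 * M\<^sup>2"] r_pos integrable_weight_q(2)[OF k] Ii
      by (subst Bochner_Integration.integral_add) (auto simp: A_def)
    also have "4 * (LINT x|lebesgue. w x * (\<phi> x)\<^sup>2) \<le> (LINT x|lebesgue. q x * (norm (grad \<phi> x))\<^sup>2)"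
      by (rule stability_w[OF \<phi>(1,2)])
    also have "(LINT x|lebesgue. q x * (norm (grad \<phi> x))\<^sup>2)
        \<le> (LINT x|lebesgue. ?I (2 * r) x * (2 * M\<^sup>2 * B) + (128 / (2 * R)\<^sup>2) * (?I (2 * R) x * q x))"
    proof (rule integral_mono)
      fix x
      have "q x * (norm (grad \<phi> x))\<^sup>2 \<le> q x * (?I (2 * r) x * B) + q x * (?I (2 * R) x * (128 / (2 * R)\<^sup>2))"
        using mult_left_mono[OF \<phi>(4) q_nonneg, of x x] by (simp add: distrib_left)
      also have "q x * (?I (2 * r) x * B) \<le> 2 * M\<^sup>2 * (?I (2 * r) x * B)"
        using q_bound[of x] B by (intro mult_right_mono) auto
      finally show "q x * (norm (grad \<phi> x))\<^sup>2 \<le> ?I (2 * r) x * (2 * M\<^sup>2 * B) + (128 / (2 * R)\<^sup>2) * (?I (2 * R) x * q x)"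
        by (simp add: mult_ac)
    qed (intro Bochner_Integration.integrable_add integrable_mult_right integrable_indicator_q Ii integrable_weight_q k')+
    also have "\<dots> = A * (2 * M\<^sup>2 * B) + (128 / (2 * R)\<^sup>2) * (LINT x|lebesgue. ?I (2 * R) x * q x)"
      using I[of "2 * r" "2 * M\<^sup>2 * B"] r_pos Ii integrable_indicator_q(1)
      by (subst Bochner_Integration.integral_add) (auto simp: A_def)
    also have "(128 / (2 * R)\<^sup>2) * (LINT x|lebesgue. ?I (2 * R) x * q x) \<le> (128 / (2 * R)\<^sup>2) * (C1 * (2 * R))"
      by (intro mult_left_mono q1) (use R in simp_all)
    also have "(128 / (2 * R)\<^sup>2) * (C1 * (2 * R)) = 64 * C1 / R"
      using R by (simp add: power2_eq_square)
    also have "64 * C1 / R \<le> 64 * C1"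
      using R C1 by (simp add: divide_le_eq mult_le_cancel_left1)
    finally show ?thesis by (simp add: C2_def)
  qed
  show thesis
  proof (rule that[of "C1 + C2"])
    show "(LINT x|lebesgue. ?I R x * q x) \<le> (C1 + C2) * R" if "R \<ge> 1" for R
    proof -
      have "0 \<le> C2 * R" using C2 that by simp
      then show ?thesis using q1[OF that] by (simp add: distrib_right)
    qed
    show "(LINT x|lebesgue. ?I R x * w x) \<le> C1 + C2" if "R \<ge> 1" for R
      using w1[OF that] C1 by linarith
  qed (use C1 C2 in simp)
qed

text \<open>Supplies the dominating function for the limit of large radii in
  \<open>w_AE_zero\<close>.\<close>

lemma w_integrable: "integrable lebesgue w"
proof -
  obtain C where C: "\<And>R. R \<ge> 1 \<Longrightarrow> (LINT x|lebesgue. cball_ind R x * w x) \<le> C"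
    using growth_bounds by metis
  let ?f = "\<lambda>n x. indicat_real (cball (0::R3) (real (Suc n))) x * w x"
  have mono: "?f m x \<le> ?f n x" if "m \<le> n" for m n x
    using that w_nonneg[of x] by (auto simp: indicator_def)
  have "incseq (\<lambda>n. LINT x|lebesgue. ?f n x)"
    by (intro incseq_SucI integral_mono integrable_indicator_q mono) simp
  moreover have "\<forall>n. (LINT x|lebesgue. ?f n x) \<le> C"
    by (intro allI C) simp
  ultimately obtain L where L: "(\<lambda>n. LINT x|lebesgue. ?f n x) \<longlonglongrightarrow> L"
    by (rule incseq_convergent)
  show ?thesis
  proof (rule integrable_monotone_convergence[OF _ _ _ L w_meas])
    show "integrable lebesgue (?f n)" for n by (rule integrable_indicator_q)
    show "AE x in lebesgue. mono (\<lambda>n. ?f n x)"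
      by (intro AE_I2 monoI mono)
    show "AE x in lebesgue. (\<lambda>n. ?f n x) \<longlonglongrightarrow> w x"
    proof (rule AE_I2, rule tendsto_eventually)
      fix x :: R3
      have "\<forall>\<^sub>F n in sequentially. norm x \<le> real n"
        using filterlim_real_sequentially unfolding filterlim_at_top by blast
      then show "\<forall>\<^sub>F n in sequentially. ?f n x = w x"
        by eventually_elim auto
    qed
  qed
qed

end

section \<open>The Pohozaev inequality and its consequences\<close>

lemma le_if_le_add_div:
  fixes x a c :: real
  assumes "\<And>R. R \<ge> R\<^sub>0 \<Longrightarrow> x \<le> a + c / R"
  shows "x \<le> a"
proof (rule tendsto_lowerbound)
  have "((\<lambda>R::real. a + c * inverse R) \<longlongrightarrow> a + c * 0) at_top"
    by (intro tendsto_intros tendsto_inverse_0_at_top filterlim_ident)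
  then show "((\<lambda>R::real. a + c / R) \<longlongrightarrow> a) at_top" by (simp add: divide_inverse)
  show "\<forall>\<^sub>F R in at_top. x \<le> a + c / R"
    using eventually_ge_at_top[of R\<^sub>0] by eventually_elim (rule assms)
qed simp

lemma le_if_le_add_mult:
  fixes x y a :: real
  assumes "\<And>s. s > 0 \<Longrightarrow> x \<le> y + s * a"
  shows "x \<le> y"
  by (rule le_if_le_add_div[of 1 _ _ a]) (use assms[of "1 / _"] in simp)

context approximated_solution
begin

text \<open>The system has a Pohozaev identity because u v^2 and u^2 v are the partial derivatives
  of u^2 v^2 / 2; \<open>?IW\<close> is the radial derivative of this potential along the mollified
  pair. The multiplier terms \<open>?IU\<close> and \<open>?IV\<close> differ from it by defects
  times x . grad U and x . grad V. On the ball |x| is at most R, and Young's inequality with weight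
  \<open>t\<close> splits each product into a part of \<open>err\<close> and a multiple of the
  energy that is small with \<open>t\<close>.\<close>

lemma pohozaev_approximation:
  assumes R: "R > 0" and t: "t > 0"
  shows "3 / 2 * (LINT x|lebesgue. w\<^sub>n n x * theta R x)
    - 4 * (LINT x|lebesgue. w\<^sub>n n x * zeta R x) - 1 / 2 * (LINT x|lebesgue. D n x * theta R x)
    \<le> R / (2 * t) * (LINT x|lebesgue. err n x * theta R x) + R * t / 2 * (LINT x|lebesgue. D n x * theta R x)
      + 4 * (LINT x|lebesgue. D n x * zeta R x)"
proof -
  obtain H where "is_C2 (theta R) (theta' R) H"
    using theta_C2[OF R] by blast
  then have th: "is_C1 (theta R) (theta' R)" by (rule is_C2_imp_C1)
  note ct = theta_continuous[of R] and cz = zeta_continuous[of R] and ct' = is_C1_continuous_grad[OF th]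
  note st = theta_bounded_support[OF R] and sz = zeta_bounded_support[OF R]
  let ?P = "\<lambda>x. (U n x)\<^sup>2 * (V n x)\<^sup>2"
  let ?e = "\<lambda>g x. (g x \<bullet> theta' R x) * (x \<bullet> g x) - (x \<bullet> theta' R x) * (norm (g x))\<^sup>2 / 2"
  have iF: "integrable lebesgue (\<lambda>x. - trace (HU n x) * (x \<bullet> GU n x) * theta R x)"
    "integrable lebesgue (\<lambda>x. - trace (HV n x) * (x \<bullet> GV n x) * theta R x)"
    by (intro integrable_continuous_mult_support continuous_intros cont ct st)+
  have ie: "integrable lebesgue (\<lambda>x. - (norm (g x))\<^sup>2 * theta R x / 2 + ?e g x)"
    if g: "continuous_on UNIV g" for g :: "R3 \<Rightarrow> R3"
  proof (rule integrable_continuous_support)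
    show "continuous_on UNIV (\<lambda>x. - (norm (g x))\<^sup>2 * theta R x / 2 + ?e g x)"
      by (intro continuous_intros g ct ct') simp_all
    have "theta R x = 0 \<and> theta' R x = 0" if "x \<notin> cball 0 R" for x
      using theta_support[OF R] is_C1_zero_outside[OF th _ that] that by blast
    then show "bounded {x. - (norm (g x))\<^sup>2 * theta R x / 2 + ?e g x \<noteq> 0}"
      by (intro bounded_subset[OF bounded_cball[of 0 R]]) fastforce
  qed
  have iP: "integrable lebesgue (\<lambda>x. ?P x * theta R x)" "integrable lebesgue (\<lambda>x. ?P x * zeta R x)"
    and iD: "integrable lebesgue (\<lambda>x. D n x * theta R x)" "integrable lebesgue (\<lambda>x. D n x * zeta R x)"
    and ierr: "integrable lebesgue (\<lambda>x. err n x * theta R x)"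
    by (intro integrable_continuous_mult_support continuous_intros cont cont_D cont_err ct cz st sz)+
  let ?ga = "\<lambda>x. (1 / 2) *\<^sub>R ((2 * (U n x * V n x)) *\<^sub>R (U n x *\<^sub>R GV n x + V n x *\<^sub>R GU n x))"
  have a: "is_C1 (\<lambda>x. 1 / 2 * (U n x * V n x)\<^sup>2) ?ga"
    by (intro is_C1_cmult is_C1_power2 is_C1_mult is_C2_imp_C1[OF U_C2] is_C2_imp_C1[OF V_C2])
  have ga: "x \<bullet> ?ga x = U n x * (V n x)\<^sup>2 * (x \<bullet> GU n x) + (U n x)\<^sup>2 * V n x * (x \<bullet> GV n x)" for x
    by (simp add: inner_add_right power2_eq_square algebra_simps)
  have iW: "integrable lebesgue (\<lambda>x. (x \<bullet> ?ga x) * theta R x)"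
    by (intro integrable_continuous_mult_support continuous_intros cont ct st)
  let ?IU = "LINT x|lebesgue. - trace (HU n x) * (x \<bullet> GU n x) * theta R x"
  let ?IV = "LINT x|lebesgue. - trace (HV n x) * (x \<bullet> GV n x) * theta R x"
  let ?IW = "LINT x|lebesgue. (x \<bullet> ?ga x) * theta R x"
  \<comment> \<open>3/2 is half the dimension, and 4 is half of the 8 in
    \<open>inner_theta'\<close>.\<close>
  have W: "?IW = - (3 / 2) * (LINT x|lebesgue. ?P x * theta R x) + 4 * (LINT x|lebesgue. ?P x * zeta R x)"
  proof -
    have "?IW = (LINT x|lebesgue. - (1 / 2 * (U n x * V n x)\<^sup>2) * (3 * theta R x + x \<bullet> theta' R x))"
      by (rule radial_derivative_identity[OF a th st])
    also have "\<dots> = (LINT x|lebesgue. - (3 / 2) * (?P x * theta R x) + 4 * (?P x * zeta R x))"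
      unfolding inner_theta'
      by (intro Bochner_Integration.integral_cong refl) (simp add: power_mult_distrib field_simps)
    also have "\<dots> = - (3 / 2) * (LINT x|lebesgue. ?P x * theta R x) + 4 * (LINT x|lebesgue. ?P x * zeta R x)"
      using iP by (subst Bochner_Integration.integral_add) (auto intro!: integrable_mult_right)
    finally show ?thesis .
  qed
  have "?IU + ?IV - ?IW = (LINT x|lebesgue. (- trace (HU n x) * (x \<bullet> GU n x) * theta R x) +
      (- trace (HV n x) * (x \<bullet> GV n x) * theta R x) - (x \<bullet> ?ga x) * theta R x)" (is "_ = integral\<^sup>L _ ?S")
    using iF iW by (simp only: Bochner_Integration.integral_add Bochner_Integration.integral_diff
        Bochner_Integration.integrable_add)
  also have "\<dots> \<le> (LINT x|lebesgue. R / (2 * t) * (err n x * theta R x) + R * t / 2 * (D n x * theta R x))"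
    (is "_ \<le> integral\<^sup>L _ ?T")
  proof (rule integral_mono)
    fix x
    define \<alpha> where "\<alpha> = - trace (HU n x) - U n x * (V n x)\<^sup>2"
    define \<beta> where "\<beta> = - trace (HV n x) - (U n x)\<^sup>2 * V n x"
    have young: "a * (x \<bullet> g) \<le> R * (a\<^sup>2 / (2 * t) + t * (norm g)\<^sup>2 / 2)" if x: "norm x \<le> R" for a and g :: R3
    proof -
      have "a * (x \<bullet> g) \<le> \<bar>a\<bar> * \<bar>x \<bullet> g\<bar>" by (simp flip: abs_mult)
      also have "\<dots> \<le> \<bar>a\<bar> * (norm x * norm g)"
        by (intro mult_left_mono Cauchy_Schwarz_ineq2) simp
      also have "\<dots> \<le> \<bar>a\<bar> * (R * norm g)"
        using x by (intro mult_left_mono mult_right_mono) auto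
      also have "\<dots> = R * (\<bar>a\<bar> * norm g)" by simp
      also have "\<dots> \<le> R * (a\<^sup>2 / (2 * t) + t * (norm g)\<^sup>2 / 2)"
      proof (rule mult_left_mono)
        have "0 \<le> (\<bar>a\<bar> - t * norm g)\<^sup>2 / (2 * t)" using t by simp
        also have "\<dots> = a\<^sup>2 / (2 * t) + t * (norm g)\<^sup>2 / 2 - \<bar>a\<bar> * norm g"
          using t by (simp add: power2_diff field_simps power2_eq_square)
        finally show "\<bar>a\<bar> * norm g \<le> a\<^sup>2 / (2 * t) + t * (norm g)\<^sup>2 / 2" by simp
      qed (use R in simp)
      finally show ?thesis .
    qed
    have "?S x = (\<alpha> * (x \<bullet> GU n x) + \<beta> * (x \<bullet> GV n x)) * theta R x"
      unfolding ga by (simp add: \<alpha>_def \<beta>_def algebra_simps)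
    also have "\<dots> \<le> (R * (\<alpha>\<^sup>2 / (2 * t) + t * (norm (GU n x))\<^sup>2 / 2) + R * (\<beta>\<^sup>2 / (2 * t) + t * (norm (GV n x))\<^sup>2 / 2)) * theta R x"
    proof (cases "x \<in> cball 0 R")
      case True
      then show ?thesis by (intro mult_right_mono add_mono young theta_01) auto
    next
      case False
      then show ?thesis by (simp add: theta_support[OF R False])
    qed
    also have "\<dots> = ?T x"
    proof -
      have "err n x = \<alpha>\<^sup>2 + \<beta>\<^sup>2" by (simp add: err_def \<alpha>_def \<beta>_def)
      then show ?thesis using t by (simp add: D_def field_simps)
    qed
    finally show "?S x \<le> ?T x" .
  qed (intro Bochner_Integration.integrable_add Bochner_Integration.integrable_diff integrable_mult_right iF iW ierr iD)+
  also have "\<dots> = R / (2 * t) * (LINT x|lebesgue. err n x * theta R x) + R * t / 2 * (LINT x|lebesgue. D n x * theta R x)"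
    using ierr iD(1) by (subst Bochner_Integration.integral_add) (auto intro!: integrable_mult_right)
  finally have upper: "?IU + ?IV - ?IW \<le>
    R / (2 * t) * (LINT x|lebesgue. err n x * theta R x) + R * t / 2 * (LINT x|lebesgue. D n x * theta R x)" .
  have "- (1 / 2) * (LINT x|lebesgue. D n x * theta R x) - 4 * (LINT x|lebesgue. D n x * zeta R x)
      = (LINT x|lebesgue. - (1 / 2) * (D n x * theta R x) - 4 * (D n x * zeta R x))"
    using iD by (subst Bochner_Integration.integral_diff) (auto intro!: integrable_mult_right)
  also have "\<dots> \<le> (LINT x|lebesgue. (- (norm (GU n x))\<^sup>2 * theta R x / 2 + ?e (GU n) x) +
      (- (norm (GV n x))\<^sup>2 * theta R x / 2 + ?e (GV n) x))"
    (is "integral\<^sup>L _ ?S \<le> integral\<^sup>L _ ?T")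
  proof (rule integral_mono)
    fix x
    show "?S x \<le> ?T x"
      using pohozaev_error_bound[of "GU n x" R x] pohozaev_error_bound[of "GV n x" R x]
      unfolding D_def abs_le_iff by (simp add: algebra_simps)
  qed (intro Bochner_Integration.integrable_add Bochner_Integration.integrable_diff integrable_mult_right ie iD cont)+
  also have "\<dots> = ?IU + ?IV"
    unfolding pohozaev_identity[OF U_C2 th st] pohozaev_identity[OF V_C2 th st]
    by (intro Bochner_Integration.integral_add ie cont)
  finally show ?thesis using upper W by linarith
qed

text \<open>First the mollification is removed, then \<open>t\<close> tends to 0. The energy
  identity replaces the limits of the energies with weights \<open>theta\<close> and
  \<open>zeta\<close> by twice the integrals of \<open>w\<close> with these weights, up to O(1/R).
  What remains on the left is 3/2 - 1 = 1/2, the gap between the Pohozaev and the energy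
  identity.\<close>

lemma pohozaev_inequality:
  "\<exists>C. \<forall>R\<ge>1.
    (LINT x|lebesgue. w x * theta R x) / 2 \<le> 12 * (LINT x|lebesgue. w x * zeta R x) + C / R \<and>
    (\<exists>d. (\<lambda>n. LINT x|lebesgue. D n x * theta R x) \<longlonglongrightarrow> d \<and> d \<le> 2 * (LINT x|lebesgue. w x * theta R x) + C / R)"
proof -
  let ?I = "\<lambda>R x. cball_ind R x"
  obtain C where C: "C \<ge> 0" "\<And>R. R \<ge> 1 \<Longrightarrow> (LINT x|lebesgue. ?I R x * q x) \<le> C * R"
    using growth_bounds by metis
  \<comment> \<open>The linear growth of \<open>q\<close> against the R^-2 of the Laplacian leaves
    1/R.\<close>
  have lap: "\<bar>LINT x|lebesgue. q x * (trace (H x) / 2)\<bar> \<le> 36 * C / R"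
    if R: "R \<ge> 1" and H: "\<And>x. \<bar>trace (H x :: real^3^3)\<bar> \<le> 72 / R\<^sup>2 * ?I R x" for R H
  proof -
    have "\<bar>LINT x|lebesgue. q x * (trace (H x) / 2)\<bar> \<le> (LINT x|lebesgue. \<bar>q x * (trace (H x) / 2)\<bar>)"
      by (rule integral_abs_bound)
    also have "\<dots> \<le> (LINT x|lebesgue. 36 / R\<^sup>2 * (?I R x * q x))"
    proof (rule integral_mono_AE')
      show "AE x in lebesgue. \<bar>q x * (trace (H x) / 2)\<bar> \<le> 36 / R\<^sup>2 * (?I R x * q x)"
      proof (rule AE_I2)
        fix x
        have "q x * \<bar>trace (H x)\<bar> \<le> q x * (72 / R\<^sup>2 * ?I R x)"
          by (intro mult_left_mono H q_nonneg)
        then show "\<bar>q x * (trace (H x) / 2)\<bar> \<le> 36 / R\<^sup>2 * (?I R x * q x)"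
          using q_nonneg[of x] by (simp add: abs_mult mult_ac)
      qed
    qed (intro integrable_mult_right integrable_indicator_q, simp add: q_nonneg)
    also have "\<dots> = 36 / R\<^sup>2 * (LINT x|lebesgue. ?I R x * q x)" by simp
    also have "\<dots> \<le> 36 / R\<^sup>2 * (C * R)"
      by (intro mult_left_mono C R) simp
    also have "\<dots> = 36 * C / R" using R by (simp add: power2_eq_square)
    finally show ?thesis .
  qed
  \<comment> \<open>12 is 4 + 4 * 2. The energies \<open>d\<close> and \<open>d'\<close> enter with
    factors 1/2 and 4 and an error \<open>36 * C / R\<close> each, so 162 is 18 + 144.\<close>
  have *: "(LINT x|lebesgue. w x * theta R x) / 2 \<le> 12 * (LINT x|lebesgue. w x * zeta R x) + 162 * C / R \<and>
    (\<exists>d. (\<lambda>n. LINT x|lebesgue. D n x * theta R x) \<longlonglongrightarrow> d \<and> d \<le> 2 * (LINT x|lebesgue. w x * theta R x) + 162 * C / R)"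
    if R1: "R \<ge> 1" for R
  proof -
    have R: "R > 0" using R1 by simp
    obtain H where H: "is_C2 (theta R) (theta' R) H" "\<And>x. \<bar>trace (H x)\<bar> \<le> 72 / R\<^sup>2 * ?I R x"
      using theta_C2[OF R] by blast
    obtain z1 H2 where H2: "is_C2 (zeta R) z1 H2" "\<And>x. \<bar>trace (H2 x)\<bar> \<le> 72 / R\<^sup>2 * ?I R x"
      using zeta_C2[OF R] by blast
    note ct = theta_continuous[of R] and cz = zeta_continuous[of R]
    note st = theta_bounded_support[OF R] and sz = zeta_bounded_support[OF R]
    let ?wt = "LINT x|lebesgue. w x * theta R x" and ?wz = "LINT x|lebesgue. w x * zeta R x"
    define d where "d = 2 * ?wt + (LINT x|lebesgue. q x * (trace (H x) / 2))"
    define d' where "d' = 2 * ?wz + (LINT x|lebesgue. q x * (trace (H2 x) / 2))"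
    have limd: "(\<lambda>n. LINT x|lebesgue. D n x * theta R x) \<longlonglongrightarrow> d"
      using lim_energy[OF H(1) st] by (simp add: d_def mult.assoc)
    have limd': "(\<lambda>n. LINT x|lebesgue. D n x * zeta R x) \<longlonglongrightarrow> d'"
      using lim_energy[OF H2(1) sz] by (simp add: d'_def mult.assoc)
    \<comment> \<open>The limit is taken for fixed \<open>t\<close>: the defect integral vanishes in
      spite of its large factor \<open>R / (2 * t)\<close>, and \<open>d\<close>, \<open>d'\<close>
      do not depend on \<open>t\<close>.\<close>
    have "3 / 2 * ?wt - 4 * ?wz - 1 / 2 * d \<le> 4 * d' + t * (R / 2 * d)" if t: "t > 0" for t
    proof -
      have "3 / 2 * ?wt - 4 * ?wz - 1 / 2 * d \<le> R / (2 * t) * 0 + R * t / 2 * d + 4 * d'"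
        by (rule LIMSEQ_le[OF _ _ exI, OF tendsto_diff[OF tendsto_diff[OF
                tendsto_mult[OF tendsto_const lim_products[OF ct st]] tendsto_mult[OF tendsto_const lim_products[OF cz sz]]]
              tendsto_mult[OF tendsto_const limd]]
              tendsto_add[OF tendsto_add[OF tendsto_mult[OF tendsto_const lim_err[OF ct st]] tendsto_mult[OF tendsto_const limd]]
              tendsto_mult[OF tendsto_const limd']]])
          (intro allI impI pohozaev_approximation R t)
      then show ?thesis by (simp add: mult_ac)
    qed
    then have "3 / 2 * ?wt - 4 * ?wz - 1 / 2 * d \<le> 4 * d'"
      by (rule le_if_le_add_mult)
    moreover have "\<bar>d - 2 * ?wt\<bar> \<le> 36 * C / R" "\<bar>d' - 2 * ?wz\<bar> \<le> 36 * C / R"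
      using lap[OF R1 H(2)] lap[OF R1 H2(2)] by (simp_all add: d_def d'_def)
    moreover have "0 \<le> C / R" using C(1) R by simp
    ultimately show ?thesis
      using limd by (intro conjI exI[of _ d]) (auto simp: abs_le_iff)
  qed
  show ?thesis
    by (intro exI[of _ "162 * C"] allI impI *)
qed

text \<open>For growing radius \<open>theta\<close> tends to 1 and \<open>zeta\<close> to 0,
  dominated by \<open>w\<close>, so \<open>pohozaev_inequality\<close> leaves half the integral of
  \<open>w\<close> on the left and 0 on the right.\<close>

lemma w_AE_zero: "AE x in lebesgue. w x = 0"
proof -
  obtain C where C: "\<And>R. R \<ge> 1 \<Longrightarrow>
    (LINT x|lebesgue. w x * theta R x) / 2 \<le> 12 * (LINT x|lebesgue. w x * zeta R x) + C / R"
    using pohozaev_inequality by blast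
  have lim: "(\<lambda>n. LINT x|lebesgue. w x * f (real n) x) \<longlonglongrightarrow> (LINT x|lebesgue. w x * c)"
    if f: "\<And>R. continuous_on UNIV (f R)" "\<And>R x. 0 \<le> f R x" "\<And>R x. f R x \<le> 1"
      "\<And>x. (\<lambda>n. f (real n) x) \<longlonglongrightarrow> c" for f :: "real \<Rightarrow> R3 \<Rightarrow> real" and c
  proof -
    have "(\<lambda>n. LINT x|lebesgue. w x * f (real (Suc n)) x) \<longlonglongrightarrow> (LINT x|lebesgue. w x * c)"
    proof (rule integral_dominated_convergence[OF _ _ w_integrable])
      show "(\<lambda>x. w x * c) \<in> borel_measurable lebesgue" using w_meas by simp
      show "(\<lambda>x. w x * f (real (Suc n)) x) \<in> borel_measurable lebesgue" for n
        by (intro borel_measurable_times w_meas continuous_imp_lebesgue_measurable f)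
      show "AE x in lebesgue. (\<lambda>n. w x * f (real (Suc n)) x) \<longlonglongrightarrow> w x * c"
        by (intro AE_I2 tendsto_intros LIMSEQ_Suc f)
      show "AE x in lebesgue. norm (w x * f (real (Suc n)) x) \<le> w x" for n
        using f(2,3)[of "real (Suc n)"] by (intro AE_I2) (simp add: w_nonneg abs_mult mult_left_le)
    qed
    then show ?thesis by (rule LIMSEQ_imp_Suc)
  qed
  have l1: "(\<lambda>n. LINT x|lebesgue. w x * theta (real n) x) \<longlonglongrightarrow> (LINT x|lebesgue. w x * 1)"
    by (rule lim[OF theta_continuous theta_01 theta_tendsto])
  have l2: "(\<lambda>n. LINT x|lebesgue. w x * zeta (real n) x) \<longlonglongrightarrow> (LINT x|lebesgue. w x * 0)"
    by (rule lim[OF zeta_continuous zeta_01 zeta_tendsto])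
  have l3: "(\<lambda>n. C * (1 / real n)) \<longlonglongrightarrow> C * 0"
    by (intro tendsto_intros lim_1_over_n)
  have "(LINT x|lebesgue. w x * 1) / 2 \<le> 12 * (LINT x|lebesgue. w x * 0) + C * 0"
    by (rule LIMSEQ_le[OF tendsto_divide[OF l1 tendsto_const] tendsto_add[OF tendsto_mult[OF tendsto_const l2] l3]])
      (use C in \<open>auto intro!: exI[of _ 1]\<close>)
  then have "(LINT x|lebesgue. w x) = 0"
    using integral_nonneg_AE[of w lebesgue] w_nonneg by (simp add: order_antisym)
  then show ?thesis
    using integral_nonneg_eq_0_iff_AE[OF w_integrable] w_nonneg by simp
qed

text \<open>Once \<open>w\<close> vanishes almost everywhere, the limiting energies with weight
  \<open>theta R\<close> are at most C/R. Integration by parts and Young's inequality bound the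
  pairing by \<open>t * (A / 2)\<close> plus a term of order 1/(t R); first \<open>R\<close> tends
  to infinity, then \<open>t\<close> to 0.\<close>

lemma weak_gradient_vanishes:
  assumes \<eta>: "\<eta> \<in> C1c"
  shows "(LINT x|lebesgue. u x * (grad \<eta> x $ i)) = 0"
proof -
  note \<eta>1 = C1c_D(1)[OF \<eta>] and s = C1c_D(2)[OF \<eta>]
  define L where "L = (LINT x|lebesgue. u x * (grad \<eta> x $ i))"
  have s': "bounded {x. grad \<eta> x $ i \<noteq> 0}"
    by (rule bounded_subset[OF is_C1_support[OF \<eta>1 s]]) auto
  have k': "continuous_on UNIV (\<lambda>x. grad \<eta> x $ i)"
    by (intro continuous_intros is_C1_continuous_grad[OF \<eta>1])
  have k: "continuous_on UNIV \<eta>" by (rule is_C1_continuous[OF \<eta>1])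
  have lim: "(\<lambda>n. LINT x|lebesgue. U n x * (grad \<eta> x $ i)) \<longlonglongrightarrow> L"
    unfolding L_def
    by (rule bounded_convergence_test[OF _ U_bound u_meas U_lim k' s'])
      (intro continuous_imp_lebesgue_measurable cont)
  obtain R\<^sub>0 where R\<^sub>0: "R\<^sub>0 > 0" "\<And>x. x \<notin> cball 0 R\<^sub>0 \<Longrightarrow> \<eta> x = 0"
    using bounded_support_obtain[OF s] by blast
  obtain b where b: "b > 0" "\<And>x. norm (\<eta> x) \<le> b"
    using continuous_support_bounded[OF k s] by blast
  define A where "A = (LINT x|lebesgue. \<bar>\<eta> x\<bar>)"
  have i\<eta>: "integrable lebesgue (\<lambda>x. \<bar>\<eta> x\<bar>)"
    by (intro integrable_abs integrable_continuous_support k s)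
  obtain C where C: "\<And>R. R \<ge> 1 \<Longrightarrow> \<exists>d. (\<lambda>n. LINT x|lebesgue. D n x * theta R x) \<longlonglongrightarrow> d \<and>
      d \<le> 2 * (LINT x|lebesgue. w x * theta R x) + C / R"
    using pohozaev_inequality by blast
  \<comment> \<open>\<open>R \<ge> 2 * R\<^sub>0\<close> places the support of \<open>\<eta>\<close>
    where \<open>theta R\<close> is at least 1/4; hence |\<eta>| is at most 4 b
    \<open>theta R\<close>, and 2 b / t is 4 b / (2 t).\<close>
  have "\<bar>L\<bar> \<le> t * (A / 2) + (2 * b / t * C) / R" if t: "t > 0" and R: "R \<ge> max 1 (2 * R\<^sub>0)" for t R
  proof -
    have R0: "R > 0" using R by simp
    note ct = theta_continuous[of R] and st = theta_bounded_support[OF R0]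
    have "(LINT x|lebesgue. w x * theta R x) = (LINT x|(lebesgue :: R3 measure). 0)"
      using w_AE_zero w_meas continuous_imp_lebesgue_measurable[OF ct] by (intro integral_cong_AE) auto
    then obtain d where d: "(\<lambda>n. LINT x|lebesgue. D n x * theta R x) \<longlonglongrightarrow> d" "d \<le> C / R"
      using C[of R] R by auto
    have iD: "integrable lebesgue (\<lambda>x. D n x * theta R x)" for n
      by (intro integrable_continuous_mult_support cont_D ct st)
    have bound: "\<bar>LINT x|lebesgue. U n x * (grad \<eta> x $ i)\<bar> \<le> t * (A / 2) + 2 * b / t * (LINT x|lebesgue. D n x * theta R x)" for n
    proof -
      have sm: "bounded {x. U n x * \<eta> x \<noteq> 0}" by (rule bounded_subset[OF s]) auto
      have i1: "integrable lebesgue (\<lambda>x. U n x * (grad \<eta> x $ i))"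
        by (intro integrable_continuous_mult_support cont k' s')
      have i2: "integrable lebesgue (\<lambda>x. GU n x $ i * \<eta> x)"
        by (intro integrable_continuous_mult_support continuous_intros cont k s)
      have "(LINT x|lebesgue. (U n x *\<^sub>R grad \<eta> x + \<eta> x *\<^sub>R GU n x) \<bullet> axis i 1) = 0"
        by (rule integral_grad_zero[OF is_C1_mult[OF is_C2_imp_C1[OF U_C2] \<eta>1] sm])
      then have "(LINT x|lebesgue. U n x * (grad \<eta> x $ i) + GU n x $ i * \<eta> x) = 0"
        by (simp add: inner_axis mult.commute)
      then have "\<bar>LINT x|lebesgue. U n x * (grad \<eta> x $ i)\<bar> = \<bar>LINT x|lebesgue. GU n x $ i * \<eta> x\<bar>"
        using i1 i2 by (simp add: Bochner_Integration.integral_add)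
      also have "\<dots> \<le> (LINT x|lebesgue. \<bar>GU n x $ i * \<eta> x\<bar>)"
        by (rule integral_abs_bound)
      also have "\<dots> \<le> (LINT x|lebesgue. t / 2 * \<bar>\<eta> x\<bar> + 2 * b / t * (D n x * theta R x))"
      proof (rule integral_mono)
        fix x
        have y: "c * 1 \<le> t / 2 + c\<^sup>2 / (2 * t)" for c
        proof -
          have "0 \<le> (c - t)\<^sup>2 / (2 * t)" using t by simp
          also have "\<dots> = t / 2 + c\<^sup>2 / (2 * t) - c"
            using t by (simp add: power2_diff field_simps power2_eq_square)
          finally show ?thesis by simp
        qed
        have "\<bar>GU n x $ i * \<eta> x\<bar> \<le> (t / 2 + \<bar>GU n x $ i\<bar>\<^sup>2 / (2 * t)) * \<bar>\<eta> x\<bar>"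
          unfolding abs_mult using y[of "\<bar>GU n x $ i\<bar>"] by (intro mult_right_mono) auto
        also have "\<dots> = t / 2 * \<bar>\<eta> x\<bar> + \<bar>GU n x $ i\<bar>\<^sup>2 * \<bar>\<eta> x\<bar> / (2 * t)"
          by (simp add: distrib_right)
        also have "\<bar>GU n x $ i\<bar>\<^sup>2 * \<bar>\<eta> x\<bar> \<le> D n x * (4 * b * theta R x)"
        proof (rule mult_mono)
          have "\<bar>GU n x $ i\<bar>\<^sup>2 \<le> (norm (GU n x))\<^sup>2"
            by (intro power_mono component_le_norm_cart) simp
          then show "\<bar>GU n x $ i\<bar>\<^sup>2 \<le> D n x" by (simp add: D_def add_increasing2)
          show "\<bar>\<eta> x\<bar> \<le> 4 * b * theta R x"
          proof (cases "x \<in> cball 0 R\<^sub>0")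
            case True
            then have "1 / 4 \<le> theta R x" using R by (intro theta_ge R0) auto
            then have "b * 1 \<le> b * (4 * theta R x)" using b(1) by (intro mult_left_mono) auto
            then show ?thesis using b(2)[of x] by simp
          next
            case False
            then show ?thesis using R\<^sub>0(2)[OF False] b(1) theta_01(1)[of R x] by simp
          qed
        qed (simp_all add: D_nonneg)
        finally show "\<bar>GU n x $ i * \<eta> x\<bar> \<le> t / 2 * \<bar>\<eta> x\<bar> + 2 * b / t * (D n x * theta R x)"
          using t by (simp add: divide_right_mono mult_ac)
      qed (intro Bochner_Integration.integrable_add integrable_mult_right integrable_abs i2 i\<eta> iD)+
      also have "\<dots> = t / 2 * A + 2 * b / t * (LINT x|lebesgue. D n x * theta R x)"
        using i\<eta> iD by (subst Bochner_Integration.integral_add) (auto simp: A_def intro!: integrable_mult_right)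
      finally show ?thesis by simp
    qed
    have "\<bar>L\<bar> \<le> t * (A / 2) + 2 * b / t * d"
      by (rule LIMSEQ_le[OF tendsto_rabs[OF lim] tendsto_add[OF tendsto_const tendsto_mult[OF tendsto_const d(1)]]])
        (use bound in blast)
    also have "2 * b / t * d \<le> 2 * b / t * (C / R)"
      using b(1) t by (intro mult_left_mono d) auto
    finally show ?thesis by simp
  qed
  then have "\<bar>L\<bar> \<le> t * (A / 2)" if "t > 0" for t
    using le_if_le_add_div[of "max 1 (2 * R\<^sub>0)" "\<bar>L\<bar>" "t * (A / 2)" "2 * b / t * C"] that by blast
  then have "\<bar>L\<bar> \<le> 0" using le_if_le_add_mult[of "\<bar>L\<bar>" 0 "A / 2"] by simp
  then show ?thesis by (simp add: L_def)
qed

text \<open>For a mollification each gradient value is a pairing as in \<open>weak\<close>, so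
  \<open>weak_gradient_vanishes\<close> makes every \<open>U n\<close> constant. The limit constant
  \<open>l\<close> has mass of order l^2 R^3 on balls, against the linear bound of
  \<open>growth_bounds\<close>.\<close>

lemma u_AE_zero:
  assumes weak: "\<And>n x. \<exists>\<eta>\<in>C1c. \<forall>i. GU n x $ i = - (LINT y|lebesgue. u y * (grad \<eta> y $ i))"
  shows "AE x in lebesgue. u x = 0"
proof -
  have G0: "GU n x = 0" for n x
    using weak[of n x] weak_gradient_vanishes by (auto simp: vec_eq_iff)
  have "\<exists>c. \<forall>x. U n x = c" for n
  proof -
    have "(U n has_derivative (\<lambda>h. 0)) (at x within UNIV)" for x
      using is_C2_imp_C1[OF U_C2[of n]] by (simp add: is_C1_def gderiv_def G0)
    then show ?thesis
      using has_derivative_zero_constant[of UNIV "U n"] by auto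
  qed
  then obtain c where c: "\<And>n x. U n x = c n" by metis
  \<comment> \<open>This set does not depend on \<open>x\<close>: it is empty or the whole space, in
    either case closed, and it contains almost every point.\<close>
  have "AE x in lebesgue. x \<in> {x :: R3. \<exists>l. c \<longlonglongrightarrow> l}"
    using U_lim by eventually_elim (auto simp: c)
  then have "(0 :: R3) \<in> {x. \<exists>l. c \<longlonglongrightarrow> l}"
    by (rule mem_closed_if_AE_lebesgue[rotated]) simp
  then obtain l where l: "c \<longlonglongrightarrow> l"
    by blast
  have ul: "AE x in lebesgue. u x = l"
    using U_lim by eventually_elim (use l in \<open>auto simp: c intro: LIMSEQ_unique\<close>)
  obtain C where C: "C \<ge> 0" "\<And>R. R \<ge> 1 \<Longrightarrow> (LINT x|lebesgue. cball_ind R x * q x) \<le> C * R"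
    using growth_bounds by metis
  obtain \<omega> where \<omega>: "\<omega> > 0" "\<And>R. R \<ge> 0 \<Longrightarrow> measure lebesgue (cball (0::R3) R) = \<omega> * R ^ 3"
    using measure_cball_R3 by blast
  have "\<omega> * l\<^sup>2 \<le> 0 + C / R" if R: "R \<ge> 1" for R
  proof -
    have "\<omega> * R ^ 3 * l\<^sup>2 = (LINT x|lebesgue. cball_ind R x * l\<^sup>2)"
      using \<omega>(2)[of R] R by simp
    also have "\<dots> \<le> (LINT x|lebesgue. cball_ind R x * q x)"
    proof (rule integral_mono_AE[OF integrable_indicator_cball integrable_indicator_q(1)])
      show "AE x in lebesgue. cball_ind R x * l\<^sup>2 \<le> cball_ind R x * q x"
        using ul by eventually_elim (auto simp: q_def intro!: mult_left_mono)
    qed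
    also have "\<dots> \<le> C * R" by (rule C(2)[OF R])
    finally have "(\<omega> * l\<^sup>2 * R\<^sup>2) * R \<le> C * R"
      by (simp add: power2_eq_square power3_eq_cube mult_ac)
    then have "\<omega> * l\<^sup>2 * R\<^sup>2 \<le> C" using R by simp
    \<comment> \<open>Weakening R^2 to R brings the bound into the form required by
      \<open>le_if_le_add_div\<close>.\<close>
    moreover have "\<omega> * l\<^sup>2 * R \<le> \<omega> * l\<^sup>2 * R\<^sup>2"
      using R \<omega>(1) by (intro mult_left_mono) (auto simp: power2_eq_square)
    ultimately show ?thesis using R by (simp add: field_simps)
  qed
  then have "\<omega> * l\<^sup>2 \<le> 0" by (rule le_if_le_add_div)
  then have "l = 0" using \<omega>(1) by (simp add: mult_le_0_iff)
  then show ?thesis using ul by simp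
qed

text \<open>The system and the form are symmetric, so \<open>u_AE_zero\<close> also yields the
  vanishing of \<open>v\<close>.\<close>

lemma swap: "approximated_solution v u M r V U GV GU HV HU"
proof
  show "AE x in lebesgue. (\<lambda>n. - trace (HV n x)) \<longlonglongrightarrow> v x * (u x)\<^sup>2"
    using HV_lim by (simp add: mult.commute)
  show "AE x in lebesgue. (\<lambda>n. - trace (HU n x)) \<longlonglongrightarrow> (v x)\<^sup>2 * u x"
    using HU_lim by (simp add: mult.commute)
  fix \<phi> \<psi> assume C: "\<phi> \<in> C1c" "\<psi> \<in> C1c" and z: "\<And>x. x \<in> cball 0 r \<Longrightarrow> \<phi> x = 0 \<and> \<psi> x = 0"
  have "Q_form v u (\<phi>, \<psi>) = Q_form u v (\<psi>, \<phi>)"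
    by (simp add: Q_form_def algebra_simps)
  then show "0 \<le> Q_form v u (\<phi>, \<psi>)"
    using stable[OF C(2,1)] z by auto
qed (use u_meas u_bound v_meas v_bound U_C2 V_C2 U_bound V_bound HU_bound HV_bound U_lim V_lim r_pos in auto)

end

section \<open>Bounded representatives\<close>

text \<open>The estimates use bounds at every point, whereas the solution is only essentially
  bounded. This lemma and the next two move the hypotheses to truncated representatives.\<close>

lemma weakly_solves_poisson_cong_AE:
  assumes w: "weakly_solves_poisson u f" and u: "u \<in> borel_measurable lebesgue" and f: "f \<in> borel_measurable lebesgue"
    and L1: "u' \<in> L1_loc" "f' \<in> L1_loc"
    and u': "u' \<in> borel_measurable lebesgue" and f': "f' \<in> borel_measurable lebesgue"
    and eq: "AE x in lebesgue. u x = u' x" "AE x in lebesgue. f x = f' x"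
  shows "weakly_solves_poisson u' f'"
proof -
  obtain g where g: "has_weak_gradient u g" and pde: "\<And>\<eta>. \<eta> \<in> C1c \<Longrightarrow>
      (LINT x|lebesgue. g x \<bullet> grad \<eta> x) = (LINT x|lebesgue. f x * \<eta> x)"
    using w by (auto simp: weakly_solves_poisson_def)
  have m: "\<eta> \<in> borel_measurable lebesgue" "grad \<eta> \<in> borel_measurable lebesgue" if "\<eta> \<in> C1c" for \<eta>
    using is_C1_continuous[OF C1c_D(1)[OF that]] is_C1_continuous_grad[OF C1c_D(1)[OF that]]
    by (auto intro: continuous_imp_lebesgue_measurable)
  have 1: "(LINT x|lebesgue. u x *\<^sub>R grad \<eta> x) = (LINT x|lebesgue. u' x *\<^sub>R grad \<eta> x)" if "\<eta> \<in> C1c" for \<eta>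
    by (rule integral_cong_AE)
      (use eq(1) in \<open>auto intro!: borel_measurable_scaleR u u' m[OF that] elim: eventually_mono\<close>)
  have 2: "(LINT x|lebesgue. f x * \<eta> x) = (LINT x|lebesgue. f' x * \<eta> x)" if "\<eta> \<in> C1c" for \<eta>
    by (rule integral_cong_AE)
      (use eq(2) in \<open>auto intro!: borel_measurable_times f f' m[OF that] elim: eventually_mono\<close>)
  show ?thesis
    using g pde 1 2 L1 by (auto simp: weakly_solves_poisson_def has_weak_gradient_def)
qed

lemma Q_form_cong_AE:
  assumes "u \<in> borel_measurable lebesgue" "v \<in> borel_measurable lebesgue"
    "u' \<in> borel_measurable lebesgue" "v' \<in> borel_measurable lebesgue"
    and eq: "AE x in lebesgue. u x = u' x" "AE x in lebesgue. v x = v' x"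
    and p: "p \<in> C1c \<times> C1c"
  shows "Q_form u v p = Q_form u' v' p"
proof -
  obtain \<phi> \<psi> where p': "p = (\<phi>, \<psi>)" "\<phi> \<in> C1c" "\<psi> \<in> C1c" using p by auto
  have [measurable]: "\<phi> \<in> borel_measurable lebesgue" "\<psi> \<in> borel_measurable lebesgue"
    using p' is_C1_continuous[OF C1c_D(1)] by (auto intro: continuous_imp_lebesgue_measurable)
  note assms(1-4)[measurable]
  have "(LINT x|lebesgue. (v x)\<^sup>2 * (\<phi> x)\<^sup>2 + (u x)\<^sup>2 * (\<psi> x)\<^sup>2 + 4 * u x * v x * \<phi> x * \<psi> x) =
    (LINT x|lebesgue. (v' x)\<^sup>2 * (\<phi> x)\<^sup>2 + (u' x)\<^sup>2 * (\<psi> x)\<^sup>2 + 4 * u' x * v' x * \<phi> x * \<psi> x)"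
  proof (rule integral_cong_AE)
    show "AE x in lebesgue. (v x)\<^sup>2 * (\<phi> x)\<^sup>2 + (u x)\<^sup>2 * (\<psi> x)\<^sup>2 + 4 * u x * v x * \<phi> x * \<psi> x =
      (v' x)\<^sup>2 * (\<phi> x)\<^sup>2 + (u' x)\<^sup>2 * (\<psi> x)\<^sup>2 + 4 * u' x * v' x * \<phi> x * \<psi> x"
      using eq by eventually_elim simp
  qed measurable
  then show ?thesis by (simp add: Q_form_def p')
qed

lemma morse_index_cong:
  assumes "\<And>p. p \<in> C1c \<times> C1c \<Longrightarrow> Q_form u v p = Q_form u' v' p"
  shows "morse_index u v = morse_index u' v'"
proof -
  have "(\<forall>w\<in>W. w \<noteq> 0 \<longrightarrow> Q_form u v w < 0) \<longleftrightarrow> (\<forall>w\<in>W. w \<noteq> 0 \<longrightarrow> Q_form u' v' w < 0)"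
    if "W \<subseteq> C1c \<times> C1c" for W
    by (rule ball_cong[OF refl]) (simp only: assms[OF subsetD[OF that]])
  then have "{W. subspace W \<and> W \<subseteq> C1c \<times> C1c \<and> (\<forall>w\<in>W. w \<noteq> 0 \<longrightarrow> Q_form u v w < 0)} =
      {W. subspace W \<and> W \<subseteq> C1c \<times> C1c \<and> (\<forall>w\<in>W. w \<noteq> 0 \<longrightarrow> Q_form u' v' w < 0)}"
    by (intro Collect_cong conj_cong refl)
  then show ?thesis unfolding morse_index_def by (rule arg_cong)
qed

lemma bounded_solution_vanishes:
  assumes u: "u \<in> borel_measurable lebesgue" "\<And>x. \<bar>u x\<bar> \<le> M"
    and v: "v \<in> borel_measurable lebesgue" "\<And>x. \<bar>v x\<bar> \<le> M"
    and eqs: "weakly_solves_poisson u (\<lambda>x. u x * (v x)\<^sup>2)" "weakly_solves_poisson v (\<lambda>x. (u x)\<^sup>2 * v x)"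
    and fin: "morse_index u v < \<infinity>"
  shows "AE x in lebesgue. u x = 0" "AE x in lebesgue. v x = 0"
proof -
  obtain r where r: "r > 0" and stable: "\<And>\<phi> \<psi>. \<phi> \<in> C1c \<Longrightarrow> \<psi> \<in> C1c \<Longrightarrow>
    (\<And>x. x \<in> cball 0 r \<Longrightarrow> \<phi> x = 0 \<and> \<psi> x = 0) \<Longrightarrow> Q_form u v (\<phi>, \<psi>) \<ge> 0"
    using finite_morse_index_imp_stable_outside_ball[OF u v fin] by metis
  define f where "f x = u x * (v x)\<^sup>2" for x
  define h where "h x = (u x)\<^sup>2 * v x" for x
  have f: "f \<in> borel_measurable lebesgue" "\<bar>f x\<bar> \<le> M * (M * M)" for x
    unfolding f_def[abs_def] power2_eq_square
    by (intro borel_measurable_times u v, intro abs_mult_le u v)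
  have h: "h \<in> borel_measurable lebesgue" "\<bar>h x\<bar> \<le> M * M * M" for x
    unfolding h_def[abs_def] power2_eq_square
    by (intro borel_measurable_times u v, intro abs_mult_le u v)
  \<comment> \<open>The right-hand sides are mollified with the same kernels as \<open>u\<close> and
    \<open>v\<close>, because \<open>weak_poisson_conv\<close> identifies them with minus the
    Laplacians of the mollifications.\<close>
  obtain k where k: "\<And>n::nat. \<exists>\<epsilon>. is_mollifier \<epsilon> (k n)"
    and lim: "\<And>g. g \<in> {u, v, f, h} \<Longrightarrow> AE x in lebesgue. (\<lambda>n. conv g (k n) x) \<longlonglongrightarrow> g x"
  \<comment> \<open>One bound for all four functions: \<open>M\<close> for the unknowns and its cube
    for the right-hand sides.\<close>
  proof (rule mollifiers_AE_converge[of "{u, v, f, h}" "max M (M * M * M)"])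
    show "\<bar>g x\<bar> \<le> max M (M * M * M)" if "g \<in> {u, v, f, h}" for g x
      using that u(2)[of x] v(2)[of x] f(2)[of x] h(2)[of x] by (auto simp: mult.assoc)
  qed (use u v f h in auto)
  have "\<exists>k' k''. is_C2 (k n) k' k''" for n
    using k[of n] by (auto simp: is_mollifier_def)
  then obtain k' k'' where k2: "\<And>n. is_C2 (k n) (k' n) (k'' n)"
    by metis
  have ks: "bounded {x. k n x \<noteq> 0}" for n
    using k is_mollifier_support by blast
  note k1 = is_C2_imp_C1[OF k2]
  have cb: "\<bar>conv g (k n) x\<bar> \<le> C" if "g \<in> borel_measurable lebesgue" "\<And>x. \<bar>g x\<bar> \<le> C" for g C n x
    using k[of n] mollifier_conv_bounded[OF that] by blast
  have L1: "u \<in> L1_loc" "v \<in> L1_loc"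
    by (rule bounded_L1_loc[OF u], rule bounded_L1_loc[OF v])
  have trU: "trace (\<chi> i j. conv u (\<lambda>z. k'' n z $ i $ j) x) = - conv f (k n) x" for n x
    using weak_poisson_conv[OF eqs(1) k2 ks] by (simp add: f_def[abs_def])
  have trV: "trace (\<chi> i j. conv v (\<lambda>z. k'' n z $ i $ j) x) = - conv h (k n) x" for n x
    using weak_poisson_conv[OF eqs(2) k2 ks] by (simp add: h_def[abs_def])
  interpret approximated_solution u v M r "\<lambda>n. conv u (k n)" "\<lambda>n. conv v (k n)"
    "\<lambda>n x. \<chi> i. conv u (\<lambda>z. k' n z $ i) x" "\<lambda>n x. \<chi> i. conv v (\<lambda>z. k' n z $ i) x"
    "\<lambda>n x. \<chi> i j. conv u (\<lambda>z. k'' n z $ i $ j) x" "\<lambda>n x. \<chi> i j. conv v (\<lambda>z. k'' n z $ i $ j) x"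
  proof
    show "is_C2 (conv u (k n)) (\<lambda>x. \<chi> i. conv u (\<lambda>z. k' n z $ i) x) (\<lambda>x. \<chi> i j. conv u (\<lambda>z. k'' n z $ i $ j) x)"
      "is_C2 (conv v (k n)) (\<lambda>x. \<chi> i. conv v (\<lambda>z. k' n z $ i) x) (\<lambda>x. \<chi> i j. conv v (\<lambda>z. k'' n z $ i $ j) x)" for n
      by (rule conv_is_C2[OF L1(1) k2 ks], rule conv_is_C2[OF L1(2) k2 ks])
    show "\<bar>trace (\<chi> i j. conv u (\<lambda>z. k'' n z $ i $ j) x)\<bar> \<le> M * (M * M)" for n x
      unfolding trU abs_minus_cancel by (rule cb[OF f])
    show "\<bar>trace (\<chi> i j. conv v (\<lambda>z. k'' n z $ i $ j) x)\<bar> \<le> M * (M * M)" for n x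
      unfolding trV abs_minus_cancel mult.assoc[symmetric] by (rule cb[OF h])
    show "AE x in lebesgue. (\<lambda>n. - trace (\<chi> i j. conv u (\<lambda>z. k'' n z $ i $ j) x)) \<longlonglongrightarrow> u x * (v x)\<^sup>2"
      unfolding trU using lim[of f] by (simp add: f_def)
    show "AE x in lebesgue. (\<lambda>n. - trace (\<chi> i j. conv v (\<lambda>z. k'' n z $ i $ j) x)) \<longlonglongrightarrow> (u x)\<^sup>2 * v x"
      unfolding trV using lim[of h] by (simp add: h_def)
  qed (use u v r stable lim cb[OF u] cb[OF v] in auto)
  \<comment> \<open>The witness is the reflected kernel, and the minus sign is that of its
    gradient.\<close>
  have weak: "\<exists>\<eta>\<in>C1c. \<forall>i. (\<chi> i. conv g (\<lambda>z. k' n z $ i) x) $ i = - (LINT y|lebesgue. g y * (grad \<eta> y $ i))" for g n x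
    by (rule bexI[OF _ reflected_test(1)[OF k1 ks, of n x]]) (simp add: reflected_test(2)[OF k1 ks] conv_def)
  show "AE x in lebesgue. u x = 0"
    by (rule u_AE_zero[OF weak])
  show "AE x in lebesgue. v x = 0"
    by (rule approximated_solution.u_AE_zero[OF swap weak])
qed

text \<open>Offering every large \<open>C\<close> lets the representatives of \<open>u\<close> and
  \<open>v\<close> share one bound.\<close>

lemma L_infinity_bounded_representative:
  assumes "u \<in> L_infinity"
  obtains M where "\<And>C. C \<ge> M \<Longrightarrow> \<exists>u'\<in>borel_measurable lebesgue. (\<forall>x. \<bar>u' x\<bar> \<le> C) \<and> (AE x in lebesgue. u x = u' x)"
proof -
  obtain M where u: "u \<in> borel_measurable lebesgue" and M: "AE x in lebesgue. \<bar>u x\<bar> \<le> M"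
    using assms by (auto simp: L_infinity_def)
  show thesis
  proof (rule that[of "max 0 M"])
    fix C assume C: "C \<ge> max 0 M"
    show "\<exists>u'\<in>borel_measurable lebesgue. (\<forall>x. \<bar>u' x\<bar> \<le> C) \<and> (AE x in lebesgue. u x = u' x)"
    proof (intro bexI[of _ "\<lambda>x. max (- C) (min C (u x))"] conjI)
      show "AE x in lebesgue. u x = max (- C) (min C (u x))"
        using M by eventually_elim (use C in auto)
    qed (use C u in auto)
  qed
qed

theorem proposition3p2:
  fixes u v :: "real ^ 3 \<Rightarrow> real"
  assumes "weak_solution u v"
    and "u \<in> L_infinity" and "v \<in> L_infinity"
    and "morse_index u v < \<infinity>"
  shows "(AE x in lebesgue. u x = 0) \<and> (AE x in lebesgue. v x = 0)"
proof -
  have m: "u \<in> borel_measurable lebesgue" "v \<in> borel_measurable lebesgue"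
    using assms(2,3) by (auto simp: L_infinity_def)
  obtain A where A: "\<And>C. C \<ge> A \<Longrightarrow> \<exists>u'\<in>borel_measurable lebesgue. (\<forall>x. \<bar>u' x\<bar> \<le> C) \<and> (AE x in lebesgue. u x = u' x)"
    using L_infinity_bounded_representative[OF assms(2)] by blast
  obtain B where B: "\<And>C. C \<ge> B \<Longrightarrow> \<exists>v'\<in>borel_measurable lebesgue. (\<forall>x. \<bar>v' x\<bar> \<le> C) \<and> (AE x in lebesgue. v x = v' x)"
    using L_infinity_bounded_representative[OF assms(3)] by blast
  define M where "M = max A B"
  obtain u' where u': "u' \<in> borel_measurable lebesgue" "\<And>x. \<bar>u' x\<bar> \<le> M" and uu': "AE x in lebesgue. u x = u' x"
    using A[of M] by (auto simp: M_def)
  obtain v' where v': "v' \<in> borel_measurable lebesgue" "\<And>x. \<bar>v' x\<bar> \<le> M" and vv': "AE x in lebesgue. v x = v' x"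
    using B[of M] by (auto simp: M_def)
  have b: "\<bar>u' x * (v' x)\<^sup>2\<bar> \<le> M * (M * M)" "\<bar>(u' x)\<^sup>2 * v' x\<bar> \<le> M * M * M" for x
    unfolding power2_eq_square by (intro abs_mult_le u' v')+
  have mb: "(\<lambda>x. u' x * (v' x)\<^sup>2) \<in> borel_measurable lebesgue" "(\<lambda>x. (u' x)\<^sup>2 * v' x) \<in> borel_measurable lebesgue"
    using u'(1) v'(1) by simp_all
  have "weakly_solves_poisson u' (\<lambda>x. u' x * (v' x)\<^sup>2)"
  proof (rule weakly_solves_poisson_cong_AE)
    show "weakly_solves_poisson u (\<lambda>x. u x * (v x)\<^sup>2)" using assms(1) by (simp add: weak_solution_def)
    show "AE x in lebesgue. u x * (v x)\<^sup>2 = u' x * (v' x)\<^sup>2" using uu' vv' by eventually_elim simp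
  qed (use m u' uu' mb in \<open>auto intro: bounded_L1_loc[OF u'] bounded_L1_loc[OF mb(1) b(1)]\<close>)
  moreover have "weakly_solves_poisson v' (\<lambda>x. (u' x)\<^sup>2 * v' x)"
  proof (rule weakly_solves_poisson_cong_AE)
    show "weakly_solves_poisson v (\<lambda>x. (u x)\<^sup>2 * v x)" using assms(1) by (simp add: weak_solution_def)
    show "AE x in lebesgue. (u x)\<^sup>2 * v x = (u' x)\<^sup>2 * v' x" using uu' vv' by eventually_elim simp
  qed (use m v' vv' mb in \<open>auto intro: bounded_L1_loc[OF v'] bounded_L1_loc[OF mb(2) b(2)]\<close>)
  moreover have "morse_index u' v' < \<infinity>"
    using assms(4) morse_index_cong[OF Q_form_cong_AE[OF m u'(1) v'(1) uu' vv']] by simp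
  ultimately have "AE x in lebesgue. u' x = 0" "AE x in lebesgue. v' x = 0"
    by (rule bounded_solution_vanishes[OF u' v'])+
  then show ?thesis
    using uu' vv' by (auto elim: eventually_elim2)
qed

end
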